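(* Let $d\geq 3$ be an integer, let $\Omega\subset\mathbb{R}^d$ be a bounded $C^2$ domain, and let $\nu$ denote the outward unit normal vector field on $\partial\Omega$. Then $$\int_{\partial\Omega}\int_{\partial\Omega}\frac{|\nu(x)-\nu(y)|}{|x-y|^{d-1}}\,d\sigma(x)\,d\sigma(y)\;\geq\;\sigma(\partial\Omega)\,\sigma(\mathbb{S}^{d-1}),$$ and equality is attained if and only if $\Omega$ is a ball.
   Context: $\sigma$ denotes the surface measure, i.e. the $(d-1)$-dimensional Hausdorff measure restricted to the hypersurface under consideration ($\partial\Omega$ or the unit sphere $\mathbb{S}^{d-1}$ of $\mathbb{R}^d$). *)

theory Defs
  imports "HOL-Analysis.Analysis"
begin

section \<open>Hausdorff measure\<close>

text \<open>
  The size of a set in the \<open>k\<close>-dimensional Hausdorff construction, normalised so that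
  \<open>k\<close>-dimensional Hausdorff measure agrees with Lebesgue measure in dimension \<open>k\<close> and
  with surface measure on hypersurfaces.  The empty set is singled out because \<open>0 ^ 0 = 1\<close>.
\<close>

definition hausdorff_size :: "nat \<Rightarrow> 'a::metric_space set \<Rightarrow> ennreal" where
  "hausdorff_size k U =
     (if U = {} then 0 else ennreal (unit_ball_vol (real k) * (diameter U / 2) ^ k))"

text \<open>
  Boundedness of the covering sets is required explicitly because \<^const>\<open>diameter\<close> is
  a real number and is meaningless for unbounded sets.
\<close>

definition hausdorff_pre :: "nat \<Rightarrow> real \<Rightarrow> 'a::metric_space set \<Rightarrow> ennreal" where
  "hausdorff_pre k \<delta> A =
     (INF U \<in> {U :: nat \<Rightarrow> 'a set. A \<subseteq> (\<Union>i. U i) \<and> (\<forall>i. bounded (U i) \<and> diameter (U i) \<le> \<delta>)}.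
        \<Sum>i. hausdorff_size k (U i))"

definition hausdorff_outer :: "nat \<Rightarrow> 'a::metric_space set \<Rightarrow> ennreal" where
  "hausdorff_outer k A = (SUP \<delta> \<in> {0<..}. hausdorff_pre k \<delta> A)"

definition hausdorff_measure :: "nat \<Rightarrow> 'a::metric_space measure" where
  "hausdorff_measure k = measure_of UNIV (sets borel) (hausdorff_outer k)"

text \<open>
  \<^const>\<open>measure_of\<close> silently returns the zero measure if the given set function is not
  countably additive.  The following lemmas show that this does not happen here: the
  Hausdorff outer measure is a metric outer measure, so Borel sets are
  Caratheodory-measurable (lemma \<open>emeasure_hausdorff_measure\<close>).
\<close>

lemma hausdorff_pre_empty: "0 < \<delta> \<Longrightarrow> hausdorff_pre k \<delta> {} = 0"
proof -
  assume "0 < \<delta>"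
  then have "hausdorff_pre k \<delta> ({} :: 'a::metric_space set) \<le> (\<Sum>i::nat. hausdorff_size k ({} :: 'a set))"
    unfolding hausdorff_pre_def by (intro INF_lower) auto
  then show "hausdorff_pre k \<delta> ({} :: 'a set) = 0"
    by (simp add: hausdorff_size_def)
qed

lemma hausdorff_pre_mono: "A \<subseteq> B \<Longrightarrow> hausdorff_pre k \<delta> A \<le> hausdorff_pre k \<delta> B"
  unfolding hausdorff_pre_def by (rule INF_superset_mono) auto

lemma hausdorff_pre_antimono: "\<delta> \<le> \<epsilon> \<Longrightarrow> hausdorff_pre k \<epsilon> A \<le> hausdorff_pre k \<delta> A"
  unfolding hausdorff_pre_def by (rule INF_superset_mono) (auto intro: order_trans)

lemma hausdorff_pre_countably_subadditive:
  fixes A :: "nat \<Rightarrow> 'a::metric_space set"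
  shows "hausdorff_pre k \<delta> (\<Union>n. A n) \<le> (\<Sum>n. hausdorff_pre k \<delta> (A n))"
proof (cases "\<exists>n. hausdorff_pre k \<delta> (A n) = top")
  case True
  then obtain n where n: "hausdorff_pre k \<delta> (A n) = top" by blast
  have "(\<Sum>n. hausdorff_pre k \<delta> (A n)) \<ge> (\<Sum>n\<in>{n}. hausdorff_pre k \<delta> (A n))"
    by (intro sum_le_suminf) auto
  then have "(\<Sum>n. hausdorff_pre k \<delta> (A n)) = top"
    using n by (simp add: top_unique)
  then show ?thesis by simp
next
  case False
  show ?thesis
  proof (rule ennreal_le_epsilon)
    fix e :: real assume "0 < e"
    have "\<exists>U. A n \<subseteq> (\<Union>i. U i) \<and> (\<forall>i. bounded (U i) \<and> diameter (U i) \<le> \<delta>) \<and>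
        (\<Sum>i. hausdorff_size k (U i :: 'a set)) < hausdorff_pre k \<delta> (A n) + ennreal (e * (1/2) ^ Suc n)" for n
    proof -
      have "hausdorff_pre k \<delta> (A n) < hausdorff_pre k \<delta> (A n) + ennreal (e * (1/2) ^ Suc n)"
        using False \<open>0 < e\<close> by (simp add: ennreal_add_left_cancel_less less_top)
      then show ?thesis
        unfolding hausdorff_pre_def INF_less_iff by blast
    qed
    then obtain U where U: "\<And>n. A n \<subseteq> (\<Union>i. U n i)"
        "\<And>n i. bounded (U n i)" "\<And>n i. diameter (U n i) \<le> \<delta>"
        "\<And>n. (\<Sum>i. hausdorff_size k (U n i :: 'a set)) < hausdorff_pre k \<delta> (A n) + ennreal (e * (1/2) ^ Suc n)"
      by metis
    let ?V = "\<lambda>m. case_prod U (prod_decode m)"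
    have "(\<Union>n. A n) \<subseteq> (\<Union>m. ?V m)"
    proof (clarsimp)
      fix x n assume "x \<in> A n"
      with U(1) obtain i where "x \<in> U n i" by blast
      then show "\<exists>m. x \<in> ?V m"
        by (intro exI[of _ "prod_encode (n, i)"]) simp
    qed
    then have "hausdorff_pre k \<delta> (\<Union>n. A n) \<le> (\<Sum>m. hausdorff_size k (?V m))"
      unfolding hausdorff_pre_def using U(2,3)
      by (intro INF_lower) (auto split: prod.split)
    also have "\<dots> = (\<Sum>n. \<Sum>i. hausdorff_size k (U n i))"
      using suminf_ennreal_2dimen[of "\<lambda>n. \<Sum>i. hausdorff_size k (U n i)" "\<lambda>(n, i). hausdorff_size k (U n i)"]
      by (simp add: o_def case_prod_unfold)
    also have "\<dots> \<le> (\<Sum>n. hausdorff_pre k \<delta> (A n) + ennreal (e * (1/2) ^ Suc n))"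
      using U(4) by (intro suminf_le) (auto intro: less_imp_le)
    also have "\<dots> = (\<Sum>n. hausdorff_pre k \<delta> (A n)) + (\<Sum>n. ennreal (e * (1/2) ^ Suc n))"
      by (rule suminf_add[symmetric]) auto
    also have "(\<Sum>n. ennreal (e * (1/2) ^ Suc n)) = ennreal e"
      using \<open>0 < e\<close> sums_mult[OF power_half_series, of e]
      by (intro suminf_ennreal_eq) auto
    finally show "hausdorff_pre k \<delta> (\<Union>n. A n) \<le> (\<Sum>n. hausdorff_pre k \<delta> (A n)) + ennreal e" .
  qed
qed

lemma hausdorff_outer_empty: "hausdorff_outer k {} = 0"
  unfolding hausdorff_outer_def by (subst SUP_eq_const[where x = 0]) (auto simp: hausdorff_pre_empty)

lemma hausdorff_outer_mono: "A \<subseteq> B \<Longrightarrow> hausdorff_outer k A \<le> hausdorff_outer k B"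
  unfolding hausdorff_outer_def by (intro SUP_mono) (auto intro: hausdorff_pre_mono)

lemma hausdorff_pre_le_outer: "0 < \<delta> \<Longrightarrow> hausdorff_pre k \<delta> A \<le> hausdorff_outer k A"
  unfolding hausdorff_outer_def by (intro SUP_upper) auto

lemma hausdorff_outer_countably_subadditive:
  "hausdorff_outer k (\<Union>n. A n) \<le> (\<Sum>n. hausdorff_outer k (A n))"
  unfolding hausdorff_outer_def[of k "\<Union>n. A n"]
  by (intro SUP_least order_trans[OF hausdorff_pre_countably_subadditive] suminf_le)
    (auto intro: hausdorff_pre_le_outer)

lemma hausdorff_outer_Un: "hausdorff_outer k (A \<union> B) \<le> hausdorff_outer k A + hausdorff_outer k B"
proof -
  define D where "D = (\<lambda>n::nat. if n = 0 then A else if n = 1 then B else {})"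
  have "A \<union> B = (\<Union>n. D n)"
    by (auto simp: D_def split: if_splits)
  then have "hausdorff_outer k (A \<union> B) \<le> (\<Sum>n. hausdorff_outer k (D n))"
    by (simp add: hausdorff_outer_countably_subadditive)
  also have "\<dots> = (\<Sum>n\<in>{0,1}. hausdorff_outer k (D n))"
    by (intro suminf_finite) (auto simp: D_def hausdorff_outer_empty)
  finally show ?thesis by (simp add: D_def)
qed

lemma hausdorff_pre_separated:
  fixes A B :: "'a::metric_space set"
  assumes sep: "\<And>a b. a \<in> A \<Longrightarrow> b \<in> B \<Longrightarrow> \<delta> < dist a b"
  shows "hausdorff_pre k \<delta> A + hausdorff_pre k \<delta> B \<le> hausdorff_pre k \<delta> (A \<union> B)"
  unfolding hausdorff_pre_def[of _ _ "A \<union> B"]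
proof (rule INF_greatest, clarify)
  fix U :: "nat \<Rightarrow> 'a set"
  assume U: "A \<union> B \<subseteq> (\<Union>i. U i)" "\<forall>i. bounded (U i) \<and> diameter (U i) \<le> \<delta>"
  define V where "V i = (if U i \<inter> A = {} then {} else U i)" for i
  define W where "W i = (if U i \<inter> B = {} then {} else U i)" for i
  have disj: "U i \<inter> A = {} \<or> U i \<inter> B = {}" for i
  proof (rule ccontr)
    assume "\<not> ?thesis"
    then obtain a b where ab: "a \<in> U i" "a \<in> A" "b \<in> U i" "b \<in> B" by auto
    then have "dist a b \<le> diameter (U i)"
      using U(2) diameter_bounded_bound by blast
    with U(2) sep[OF ab(2,4)] show False by (meson leD order_trans)
  qed
  have "0 \<le> \<delta>" using U(2) diameter_ge_0 order_trans by blast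
  then have V: "hausdorff_pre k \<delta> A \<le> (\<Sum>i. hausdorff_size k (V i))"
    unfolding hausdorff_pre_def using U by (intro INF_lower) (auto simp: V_def, blast)
  have W: "hausdorff_pre k \<delta> B \<le> (\<Sum>i. hausdorff_size k (W i))"
    unfolding hausdorff_pre_def using U \<open>0 \<le> \<delta>\<close> by (intro INF_lower) (auto simp: W_def, blast)
  have "hausdorff_pre k \<delta> A + hausdorff_pre k \<delta> B \<le> (\<Sum>i. hausdorff_size k (V i)) + (\<Sum>i. hausdorff_size k (W i))"
    using V W by (rule add_mono)
  also have "\<dots> = (\<Sum>i. hausdorff_size k (V i) + hausdorff_size k (W i))"
    by (rule suminf_add) auto
  also have "\<dots> \<le> (\<Sum>i. hausdorff_size k (U i))"
    using disj by (intro suminf_le) (auto simp: V_def W_def hausdorff_size_def)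
  finally show "hausdorff_pre k \<delta> A + hausdorff_pre k \<delta> B \<le> (\<Sum>i. hausdorff_size k (U i))" .
qed

lemma hausdorff_outer_separated:
  fixes A B :: "'a::metric_space set"
  assumes "0 < r" and sep: "\<And>a b. a \<in> A \<Longrightarrow> b \<in> B \<Longrightarrow> r \<le> dist a b"
  shows "hausdorff_outer k A + hausdorff_outer k B \<le> hausdorff_outer k (A \<union> B)"
proof -
  have *: "hausdorff_pre k \<delta> A + hausdorff_pre k \<epsilon> B \<le> hausdorff_outer k (A \<union> B)"
    if "0 < \<delta>" "0 < \<epsilon>" for \<delta> \<epsilon>
  proof -
    define \<eta> where "\<eta> = min (r / 2) (min \<delta> \<epsilon>)"
    have \<eta>: "0 < \<eta>" "\<eta> < r" "\<eta> \<le> \<delta>" "\<eta> \<le> \<epsilon>"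
      using that \<open>0 < r\<close> by (auto simp: \<eta>_def)
    have "hausdorff_pre k \<delta> A + hausdorff_pre k \<epsilon> B \<le> hausdorff_pre k \<eta> A + hausdorff_pre k \<eta> B"
      using \<eta> by (intro add_mono hausdorff_pre_antimono)
    also have "\<dots> \<le> hausdorff_pre k \<eta> (A \<union> B)"
      using sep \<eta> by (intro hausdorff_pre_separated) force
    also have "\<dots> \<le> hausdorff_outer k (A \<union> B)"
      using \<eta> by (intro hausdorff_pre_le_outer)
    finally show ?thesis .
  qed
  have "hausdorff_pre k \<delta> A + hausdorff_outer k B \<le> hausdorff_outer k (A \<union> B)" if "0 < \<delta>" for \<delta>
    unfolding hausdorff_outer_def[of k B] using * that
    by (subst ennreal_SUP_add_right) (auto intro!: SUP_least)
  then show ?thesis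
    unfolding hausdorff_outer_def[of k A]
    by (subst ennreal_SUP_add_left[symmetric]) (auto intro!: SUP_least)
qed

lemma hausdorff_outer_sum_separated:
  fixes R :: "nat \<Rightarrow> 'a::metric_space set"
  assumes sep: "\<And>n. \<exists>r>0. \<forall>i<n. \<forall>a\<in>R i. \<forall>b\<in>R n. r \<le> dist a b"
  shows "(\<Sum>i<n. hausdorff_outer k (R i)) \<le> hausdorff_outer k (\<Union>i<n. R i)"
proof (induction n)
  case (Suc n)
  obtain r where r: "r > 0" "\<forall>i<n. \<forall>a\<in>R i. \<forall>b\<in>R n. r \<le> dist a b"
    using sep by blast
  have "(\<Sum>i<Suc n. hausdorff_outer k (R i)) \<le> hausdorff_outer k (\<Union>i<n. R i) + hausdorff_outer k (R n)"
    using Suc.IH by (simp add: add_right_mono)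
  also have "\<dots> \<le> hausdorff_outer k ((\<Union>i<n. R i) \<union> R n)"
    using r by (intro hausdorff_outer_separated) auto
  also have "(\<Union>i<n. R i) \<union> R n = (\<Union>i<Suc n. R i)"
    by (auto simp: less_Suc_eq)
  finally show ?case .
qed simp

lemma hausdorff_outer_closed:
  fixes C T :: "'a::metric_space set"
  assumes "closed C"
  shows "hausdorff_outer k (T \<inter> C) + hausdorff_outer k (T - C) \<le> hausdorff_outer k T"
proof (cases "C = {} \<or> hausdorff_outer k T = top")
  case True
  then show ?thesis by (auto simp: hausdorff_outer_empty)
next
  case False
  then have "C \<noteq> {}" and fin: "hausdorff_outer k T < top" by (auto simp: less_top)
  let ?H = "hausdorff_outer k"
  define \<rho> where "\<rho> n = 1 / (real n + 1)" for n
  have \<rho>_pos: "0 < \<rho> n" for n by (simp add: \<rho>_def)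
  have \<rho>_mono: "\<rho> m \<le> \<rho> n" if "n \<le> m" for n m
    using that by (auto simp: \<rho>_def field_simps)
  have \<rho>_less: "\<rho> m < \<rho> n" if "n < m" for n m
    using that by (auto simp: \<rho>_def field_simps)
  define B where "B n = {x \<in> T. \<rho> n \<le> infdist x C}" for n
  define R where "R n = {x \<in> T. \<rho> (Suc n) \<le> infdist x C \<and> infdist x C < \<rho> n}" for n
  have R_sep: "\<rho> (Suc i) - \<rho> j \<le> dist a b" if "a \<in> R i" "b \<in> R j" for i j a b
  proof -
    have "infdist a C \<le> infdist b C + dist a b" by (rule infdist_triangle)
    then show ?thesis using that by (auto simp: R_def)
  qed
  have half: "(\<Sum>i<n. ?H (R (2 * i + c))) \<le> ?H T" for n c
  proof -
    have "(\<Sum>i<n. ?H (R (2 * i + c))) \<le> ?H (\<Union>i<n. R (2 * i + c))"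
    proof (rule hausdorff_outer_sum_separated)
      fix n
      show "\<exists>r>0. \<forall>i<n. \<forall>a\<in>R (2 * i + c). \<forall>b\<in>R (2 * n + c). r \<le> dist a b"
      proof (cases "n = 0")
        case False
        show ?thesis
        proof (intro exI[of _ "\<rho> (2 * n + c - 1) - \<rho> (2 * n + c)"] conjI allI impI ballI)
          fix i a b assume i: "i < n" and ab: "a \<in> R (2 * i + c)" "b \<in> R (2 * n + c)"
          have "\<rho> (2 * n + c - 1) \<le> \<rho> (Suc (2 * i + c))"
            using i by (intro \<rho>_mono) simp
          with R_sep[OF ab] show "\<rho> (2 * n + c - 1) - \<rho> (2 * n + c) \<le> dist a b" by simp
        next
          show "0 < \<rho> (2 * n + c - 1) - \<rho> (2 * n + c)"
            using \<rho>_less[of "2 * n + c - 1" "2 * n + c"] False by simp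
        qed
      qed (auto intro: exI[of _ 1])
    qed
    also have "\<dots> \<le> ?H T" by (intro hausdorff_outer_mono) (auto simp: R_def)
    finally show ?thesis .
  qed
  have even_odd: "(\<Sum>i<2 * n. f i) = (\<Sum>i<n. f (2 * i)) + (\<Sum>i<n. f (2 * i + 1))"
    for n and f :: "nat \<Rightarrow> ennreal"
    by (induction n) (simp_all add: add_ac)
  have "(\<Sum>i<n. ?H (R i)) \<le> ?H T + ?H T" for n
  proof -
    have "(\<Sum>i<n. ?H (R i)) \<le> (\<Sum>i<2 * n. ?H (R i))"
      by (intro sum_mono2) auto
    also have "\<dots> \<le> ?H T + ?H T"
      unfolding even_odd using half[of 0 n] half[of 1 n] by (intro add_mono) simp_all
    finally show ?thesis .
  qed
  then have "(\<Sum>i. ?H (R i)) \<le> ?H T + ?H T"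
    by (intro suminf_le_const) auto
  then have sum_fin: "(\<Sum>i. ?H (R i)) \<noteq> top"
    using fin by (metis ennreal_add_eq_top less_top top_unique)
  have tail: "(\<lambda>n. \<Sum>i. ?H (R (i + n))) \<longlonglongrightarrow> 0"
  proof -
    have "(\<Sum>i. ?H (R (i + n))) = (\<Sum>i. ?H (R i)) - (\<Sum>i<n. ?H (R i))" for n
    proof -
      have "(\<Sum>i<n. ?H (R i)) \<le> (\<Sum>i. ?H (R i))"
        by (intro sum_le_suminf) auto
      then have "(\<Sum>i<n. ?H (R i)) \<noteq> top"
        using sum_fin by (metis top_unique)
      moreover have "(\<Sum>i. ?H (R i)) = (\<Sum>i. ?H (R (i + n))) + (\<Sum>i<n. ?H (R i))"
        by (rule suminf_offset) auto
      ultimately show ?thesis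
        by (simp add: ennreal_add_diff_cancel_right)
    qed
    moreover have "(\<lambda>n. (\<Sum>i. ?H (R i)) - (\<Sum>i<n. ?H (R i))) \<longlonglongrightarrow> (\<Sum>i. ?H (R i)) - (\<Sum>i. ?H (R i))"
      using sum_fin by (intro tendsto_diff_ennreal tendsto_const summable_LIMSEQ) auto
    moreover have "(\<Sum>i. ?H (R i)) - (\<Sum>i. ?H (R i)) = 0"
      using sum_fin by (simp add: less_top)
    ultimately show ?thesis by simp
  qed
  have bound: "?H (T \<inter> C) + ?H (T - C) \<le> ?H T + (\<Sum>i. ?H (R (i + n)))" for n
  proof -
    have "T - C \<subseteq> B n \<union> (\<Union>i. R (i + n))"
    proof
      fix x assume x: "x \<in> T - C"
      then have pos: "0 < infdist x C"
        using \<open>closed C\<close> \<open>C \<noteq> {}\<close> by (metis DiffD2 in_closed_iff_infdist_zero infdist_nonneg less_eq_real_def)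
      show "x \<in> B n \<union> (\<Union>i. R (i + n))"
      proof (cases "\<rho> n \<le> infdist x C")
        case False
        define m where "m = (LEAST m. \<rho> m \<le> infdist x C)"
        obtain l where "1 / real (Suc l) < infdist x C"
          using pos by (rule nat_approx_posE)
        then have "\<rho> l \<le> infdist x C" by (simp add: \<rho>_def add.commute)
        then have m: "\<rho> m \<le> infdist x C" unfolding m_def by (rule LeastI)
        have "n < m"
          using m False \<rho>_mono[of m n] by (meson not_le order_trans)
        then obtain j where j: "m = Suc (j + n)"
          by (metis add.commute less_natE)
        then have "\<not> \<rho> (j + n) \<le> infdist x C"
          using not_less_Least[of "j + n" "\<lambda>m. \<rho> m \<le> infdist x C"] unfolding m_def by simp
        then have "x \<in> R (j + n)" using x m j by (simp add: R_def)
        then show ?thesis by blast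
      qed (use x in \<open>auto simp: B_def\<close>)
    qed
    then have "?H (T - C) \<le> ?H (B n) + ?H (\<Union>i. R (i + n))"
      by (meson hausdorff_outer_Un hausdorff_outer_mono order_trans)
    also have "\<dots> \<le> ?H (B n) + (\<Sum>i. ?H (R (i + n)))"
      by (intro add_left_mono hausdorff_outer_countably_subadditive)
    finally have 1: "?H (T - C) \<le> ?H (B n) + (\<Sum>i. ?H (R (i + n)))" .
    have "?H (T \<inter> C) + ?H (B n) \<le> ?H (T \<inter> C \<union> B n)"
    proof (rule hausdorff_outer_separated[OF \<rho>_pos])
      fix a b assume "a \<in> T \<inter> C" "b \<in> B n"
      then show "\<rho> n \<le> dist a b"
        using infdist_le[of a C b] by (simp add: B_def dist_commute)
    qed
    also have "\<dots> \<le> ?H T" by (intro hausdorff_outer_mono) (auto simp: B_def)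
    finally have 2: "?H (T \<inter> C) + ?H (B n) \<le> ?H T" .
    have "?H (T \<inter> C) + ?H (T - C) \<le> ?H (T \<inter> C) + (?H (B n) + (\<Sum>i. ?H (R (i + n))))"
      using 1 by (rule add_left_mono)
    also have "\<dots> \<le> ?H T + (\<Sum>i. ?H (R (i + n)))"
      unfolding add.assoc[symmetric] using 2 by (rule add_right_mono)
    finally show ?thesis .
  qed
  have "(\<lambda>n. ?H T + (\<Sum>i. ?H (R (i + n)))) \<longlonglongrightarrow> ?H T + 0"
    by (intro tendsto_add tendsto_const tail)
  then have "?H (T \<inter> C) + ?H (T - C) \<le> ?H T + 0"
    by (rule LIMSEQ_le_const) (use bound in blast)
  then show ?thesis by simp
qed

lemma sets_hausdorff_measure [simp, measurable_cong]: "sets (hausdorff_measure k) = sets borel"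
  unfolding hausdorff_measure_def
  by (simp add: sets.sigma_sets_eq[of borel, simplified])

lemma space_hausdorff_measure [simp]: "space (hausdorff_measure k) = UNIV"
  unfolding hausdorff_measure_def by (simp add: space_measure_of_conv)

lemma emeasure_hausdorff_measure:
  assumes "A \<in> sets borel"
  shows "emeasure (hausdorff_measure k) A = hausdorff_outer k (A :: 'a::metric_space set)"
proof -
  let ?L = "lambda_system UNIV (Pow UNIV) (hausdorff_outer k :: 'a set \<Rightarrow> ennreal)"
  have "outer_measure_space (Pow UNIV) (hausdorff_outer k :: 'a set \<Rightarrow> ennreal)"
    by (simp add: outer_measure_space_def positive_def increasing_def countably_subadditive_def
        hausdorff_outer_empty hausdorff_outer_mono hausdorff_outer_countably_subadditive)
  then have L: "measure_space UNIV ?L (hausdorff_outer k)"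
    by (rule sigma_algebra.caratheodory_lemma[OF sigma_algebra_Pow])
  interpret L: sigma_algebra UNIV ?L
    using L by (simp add: measure_space_def)
  have "C \<in> ?L" if "closed C" for C
  proof -
    have "hausdorff_outer k (C \<inter> T) + hausdorff_outer k ((UNIV - C) \<inter> T) = hausdorff_outer k T" for T
    proof (rule antisym)
      show "hausdorff_outer k (C \<inter> T) + hausdorff_outer k ((UNIV - C) \<inter> T) \<le> hausdorff_outer k T"
        using hausdorff_outer_closed[OF that, of k T] by (simp add: Int_commute Diff_eq)
      have "hausdorff_outer k T = hausdorff_outer k (C \<inter> T \<union> (UNIV - C) \<inter> T)"
        by (rule arg_cong[of _ _ "hausdorff_outer k"]) auto
      then show "hausdorff_outer k T \<le> hausdorff_outer k (C \<inter> T) + hausdorff_outer k ((UNIV - C) \<inter> T)"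
        using hausdorff_outer_Un by metis
    qed
    then show ?thesis by (simp add: lambda_system_def)
  qed
  then have "sets borel \<subseteq> ?L"
    using L.sigma_sets_subset[of "Collect closed"] by (auto simp: borel_eq_closed)
  then have "countably_additive (sets borel) (hausdorff_outer k :: 'a set \<Rightarrow> ennreal)"
    using L unfolding measure_space_def countably_additive_def by (meson subset_trans subsetD)
  then have "measure_space UNIV (sets borel) (hausdorff_outer k :: 'a set \<Rightarrow> ennreal)"
    using sets.sigma_algebra_axioms[of "borel :: 'a measure"]
    by (simp add: measure_space_def positive_def hausdorff_outer_empty)
  then show ?thesis
    unfolding hausdorff_measure_def using assms
    by (intro emeasure_measure_of_sigma) (auto simp: measure_space_def)
qed

definition surface_measure :: "'a::euclidean_space set \<Rightarrow> 'a measure" where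
  "surface_measure S = restrict_space (hausdorff_measure (DIM('a) - 1)) S"


section \<open>Bounded domains of class \<open>C\<^sup>2\<close>\<close>

definition C2_function :: "('a::euclidean_space \<Rightarrow> real) \<Rightarrow> bool" where
  "C2_function f \<longleftrightarrow>
     (\<exists>(f' :: 'a \<Rightarrow> 'a \<Rightarrow>\<^sub>L real) (f'' :: 'a \<Rightarrow> 'a \<Rightarrow>\<^sub>L ('a \<Rightarrow>\<^sub>L real)).
        (\<forall>x. (f has_derivative blinfun_apply (f' x)) (at x)) \<and>
        (\<forall>x. (f' has_derivative blinfun_apply (f'' x)) (at x)) \<and>
        continuous_on UNIV f'')"

text \<open>
  Near each boundary point, after a rigid motion taking the unit vector \<open>e\<close> to the last
  coordinate direction, the set is the strict epigraph of a \<open>C\<^sup>2\<close> function of the remaining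
  \<open>d - 1\<close> coordinates.  The point \<open>x - (x \<bullet> e) *\<^sub>R e\<close> is the projection of \<open>x\<close> to the
  hyperplane orthogonal to \<open>e\<close>; only the values of \<open>g\<close> on that hyperplane matter, and every
  \<open>C\<^sup>2\<close> function on the hyperplane extends to the whole space by composing with the projection.
\<close>

definition C2_boundary :: "'a::euclidean_space set \<Rightarrow> bool" where
  "C2_boundary \<Omega> \<longleftrightarrow>
     (\<forall>p \<in> frontier \<Omega>. \<exists>r e g. 0 < r \<and> norm e = 1 \<and> C2_function g \<and>
        \<Omega> \<inter> ball p r = {x \<in> ball p r. g (x - (x \<bullet> e) *\<^sub>R e) < x \<bullet> e})"

definition bounded_C2_domain :: "'a::euclidean_space set \<Rightarrow> bool" where
  "bounded_C2_domain \<Omega> \<longleftrightarrow>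
     \<Omega> \<noteq> {} \<and> open \<Omega> \<and> connected \<Omega> \<and> bounded \<Omega> \<and> C2_boundary \<Omega>"

text \<open>
  Tangent vectors of a hypersurface \<open>S\<close> at \<open>p\<close> are the velocities at \<open>p\<close> of curves in \<open>S\<close>.
\<close>

definition tangent_vectors :: "'a::euclidean_space set \<Rightarrow> 'a \<Rightarrow> 'a set" where
  "tangent_vectors S p =
     {v. \<exists>c \<epsilon>. 0 < \<epsilon> \<and> c ` {-\<epsilon><..<\<epsilon>} \<subseteq> S \<and> c 0 = p \<and> (c has_vector_derivative v) (at (0::real))}"

definition outward_unit_normal :: "'a::euclidean_space set \<Rightarrow> 'a \<Rightarrow> 'a \<Rightarrow> bool" where
  "outward_unit_normal \<Omega> p n \<longleftrightarrow>
     norm n = 1 \<and>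
     (\<forall>v \<in> tangent_vectors (frontier \<Omega>) p. n \<bullet> v = 0) \<and>
     (\<exists>\<epsilon>>0. \<forall>t\<in>{0<..<\<epsilon>}. p - t *\<^sub>R n \<in> \<Omega> \<and> p + t *\<^sub>R n \<notin> closure \<Omega>)"

end

theory Submission
  imports Defs
begin

text \<open>
  For \<open>x, y\<close> on the boundary, Cauchy-Schwarz bounds \<open>(\<nu> x - \<nu> y) \<bullet> (x - y) / norm (x - y) ^ d\<close> by the
  integrand.  By symmetry the double integral of the former is twice that of the double layer kernel
  \<open>\<nu> x \<bullet> (x - y) / norm (x - y) ^ d\<close>, and Gauss' solid angle formula gives the inner
  integral half the area of the unit sphere as its value.  To avoid principal values, \<open>norm (x - y)\<close> is replaced by
  \<open>sqrt (\<epsilon>\<^sup>2 + (norm (x - y))\<^sup>2)\<close>: the divergence theorem and rescaling by \<open>\<epsilon>\<close> turn the inner integral into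
  that of an integrable radial bump over \<open>(\<Omega> - y) / \<epsilon>\<close>, which tends to a half space.
  Equality forces \<open>\<nu> x - \<nu> y\<close> to be a nonnegative multiple of \<open>x - y\<close> for all boundary points, so that
  \<open>\<nu>\<close> is a homothety and the boundary lies on a sphere.

  Both sides of the inequality are quadratic in \<open>\<sigma>\<close>.  Hence Hausdorff measure on hyperplanes need only
  be a multiple of Lebesgue measure, with a factor independent of the hyperplane, and the
  isodiametric inequality is not needed.
\<close>

section \<open>Hausdorff measure and Lipschitz maps\<close>

text \<open>The surface measure is a Hausdorff measure, so Gauss' theorem has to be tied to
  coverings. Projecting a piece of the boundary along a unit vector \<open>v\<close> onto a
  hyperplane and integrating over the lines parallel to \<open>v\<close> gives the divergence
  theorem, but only for the component along a \<open>v\<close> transversal to that piece. Both sides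
  are linear in the direction and the transversal directions contain a cone with interior, so every
  component follows. The slicing constant enters the double layer potential and the mass of the bump
  in the same way; the bump integral over the unit ball therefore turns the limit into the area of
  the unit sphere. The kernel
  \<open>(\<nu> x - \<nu> y) \<bullet> (x - y) / norm (x - y) ^ d\<close> has no fixed sign. The
  inequality is therefore taken for each fixed \<open>\<epsilon>\<close> before the limit, and the
  equality case applies Fatou's lemma to the nonnegative gap between the energy kernel and the
  regularised one. Parallelism almost everywhere becomes parallelism everywhere because
  \<open>\<nu>\<close> is continuous and every ball around a boundary point carries positive
  area.\<close>

lemma hausdorff_pre_image_le:
  fixes f :: "'a \<Rightarrow> 'b::metric_space" and g :: "'a \<Rightarrow> 'c::metric_space"
  assumes L: "0 < L" and lip: "\<And>x y. x \<in> A \<Longrightarrow> y \<in> A \<Longrightarrow> dist (f x) (f y) \<le> L * dist (g x) (g y)"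
    and U: "g ` A \<subseteq> (\<Union>i. U i)" "\<And>i::nat. bounded (U i)" "\<And>i. diameter (U i) \<le> \<delta> / L"
  shows "hausdorff_pre k \<delta> (f ` A) \<le> ennreal (L ^ k) * (\<Sum>i. hausdorff_size k (U i))"
proof -
  \<comment> \<open>The part of \<open>A\<close> that \<open>g\<close> sends into \<open>U i\<close>
    has an \<open>f\<close>-image of diameter at most \<open>L\<close> times that of
    \<open>U i\<close>; hence the scale \<open>\<delta> / L\<close> on the side of
    \<open>g\<close>.\<close>
  define V where "V i = f ` {x \<in> A. g x \<in> U i}" for i
  have d: "dist u v \<le> L * diameter (U i)" if "u \<in> V i" "v \<in> V i" for u v i
  proof -
    obtain x y where xy: "u = f x" "v = f y" "x \<in> A" "y \<in> A" "g x \<in> U i" "g y \<in> U i"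
      using \<open>u \<in> V i\<close> \<open>v \<in> V i\<close> unfolding V_def by blast
    have "dist u v \<le> L * dist (g x) (g y)"
      using lip xy by simp
    also have "\<dots> \<le> L * diameter (U i)"
      using L U(2) xy by (intro mult_left_mono diameter_bounded_bound) auto
    finally show ?thesis .
  qed
  have bV: "bounded (V i)" for i
    unfolding bounded_two_points using d by blast
  have dV: "diameter (V i) \<le> L * diameter (U i)" for i
  proof (cases "V i = {}")
    case True
    then show ?thesis using L diameter_ge_0[OF U(2)] by simp
  next
    case False
    have "(SUP (x, y)\<in>V i \<times> V i. dist x y) \<le> L * diameter (U i)"
      using False d by (intro cSUP_least) auto
    with False show ?thesis by (simp add: diameter_def)
  qed
  have sV: "hausdorff_size k (V i) \<le> ennreal (L ^ k) * hausdorff_size k (U i)" for i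
  proof (cases "V i = {}")
    case False
    then have "U i \<noteq> {}" by (auto simp: V_def)
    have "(diameter (V i) / 2) ^ k \<le> (L * diameter (U i) / 2) ^ k"
      using dV diameter_ge_0[OF bV] by (intro power_mono divide_right_mono) auto
    also have "\<dots> = L ^ k * (diameter (U i) / 2) ^ k"
      by (simp add: power_mult_distrib power_divide)
    finally have "unit_ball_vol (real k) * (diameter (V i) / 2) ^ k
        \<le> L ^ k * (unit_ball_vol (real k) * (diameter (U i) / 2) ^ k)"
      using unit_ball_vol_nonneg[of "real k"] by (simp add: mult.left_commute mult_left_mono)
    with False \<open>U i \<noteq> {}\<close> L diameter_ge_0[OF U(2)] show ?thesis
      by (simp add: hausdorff_size_def ennreal_mult[symmetric] ennreal_leI)
  qed (simp add: hausdorff_size_def)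
  have dle: "diameter (V i) \<le> \<delta>" for i
  proof -
    have "diameter (V i) \<le> L * diameter (U i)" by (rule dV)
    also have "\<dots> \<le> \<delta>" using U(3)[of i] L by (simp add: field_simps)
    finally show ?thesis .
  qed
  have "f ` A \<subseteq> (\<Union>i. V i)"
    using U(1) by (auto simp: V_def) blast
  then have "hausdorff_pre k \<delta> (f ` A) \<le> (\<Sum>i. hausdorff_size k (V i))"
    unfolding hausdorff_pre_def using bV dle by (intro INF_lower) auto
  also have "\<dots> \<le> (\<Sum>i. ennreal (L ^ k) * hausdorff_size k (U i))"
    using sV by (intro suminf_le) auto
  finally show ?thesis by simp
qed

text \<open>Two maps on a common index set replace one Lipschitz map: with \<open>g\<close> the
  identity this is the usual bound for a Lipschitz \<open>f\<close>, and with \<open>f\<close> the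
  identity it bounds a set by its image under an injective \<open>g\<close> whose inverse is
  Lipschitz, without naming the inverse.\<close>

lemma hausdorff_outer_image_le:
  fixes f :: "'a \<Rightarrow> 'b::metric_space" and g :: "'a \<Rightarrow> 'c::metric_space"
  assumes L: "0 < L" and lip: "\<And>x y. x \<in> A \<Longrightarrow> y \<in> A \<Longrightarrow> dist (f x) (f y) \<le> L * dist (g x) (g y)"
  shows "hausdorff_outer k (f ` A) \<le> ennreal (L ^ k) * hausdorff_outer k (g ` A)"
  unfolding hausdorff_outer_def[of k "f ` A"]
proof (rule SUP_least)
  fix \<delta> :: real assume "\<delta> \<in> {0<..}"
  then have \<delta>: "0 < \<delta>" by simp
  have inv: "ennreal (L ^ k) * ennreal (1 / L ^ k) = 1"
    using L by (simp add: ennreal_mult[symmetric])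
  \<comment> \<open>Dividing first leaves the infimum alone on the right, so that one cover can be
    treated at a time.\<close>
  have "ennreal (1 / L ^ k) * hausdorff_pre k \<delta> (f ` A) \<le> hausdorff_pre k (\<delta> / L) (g ` A)"
    unfolding hausdorff_pre_def[of k "\<delta> / L"]
  proof (rule INF_greatest)
    fix U :: "nat \<Rightarrow> 'c set"
    assume "U \<in> {U. g ` A \<subseteq> (\<Union>i. U i) \<and> (\<forall>i. bounded (U i) \<and> diameter (U i) \<le> \<delta> / L)}"
    then have "hausdorff_pre k \<delta> (f ` A) \<le> ennreal (L ^ k) * (\<Sum>i. hausdorff_size k (U i))"
      using L lip by (intro hausdorff_pre_image_le) auto
    then have "ennreal (1 / L ^ k) * hausdorff_pre k \<delta> (f ` A)
        \<le> ennreal (1 / L ^ k) * (ennreal (L ^ k) * (\<Sum>i. hausdorff_size k (U i)))"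
      by (rule mult_left_mono) simp
    also have "\<dots> = (\<Sum>i. hausdorff_size k (U i))"
      using inv by (simp add: mult.assoc[symmetric] mult.commute)
    finally show "ennreal (1 / L ^ k) * hausdorff_pre k \<delta> (f ` A) \<le> (\<Sum>i. hausdorff_size k (U i))" .
  qed
  also have "\<dots> \<le> hausdorff_outer k (g ` A)"
    using L \<delta> by (intro hausdorff_pre_le_outer) simp
  finally have "ennreal (L ^ k) * (ennreal (1 / L ^ k) * hausdorff_pre k \<delta> (f ` A))
      \<le> ennreal (L ^ k) * hausdorff_outer k (g ` A)"
    by (rule mult_left_mono) simp
  then show "hausdorff_pre k \<delta> (f ` A) \<le> ennreal (L ^ k) * hausdorff_outer k (g ` A)"
    using inv by (simp add: mult.assoc[symmetric])
qed

corollary hausdorff_outer_isometry: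
  assumes "\<And>x y. x \<in> A \<Longrightarrow> y \<in> A \<Longrightarrow> dist (f x) (f y) = dist x y"
  shows "hausdorff_outer k (f ` A) = hausdorff_outer k A"
  using hausdorff_outer_image_le[of 1 A f "\<lambda>x. x" k] hausdorff_outer_image_le[of 1 A "\<lambda>x. x" f k] assms
  by (intro antisym) auto

lemma hausdorff_pre_finite_cover:
  assumes I: "finite I" "A \<subseteq> (\<Union>i\<in>I. U i)" "0 \<le> \<delta>"
    and U: "\<And>i. i \<in> I \<Longrightarrow> bounded (U i)" "\<And>i. i \<in> I \<Longrightarrow> diameter (U i) \<le> \<delta>"
  shows "hausdorff_pre k \<delta> A \<le> (\<Sum>i\<in>I. hausdorff_size k (U i))"
proof -
  obtain h where h: "bij_betw h {..<card I} I"
    using I(1) bij_betw_from_nat_into_finite by blast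
  \<comment> \<open>Covers are sequences by definition; the padding by empty sets is free since
    their size is 0 even for exponent 0.\<close>
  define V where "V n = (if n < card I then U (h n) else {})" for n
  have "A \<subseteq> (\<Union>n. V n)"
  proof
    fix x assume "x \<in> A"
    then obtain i where "i \<in> I" "x \<in> U i" using I by blast
    moreover obtain n where "n < card I" "h n = i"
      using h \<open>i \<in> I\<close> by (metis bij_betw_imp_surj_on imageE lessThan_iff)
    ultimately show "x \<in> (\<Union>n. V n)" by (auto simp: V_def)
  qed
  moreover have "bounded (V n) \<and> diameter (V n) \<le> \<delta>" for n
    using U h I(3) by (auto simp: V_def dest!: bij_betwE)
  ultimately have "hausdorff_pre k \<delta> A \<le> (\<Sum>n. hausdorff_size k (V n))"
    unfolding hausdorff_pre_def by (intro INF_lower) auto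
  also have "\<dots> = (\<Sum>n<card I. hausdorff_size k (V n))"
    by (intro suminf_finite) (auto simp: V_def hausdorff_size_def)
  also have "\<dots> = (\<Sum>n<card I. hausdorff_size k (U (h n)))"
    by (simp add: V_def)
  also have "\<dots> = (\<Sum>i\<in>I. hausdorff_size k (U i))"
    using h by (rule sum.reindex_bij_betw)
  finally show ?thesis .
qed

section \<open>Hausdorff measure of codimension one on hyperplanes\<close>

text \<open>Cutting the flat cube of side \<open>2 * R\<close> into \<open>n ^ (d - 1)\<close> cubes
  of side \<open>s = 2 * R / n\<close>, each of diameter at most \<open>d * s\<close>, gives a total
  size in which \<open>n\<close> cancels. The bound \<open>C\<close> is thus independent of the
  scale \<open>\<delta>\<close>.\<close>

lemma hausdorff_outer_coordinate_hyperplane_finite: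
  fixes b :: "'a::euclidean_space"
  assumes b: "b \<in> Basis" and R: "0 < R"
  shows "hausdorff_outer (DIM('a) - 1) {x. x \<bullet> b = 0 \<and> (\<forall>i\<in>Basis. \<bar>x \<bullet> i\<bar> \<le> R)} < \<infinity>"
proof -
  let ?k = "DIM('a) - 1"
  let ?A = "{x. x \<bullet> b = 0 \<and> (\<forall>i\<in>Basis. \<bar>x \<bullet> i\<bar> \<le> R)}"
  define J where "J = Basis - {b}"
  have cJ: "card J = ?k" and fJ: "finite J" using b by (auto simp: J_def)
  define C where "C = unit_ball_vol (real ?k) * (real DIM('a) * R) ^ ?k"
  have C: "0 \<le> C" using R by (auto simp: C_def)
  have bound: "hausdorff_pre ?k \<delta> ?A \<le> ennreal C" if \<delta>: "0 < \<delta>" for \<delta>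
  proof -
    have "0 < real DIM('a) * (2 * R) / \<delta>" using R \<delta> by simp
    moreover obtain n :: nat where "real DIM('a) * (2 * R) / \<delta> < real n"
      using reals_Archimedean2 by blast
    ultimately have n: "n > 0" "real DIM('a) * (2 * R) / \<delta> < real n"
      by - (metis of_nat_0_less_iff order.strict_trans, assumption)
    define s where "s = 2 * R / real n"
    have s: "s > 0" "real DIM('a) * s \<le> \<delta>" using R n \<delta> by (auto simp: s_def field_simps)
    define I where "I = (J \<rightarrow>\<^sub>E {..<n})"
    define U where "U \<phi> = {x. x \<bullet> b = 0 \<and> (\<forall>i\<in>J. -R + s * real (\<phi> i) \<le> x \<bullet> i \<and> x \<bullet> i \<le> -R + s * real (\<phi> i + 1))}"
      for \<phi> :: "'a \<Rightarrow> nat"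
    have dist: "dist x y \<le> real DIM('a) * s" if "x \<in> U \<phi>" "y \<in> U \<phi>" for x y \<phi>
    proof -
      have "\<bar>(x - y) \<bullet> i\<bar> \<le> s" if "i \<in> Basis" for i
      proof (cases "i = b")
        case True
        then show ?thesis using \<open>x \<in> U \<phi>\<close> \<open>y \<in> U \<phi>\<close> s by (auto simp: U_def inner_diff_left)
      next
        case False
        then have "i \<in> J" using that by (auto simp: J_def)
        then have "-R + s * real (\<phi> i) \<le> x \<bullet> i" "x \<bullet> i \<le> -R + s * real (\<phi> i) + s"
          "-R + s * real (\<phi> i) \<le> y \<bullet> i" "y \<bullet> i \<le> -R + s * real (\<phi> i) + s"
          using \<open>x \<in> U \<phi>\<close> \<open>y \<in> U \<phi>\<close> by (auto simp: U_def algebra_simps)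
        then show ?thesis by (auto simp: inner_diff_left)
      qed
      then have "(\<Sum>i\<in>Basis. \<bar>(x - y) \<bullet> i\<bar>) \<le> (\<Sum>i\<in>(Basis::'a set). s)"
        by (intro sum_mono) auto
      then show ?thesis
        using norm_le_l1[of "x - y"] by (simp add: dist_norm)
    qed
    have bU: "bounded (U \<phi>)" for \<phi>
      unfolding bounded_two_points using dist by blast
    have dU: "diameter (U \<phi>) \<le> real DIM('a) * s" for \<phi>
      using dist s by (intro diameter_le) (auto simp: dist_norm)
    have cover: "?A \<subseteq> (\<Union>\<phi>\<in>I. U \<phi>)"
    proof
      fix x assume x: "x \<in> ?A"
      \<comment> \<open>The minimum with \<open>n - 1\<close> puts points with coordinate exactly
        \<open>R\<close> into the last cell.\<close>
      define \<phi> where "\<phi> = (\<lambda>i\<in>J. min (n - 1) (nat \<lfloor>(x \<bullet> i + R) / s\<rfloor>))"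
      have "-R + s * real (\<phi> i) \<le> x \<bullet> i \<and> x \<bullet> i \<le> -R + s * real (\<phi> i + 1)" if i: "i \<in> J" for i
      proof -
        define z where "z = (x \<bullet> i + R) / s"
        have xi: "\<bar>x \<bullet> i\<bar> \<le> R" using x i by (auto simp: J_def)
        then have z0: "0 \<le> z" using s by (auto simp: z_def)
        have "x \<bullet> i + R \<le> s * real n" using xi n by (auto simp: s_def)
        then have zn: "z \<le> real n" using s by (simp add: z_def field_simps)
        have \<phi>: "\<phi> i = min (n - 1) (nat \<lfloor>z\<rfloor>)" using i by (simp add: \<phi>_def z_def)
        have "real (\<phi> i) \<le> z" using z0 unfolding \<phi> by linarith
        moreover have "z \<le> real (\<phi> i + 1)"
        proof (cases "nat \<lfloor>z\<rfloor> \<le> n - 1")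
          case True then show ?thesis unfolding \<phi> using z0 by (simp add: min_def) linarith
        next
          case False then show ?thesis unfolding \<phi> using zn n by (simp add: min_def)
        qed
        ultimately have "s * real (\<phi> i) \<le> s * z" "s * z \<le> s * real (\<phi> i + 1)"
          using s by (auto intro: mult_left_mono)
        moreover have "s * z = x \<bullet> i + R" using s by (simp add: z_def)
        ultimately show ?thesis by linarith
      qed
      moreover have "\<phi> \<in> I" using n by (auto simp: I_def \<phi>_def)
      ultimately show "x \<in> (\<Union>\<phi>\<in>I. U \<phi>)" using x by (auto simp: U_def)
    qed
    have sz: "hausdorff_size ?k (U \<phi>) \<le> ennreal (unit_ball_vol (real ?k) * (real DIM('a) * s / 2) ^ ?k)" for \<phi>
      using dU[of \<phi>] diameter_ge_0[OF bU, of \<phi>]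
      by (auto simp: hausdorff_size_def intro!: ennreal_leI mult_left_mono power_mono)
    have "hausdorff_pre ?k \<delta> ?A \<le> (\<Sum>\<phi>\<in>I. hausdorff_size ?k (U \<phi>))"
    proof (rule hausdorff_pre_finite_cover[OF _ cover])
      show "finite I" using fJ by (auto simp: I_def intro: finite_PiE)
      show "diameter (U \<phi>) \<le> \<delta>" for \<phi> using dU[of \<phi>] s by linarith
    qed (use \<delta> bU in auto)
    also have "\<dots> \<le> (\<Sum>\<phi>\<in>I. ennreal (unit_ball_vol (real ?k) * (real DIM('a) * s / 2) ^ ?k))"
      using sz by (intro sum_mono)
    also have "\<dots> = ennreal (real (card I) * (unit_ball_vol (real ?k) * (real DIM('a) * s / 2) ^ ?k))"
      using s by (simp add: ennreal_mult ennreal_of_nat_eq_real_of_nat)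
    also have "real (card I) = real n ^ ?k"
      using fJ cJ by (simp add: I_def card_PiE)
    also have "real n ^ ?k * (unit_ball_vol (real ?k) * (real DIM('a) * s / 2) ^ ?k) = C"
    proof -
      have "real n ^ ?k * (real DIM('a) * s / 2) ^ ?k = (real DIM('a) * R) ^ ?k"
        using n by (simp add: power_mult_distrib[symmetric] s_def)
      then show ?thesis unfolding C_def by (metis mult.left_commute)
    qed
    finally show ?thesis .
  qed
  have "hausdorff_outer ?k ?A \<le> ennreal C"
    unfolding hausdorff_outer_def using bound by (intro SUP_least) auto
  then show ?thesis by (simp add: order_le_less_trans)
qed

text \<open>Thickening by the unit interval in direction \<open>b\<close> turns the question into
  one about Lebesgue measure. A covering set lies in a flat box centred at one of its points with
  half-width its diameter, and the volume of the thickened box is a fixed multiple of the Hausdorff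
  size. Subadditivity of volume then bounds every cover from below.\<close>

lemma hausdorff_outer_coordinate_cube_pos:
  fixes b :: "'a::euclidean_space"
  assumes b: "b \<in> Basis" and s: "0 < s"
  shows "0 < hausdorff_outer (DIM('a) - 1) {x. x \<bullet> b = 0 \<and> (\<forall>i\<in>Basis - {b}. \<bar>x \<bullet> i\<bar> \<le> s)}"
proof -
  let ?k = "DIM('a) - 1"
  let ?A = "{x. x \<bullet> b = 0 \<and> (\<forall>i\<in>Basis - {b}. \<bar>x \<bullet> i\<bar> \<le> s)}"
  define J where "J = Basis - {b}"
  have cJ: "card J = ?k" and fJ: "finite J" using b by (auto simp: J_def)
  have BJ: "Basis = insert b J" "b \<notin> J" using b by (auto simp: J_def)
  \<comment> \<open>Chosen so that the volume \<open>(2 * diameter) ^ (d - 1)\<close> of a thickened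
    box is \<open>D\<close> times the Hausdorff size of the set inside it.\<close>
  define D where "D = 4 ^ ?k / unit_ball_vol (real ?k)"
  have ub: "0 < unit_ball_vol (real ?k)" by (simp add: unit_ball_vol_pos)
  then have D: "0 < D" by (auto simp: D_def)
  have key: "ennreal ((2 * s) ^ ?k) \<le> ennreal D * (\<Sum>i. hausdorff_size ?k (U i))"
    if U: "?A \<subseteq> (\<Union>i. U i)" "\<And>i::nat. bounded (U i)" for U
  proof -
    define c where "c i = (SOME x. x \<in> U i)" for i
    \<comment> \<open>\<open>cen x t\<close> is \<open>x\<close> with its
      \<open>b\<close>-coordinate replaced by \<open>t\<close>, and \<open>off d\<close> has all
      coordinates \<open>d\<close> except 0 at \<open>b\<close>; together they describe the
      thickened boxes.\<close>
    define cen where "cen x t = (\<Sum>j\<in>J. (x \<bullet> j) *\<^sub>R j) + t *\<^sub>R b" for x :: 'a and t :: real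
    define off where "off d = (\<Sum>j\<in>J. d *\<^sub>R j)" for d :: real
    have cen: "cen x t \<bullet> j = (if j = b then t else x \<bullet> j)" if "j \<in> Basis" for x t j
      using that BJ fJ b
      by (auto simp: cen_def inner_add_left inner_sum_left inner_Basis if_distrib sum.delta' J_def cong: if_cong)
    have off: "off d \<bullet> j = (if j = b then 0 else d)" if "j \<in> Basis" for d j
      using that BJ fJ b
      by (auto simp: off_def inner_sum_left inner_Basis if_distrib sum.delta' J_def cong: if_cong)
    define W where "W i = (if U i = {} then {} else
      cbox (cen (c i) 0 - off (diameter (U i))) (cen (c i) 1 + off (diameter (U i))))" for i
    have vol: "emeasure lborel (cbox (cen x 0 - off d) (cen y 1 + off d)) = ennreal ((2 * d) ^ ?k)"
      if "0 \<le> d" "\<And>j. j \<in> J \<Longrightarrow> x \<bullet> j = y \<bullet> j" for x y d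
    proof -
      have "\<forall>j\<in>Basis. (cen x 0 - off d) \<bullet> j \<le> (cen y 1 + off d) \<bullet> j"
        using that by (auto simp: cen off inner_diff_left inner_add_left J_def)
      moreover have "(\<Prod>j\<in>Basis. ((cen y 1 + off d) - (cen x 0 - off d)) \<bullet> j) = (\<Prod>j\<in>J. 2 * d)"
      proof -
        have "(\<Prod>j\<in>J. ((cen y 1 + off d) - (cen x 0 - off d)) \<bullet> j) = (\<Prod>j\<in>J. 2 * d)"
          using that by (intro prod.cong) (auto simp: cen off inner_diff_left inner_add_left J_def)
        moreover have "((cen y 1 + off d) - (cen x 0 - off d)) \<bullet> b = 1"
          using b by (auto simp: cen off inner_diff_left inner_add_left)
        ultimately show ?thesis unfolding BJ(1) using BJ(2) fJ by simp
      qed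
      ultimately show ?thesis
        by (simp add: emeasure_lborel_cbox_eq cJ)
    qed
    have cov: "cbox (cen 0 0 - off s) (cen 0 1 + off s) \<subseteq> (\<Union>i. W i)"
    proof
      fix x assume x: "x \<in> cbox (cen 0 0 - off s) (cen 0 1 + off s)"
      define x' where "x' = cen x 0"
      have x1: "0 \<le> x \<bullet> b" "x \<bullet> b \<le> 1" "\<And>j. j \<in> J \<Longrightarrow> \<bar>x \<bullet> j\<bar> \<le> s"
        using x b by (force simp: mem_box cen off inner_diff_left inner_add_left J_def)+
      then have "x' \<in> ?A" using b by (auto simp: x'_def cen J_def)
      then obtain i where i: "x' \<in> U i" using U by blast
      then have ne: "U i \<noteq> {}" by auto
      then have "c i \<in> U i" by (simp add: c_def some_in_eq)
      then have d: "dist x' (c i) \<le> diameter (U i)" using U(2) i by (intro diameter_bounded_bound)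
      have "\<bar>x \<bullet> j - c i \<bullet> j\<bar> \<le> diameter (U i)" if "j \<in> J" for j
      proof -
        have "\<bar>(x' - c i) \<bullet> j\<bar> \<le> norm (x' - c i)" using that by (intro Basis_le_norm) (auto simp: J_def)
        then show ?thesis using d that by (auto simp: x'_def dist_norm inner_diff_left cen J_def)
      qed
      then have "\<And>j. j \<in> J \<Longrightarrow> c i \<bullet> j - diameter (U i) \<le> x \<bullet> j \<and> x \<bullet> j \<le> c i \<bullet> j + diameter (U i)"
        by (force simp: abs_le_iff)
      then have "x \<in> W i"
        using ne x1 by (auto simp: W_def mem_box cen off inner_diff_left inner_add_left J_def)
      then show "x \<in> (\<Union>i. W i)" by blast
    qed
    have mW: "W i \<in> sets lborel" for i by (simp add: W_def)
    have eW: "emeasure lborel (W i) \<le> ennreal D * hausdorff_size ?k (U i)" for i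
    proof (cases "U i = {}")
      case False
      have "D * (unit_ball_vol (real ?k) * (diameter (U i) / 2) ^ ?k) = (2 * diameter (U i)) ^ ?k"
      proof -
        have "(2 * diameter (U i)) ^ ?k = 4 ^ ?k * (diameter (U i) / 2) ^ ?k"
          by (subst power_mult_distrib[symmetric]) simp
        moreover have "q / u * (u * y) = q * y" if "0 < u" for q u y :: real
          using that by simp
        ultimately show ?thesis unfolding D_def using ub by presburger
      qed
      then show ?thesis
        using False vol[of "diameter (U i)" "c i" "c i"] diameter_ge_0[OF U(2)] D
        by (simp add: W_def hausdorff_size_def ennreal_mult[symmetric])
    qed (simp add: W_def)
    have "ennreal ((2 * s) ^ ?k) = emeasure lborel (cbox (cen 0 0 - off s) (cen 0 1 + off s))"
      using s by (intro vol[symmetric]) auto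
    also have "\<dots> \<le> emeasure lborel (\<Union>i. W i)" using cov mW by (intro emeasure_mono) auto
    also have "\<dots> \<le> (\<Sum>i. emeasure lborel (W i))" using mW by (intro emeasure_subadditive_countably) auto
    also have "\<dots> \<le> (\<Sum>i. ennreal D * hausdorff_size ?k (U i))" using eW by (intro suminf_le) auto
    finally show ?thesis by simp
  qed
  have "ennreal ((2 * s) ^ ?k / D) \<le> (\<Sum>i. hausdorff_size ?k (U i))"
    if U: "?A \<subseteq> (\<Union>i. U i)" "\<And>i::nat. bounded (U i)" for U
  proof -
    have "ennreal (1 / D) * ennreal ((2 * s) ^ ?k) \<le> ennreal (1 / D) * (ennreal D * (\<Sum>i. hausdorff_size ?k (U i)))"
      using key[OF that] by (intro mult_left_mono) auto
    moreover have "ennreal (1 / D) * ennreal D = 1" using D by (simp add: ennreal_mult[symmetric])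
    ultimately show ?thesis
      using D s by (simp add: mult.assoc[symmetric] ennreal_mult[symmetric])
  qed
  then have "ennreal ((2 * s) ^ ?k / D) \<le> hausdorff_pre ?k 1 ?A"
    unfolding hausdorff_pre_def by (intro INF_greatest) auto
  also have "\<dots> \<le> hausdorff_outer ?k ?A" by (intro hausdorff_pre_le_outer) simp
  finally have "ennreal ((2 * s) ^ ?k / D) \<le> hausdorff_outer ?k ?A" .
  moreover have "0 < ennreal ((2 * s) ^ ?k / D)" using s D by simp
  ultimately show ?thesis by (rule less_le_trans[rotated])
qed

text \<open>The reflection in the hyperplane orthogonal to \<open>a - b\<close>. For
  \<open>a = b\<close> division by zero makes it the identity, so it is always an isometric
  involution, and it exchanges two given vectors of equal length. It serves as the rotation between
  directions throughout.\<close>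

definition reflection :: "'a::real_inner \<Rightarrow> 'a \<Rightarrow> 'a \<Rightarrow> 'a" where
  "reflection a b x = x - (2 * (x \<bullet> (a - b)) / ((a - b) \<bullet> (a - b))) *\<^sub>R (a - b)"

lemma linear_reflection: "linear (reflection a b)"
proof -
  have "linear (\<lambda>x. x - (2 * (x \<bullet> u) / (u \<bullet> u)) *\<^sub>R u)" for u :: 'a
    by (rule linearI) (simp_all add: inner_add_left algebra_simps add_divide_distrib)
  then show ?thesis by (simp add: reflection_def[abs_def])
qed

lemma inner_reflection: "reflection a b x \<bullet> reflection a b y = x \<bullet> y"
proof (cases "a = b")
  case False
  define u where "u = a - b"
  have "u \<bullet> u \<noteq> 0" using False by (simp add: u_def)
  moreover have "(x - (2 * (x \<bullet> u) / (u \<bullet> u)) *\<^sub>R u) \<bullet> (y - (2 * (y \<bullet> u) / (u \<bullet> u)) *\<^sub>R u)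
      = x \<bullet> y - (2 * (y \<bullet> u) / (u \<bullet> u)) * (x \<bullet> u) - (2 * (x \<bullet> u) / (u \<bullet> u)) * (y \<bullet> u)
        + (2 * (x \<bullet> u) / (u \<bullet> u)) * (2 * (y \<bullet> u) / (u \<bullet> u)) * (u \<bullet> u)"
    by (simp only: inner_diff_left inner_diff_right inner_scaleR_left inner_scaleR_right inner_commute[of u y])
      (simp only: algebra_simps)
  ultimately show ?thesis
    unfolding reflection_def u_def[symmetric] by simp
qed (simp add: reflection_def)

lemma reflection_reflection: "reflection a b (reflection a b x) = x"
proof (cases "a = b")
  case False
  then have n: "(a - b) \<bullet> (a - b) \<noteq> 0" by simp
  define u where "u = a - b"
  have "u \<bullet> u \<noteq> 0" using n by (simp add: u_def)
  then show ?thesis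
    unfolding reflection_def u_def[symmetric]
    by (simp add: inner_diff_left)
qed (simp add: reflection_def)

lemma reflection_maps:
  assumes "norm a = norm b"
  shows "reflection a b a = b"
proof (cases "a = b")
  case False
  then have n: "(a - b) \<bullet> (a - b) \<noteq> 0" by simp
  have "a \<bullet> a = b \<bullet> b" using assms by (simp add: norm_eq)
  then have "2 * (a \<bullet> (a - b)) = (a - b) \<bullet> (a - b)"
    by (simp add: inner_diff_left inner_diff_right inner_commute)
  with n show ?thesis by (simp add: reflection_def)
qed (simp add: reflection_def)

lemma dist_reflection: "dist (reflection a b x) (reflection a b y) = dist x y"
  unfolding dist_norm linear_diff[OF linear_reflection, symmetric]
  by (simp add: norm_eq_sqrt_inner inner_reflection)

lemma norm_reflection: "norm (reflection a b x) = norm x"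
  by (simp add: norm_eq_sqrt_inner inner_reflection)

lemma borel_measurable_reflection [measurable]:
  "reflection a b \<in> borel_measurable (borel :: 'a::euclidean_space measure)"
  by (intro borel_measurable_continuous_onI linear_continuous_on linear_conv_bounded_linear[THEN iffD1]
      linear_reflection)

text \<open>A density rather than a restricted space: the measure lives on the whole space with the
  Borel sets, so products with \<open>lborel\<close> and images under global maps can be formed
  directly.\<close>

definition hyperplane_measure :: "'a::euclidean_space \<Rightarrow> 'a measure" where
  "hyperplane_measure v = density (hausdorff_measure (DIM('a) - 1)) (indicator {h. v \<bullet> h = 0})"

lemma hyperplane_borel [measurable]: "{h. v \<bullet> h = 0} \<in> sets (borel :: 'a::euclidean_space measure)"
  by (intro borel_closed closed_hyperplane)

lemma sets_hyperplane_measure [simp, measurable_cong]: "sets (hyperplane_measure v) = sets borel"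
  by (simp add: hyperplane_measure_def)

lemma space_hyperplane_measure [simp]: "space (hyperplane_measure v) = UNIV"
  by (simp add: hyperplane_measure_def)

lemma emeasure_hyperplane_measure:
  fixes v :: "'a::euclidean_space"
  assumes [measurable]: "A \<in> sets borel"
  shows "emeasure (hyperplane_measure v) A = hausdorff_outer (DIM('a) - 1) (A \<inter> {h. v \<bullet> h = 0})"
proof -
  have "emeasure (hyperplane_measure v) A
      = (\<integral>\<^sup>+ x. indicator {h. v \<bullet> h = 0} x * indicator A x \<partial>hausdorff_measure (DIM('a) - 1))"
    unfolding hyperplane_measure_def by (rule emeasure_density) (simp_all add: borel_measurable_indicator)
  also have "\<dots> = (\<integral>\<^sup>+ x. indicator ({h. v \<bullet> h = 0} \<inter> A) x \<partial>hausdorff_measure (DIM('a) - 1))"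
    by (simp only: indicator_inter_arith)
  also have "\<dots> = emeasure (hausdorff_measure (DIM('a) - 1)) ({h. v \<bullet> h = 0} \<inter> A)"
    by (rule nn_integral_indicator) (simp add: sets.Int)
  finally have "emeasure (hyperplane_measure v) A
      = emeasure (hausdorff_measure (DIM('a) - 1)) ({h. v \<bullet> h = 0} \<inter> A)" .
  then show ?thesis
    by (simp add: emeasure_hausdorff_measure Int_commute)
qed

lemma AE_hyperplane_measure: "AE h in hyperplane_measure v. v \<bullet> h = 0"
proof -
  have "emeasure (hyperplane_measure v) (- {h. v \<bullet> h = 0}) = 0"
    by (subst emeasure_hyperplane_measure) (auto simp: hausdorff_outer_empty)
  then show ?thesis
    by (intro AE_I[where N = "- {h. v \<bullet> h = 0}"]) auto
qed

lemma distr_hyperplane_measure: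
  fixes v w :: "'a::euclidean_space"
  assumes T[measurable]: "T \<in> borel_measurable borel" and iso: "\<And>x y. dist (T x) (T y) = dist x y"
    and bij: "\<And>y. \<exists>x. T x = y" and hyp: "\<And>x. w \<bullet> T x = 0 \<longleftrightarrow> v \<bullet> x = 0"
  shows "distr (hyperplane_measure v) borel T = hyperplane_measure w"
proof (rule measure_eqI)
  fix A assume "A \<in> sets (distr (hyperplane_measure v) borel T)"
  then have A[measurable]: "A \<in> sets borel" by simp
  have "T ` (T -` A \<inter> {h. v \<bullet> h = 0}) = A \<inter> {h. w \<bullet> h = 0}"
  proof (intro equalityI subsetI)
    fix y assume y: "y \<in> A \<inter> {h. w \<bullet> h = 0}"
    obtain x where "T x = y" using bij by blast
    with y show "y \<in> T ` (T -` A \<inter> {h. v \<bullet> h = 0})" using hyp[of x] by blast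
  qed (use hyp in auto)
  moreover have "hausdorff_outer (DIM('a) - 1) (T ` (T -` A \<inter> {h. v \<bullet> h = 0}))
      = hausdorff_outer (DIM('a) - 1) (T -` A \<inter> {h. v \<bullet> h = 0})"
    using iso by (intro hausdorff_outer_isometry)
  moreover have "T -` A \<in> sets borel"
    using measurable_sets[OF T A] by simp
  ultimately show "emeasure (distr (hyperplane_measure v) borel T) A = emeasure (hyperplane_measure w) A"
    by (simp add: emeasure_distr emeasure_hyperplane_measure)
qed simp

lemma hyperplane_measure_translate:
  fixes v :: "'a::euclidean_space"
  assumes "v \<bullet> c = 0"
  shows "distr (hyperplane_measure v) borel (\<lambda>x. x + c) = hyperplane_measure v"
proof (rule distr_hyperplane_measure)
  show "\<exists>x. x + c = y" for y by (rule exI[of _ "y - c"]) simp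
qed (use assms in \<open>auto simp: inner_add_right\<close>)

lemma hyperplane_measure_reflection:
  fixes v w :: "'a::euclidean_space"
  assumes "norm v = norm w"
  shows "distr (hyperplane_measure v) borel (reflection v w) = hyperplane_measure w"
proof (rule distr_hyperplane_measure)
  show "w \<bullet> reflection v w x = 0 \<longleftrightarrow> v \<bullet> x = 0" for x
    using inner_reflection[of v w v x] reflection_maps[OF assms] by simp
  show "\<exists>x. reflection v w x = y" for y
    using reflection_reflection by blast
qed (auto simp: dist_reflection)

text \<open>Balls about the origin are invariant under reflections; this carries finiteness and
  positivity from coordinate hyperplanes to all hyperplanes.\<close>

lemma hausdorff_outer_hyperplane_cball:
  fixes v w :: "'a::euclidean_space"
  assumes "norm v = norm w"
  shows "hausdorff_outer (DIM('a) - 1) ({h. v \<bullet> h = 0} \<inter> cball 0 R)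
    = hausdorff_outer (DIM('a) - 1) ({h. w \<bullet> h = 0} \<inter> cball 0 R)"
proof -
  have "reflection v w -` cball 0 R = cball 0 R"
    by (auto simp: norm_reflection)
  moreover have "emeasure (hyperplane_measure w) (cball 0 R)
      = emeasure (hyperplane_measure v) (reflection v w -` cball 0 R)"
    unfolding hyperplane_measure_reflection[OF assms, symmetric] by (subst emeasure_distr) auto
  ultimately show ?thesis
    by (simp add: emeasure_hyperplane_measure Int_commute)
qed

lemma hausdorff_outer_hyperplane_bounded_finite:
  fixes v :: "'a::euclidean_space"
  assumes "norm v = 1" "A \<subseteq> {h. v \<bullet> h = 0}" "bounded A"
  shows "hausdorff_outer (DIM('a) - 1) A < \<infinity>"
proof -
  obtain R where R: "0 < R" "A \<subseteq> cball 0 R"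
    using assms(3) bounded_pos[of A] by (auto simp: subset_iff)
  obtain b :: 'a where b: "b \<in> Basis" using nonempty_Basis by blast
  have "hausdorff_outer (DIM('a) - 1) A \<le> hausdorff_outer (DIM('a) - 1) ({h. v \<bullet> h = 0} \<inter> cball 0 R)"
    using R assms by (intro hausdorff_outer_mono) auto
  also have "\<dots> = hausdorff_outer (DIM('a) - 1) ({h. b \<bullet> h = 0} \<inter> cball 0 R)"
    using assms b by (intro hausdorff_outer_hyperplane_cball) simp
  also have "\<dots> \<le> hausdorff_outer (DIM('a) - 1) {x. x \<bullet> b = 0 \<and> (\<forall>i\<in>Basis. \<bar>x \<bullet> i\<bar> \<le> R)}"
    by (intro hausdorff_outer_mono) (auto simp: inner_commute intro: order_trans[OF Basis_le_norm])
  also have "\<dots> < \<infinity>"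
    using b R(1) by (rule hausdorff_outer_coordinate_hyperplane_finite)
  finally show ?thesis .
qed

lemma hausdorff_outer_hyperplane_ball_pos:
  fixes v :: "'a::euclidean_space"
  assumes "norm v = 1" "0 < s"
  shows "0 < hausdorff_outer (DIM('a) - 1) ({h. v \<bullet> h = 0} \<inter> cball 0 s)"
proof -
  obtain b :: 'a where b: "b \<in> Basis" using nonempty_Basis by blast
  define s' where "s' = s / DIM('a)"
  have s': "0 < s'" using assms by (simp add: s'_def)
  note hausdorff_outer_coordinate_cube_pos[OF b s']
  also have "hausdorff_outer (DIM('a) - 1) {x. x \<bullet> b = 0 \<and> (\<forall>i\<in>Basis - {b}. \<bar>x \<bullet> i\<bar> \<le> s')}
      \<le> hausdorff_outer (DIM('a) - 1) ({h. b \<bullet> h = 0} \<inter> cball 0 s)"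
  proof (rule hausdorff_outer_mono, clarify)
    fix x assume x: "x \<bullet> b = 0" "\<forall>i\<in>Basis - {b}. \<bar>x \<bullet> i\<bar> \<le> s'"
    then have "\<bar>x \<bullet> i\<bar> \<le> s'" if "i \<in> Basis" for i using s' that by (cases "i = b") auto
    then have "(\<Sum>i\<in>Basis. \<bar>x \<bullet> i\<bar>) \<le> (\<Sum>i\<in>(Basis::'a set). s')" by (intro sum_mono)
    also have "\<dots> = s" by (simp add: s'_def)
    finally show "x \<in> {h. b \<bullet> h = 0} \<inter> cball 0 s"
      using x norm_le_l1[of x] by (simp add: inner_commute)
  qed
  also have "\<dots> = hausdorff_outer (DIM('a) - 1) ({h. v \<bullet> h = 0} \<inter> cball 0 s)"
    using assms b by (intro hausdorff_outer_hyperplane_cball) simp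
  finally show ?thesis .
qed

lemma sigma_finite_hyperplane_measure:
  fixes v :: "'a::euclidean_space"
  assumes "norm v = 1"
  shows "sigma_finite_measure (hyperplane_measure v)"
proof
  have "emeasure (hyperplane_measure v) (cball 0 (real n)) \<noteq> \<infinity>" for n
    using hausdorff_outer_hyperplane_bounded_finite[OF assms, of "cball 0 (real n) \<inter> {h. v \<bullet> h = 0}"]
    by (simp add: emeasure_hyperplane_measure bounded_Int)
  moreover have "(\<Union>n. cball (0::'a) (real n)) = UNIV"
    using real_arch_simple by (auto simp: set_eq_iff)
  ultimately show "\<exists>A. countable A \<and> A \<subseteq> sets (hyperplane_measure v) \<and> \<Union> A = space (hyperplane_measure v)
      \<and> (\<forall>a\<in>A. emeasure (hyperplane_measure v) a \<noteq> \<infinity>)"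
    by (intro exI[of _ "range (\<lambda>n. cball (0::'a) (real n))"]) auto
qed

section \<open>Slicing Lebesgue measure by parallel lines\<close>

lemma nn_integral_lborel_translate:
  fixes c :: "'a::euclidean_space"
  assumes [measurable]: "f \<in> borel_measurable borel"
  shows "(\<integral>\<^sup>+ x. f (x + c) \<partial>lborel) = (\<integral>\<^sup>+ x. f x \<partial>lborel)"
  by (subst (2) lborel_distr_plus[of c, symmetric]) (simp add: nn_integral_distr add.commute)

text \<open>Uniqueness of Haar measure through Fubini: the double integral of
  \<open>indicator A x * indicator Q (y - x)\<close>, with \<open>Q\<close> the unit cube, is
  evaluated in both orders.\<close>

lemma translation_invariant_eq_scaled_lborel:
  fixes M :: "'a::euclidean_space measure"
  assumes sets[measurable_cong]: "sets M = sets borel" and "sigma_finite_measure M"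
    and inv: "\<And>a. distr M borel (\<lambda>x. x + a) = M"
    and [measurable]: "A \<in> sets borel"
  shows "emeasure M A = emeasure M {x. - x \<in> cbox 0 One} * emeasure lborel A"
proof -
  interpret M: sigma_finite_measure M by fact
  interpret P: pair_sigma_finite M "lborel :: 'a measure" ..
  let ?Q = "cbox 0 One :: 'a set"
  have space: "space M = UNIV" using sets_eq_imp_space_eq[OF sets] by simp
  have translate: "(\<integral>\<^sup>+ x. f (x + c) \<partial>M) = (\<integral>\<^sup>+ x. f x \<partial>M)"
    if [measurable]: "f \<in> borel_measurable borel" for f c
    by (subst (2) inv[of c, symmetric]) (simp add: nn_integral_distr)
  have "emeasure lborel ?Q = 1" by (simp add: emeasure_lborel_cbox_eq)
  then have "emeasure M A = (\<integral>\<^sup>+ x. indicator A x * emeasure lborel ?Q \<partial>M)"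
    by (simp add: nn_integral_multc space)
  also have "\<dots> = (\<integral>\<^sup>+ x. indicator A x * (\<integral>\<^sup>+ y. indicator ?Q (y + - x) \<partial>lborel) \<partial>M)"
    by (subst nn_integral_lborel_translate) auto
  also have "\<dots> = (\<integral>\<^sup>+ x. (\<integral>\<^sup>+ y. indicator A x * indicator ?Q (y - x) \<partial>lborel) \<partial>M)"
    by (simp add: nn_integral_cmult)
  also have "\<dots> = (\<integral>\<^sup>+ y. (\<integral>\<^sup>+ x. indicator A x * indicator ?Q (y - x) \<partial>M) \<partial>lborel)"
    by (rule P.Fubini'[symmetric]) measurable
  \<comment> \<open>Translating \<open>M\<close> by \<open>y\<close> removes \<open>y\<close> from
    the second factor, after which the \<open>y\<close>-integral sees only a translate of
    \<open>A\<close>.\<close>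
  also have "\<dots> = (\<integral>\<^sup>+ y. (\<integral>\<^sup>+ x. indicator A (x + y) * indicator ?Q (y - (x + y)) \<partial>M) \<partial>lborel)"
    by (intro nn_integral_cong translate[symmetric]) measurable
  also have "\<dots> = (\<integral>\<^sup>+ x. (\<integral>\<^sup>+ y. indicator A (y + x) * indicator ?Q (- x) \<partial>lborel) \<partial>M)"
    by (subst P.Fubini') (auto simp: add.commute)
  also have "\<dots> = (\<integral>\<^sup>+ x. emeasure lborel A * indicator ?Q (- x) \<partial>M)"
    by (simp add: nn_integral_multc nn_integral_lborel_translate)
  also have "\<dots> = emeasure lborel A * (\<integral>\<^sup>+ x. indicator {x. - x \<in> ?Q} x \<partial>M)"
    by (subst nn_integral_cmult[symmetric]) (auto simp: indicator_def)
  also have "\<dots> = emeasure lborel A * emeasure M {x. - x \<in> ?Q}"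
    by (subst nn_integral_indicator) (auto simp: sets)
  finally show ?thesis by (simp add: mult.commute)
qed

text \<open>The image measure is translation invariant because the reflection is linear, hence a
  multiple of Lebesgue measure; the unit ball is mapped to itself, so the multiple is 1.\<close>

lemma lborel_distr_reflection:
  "distr lborel borel (reflection a b) = (lborel :: 'a::euclidean_space measure)"
proof -
  let ?M = "distr lborel borel (reflection a b) :: 'a measure"
  let ?c = "emeasure ?M {x. - x \<in> cbox 0 One}"
  have inv: "distr ?M borel (\<lambda>x. x + c) = ?M" for c
  proof -
    have "distr ?M borel (\<lambda>x. x + c) = distr lborel borel (\<lambda>x. reflection a b x + c)"
      by (subst distr_distr) (auto simp: comp_def)
    also have "\<dots> = distr lborel borel (\<lambda>x. reflection a b (reflection a b c + x))"
      by (simp add: linear_add[OF linear_reflection] reflection_reflection add.commute)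
    also have "\<dots> = distr (distr lborel borel ((+) (reflection a b c))) borel (reflection a b)"
      by (subst distr_distr) (auto simp: comp_def)
    finally show ?thesis by (simp add: lborel_distr_plus)
  qed
  have sf: "sigma_finite_measure ?M"
  proof
    have *: "emeasure ?M (cball 0 (real n)) \<noteq> \<infinity>" for n
    proof -
      have "reflection a b -` cball 0 (real n) = cball 0 (real n)" by (auto simp: norm_reflection)
      then show ?thesis using emeasure_lborel_cball_finite[of "0::'a" "real n"] by (simp add: emeasure_distr less_top[symmetric])
    qed
    have "(\<Union>n. cball (0::'a) (real n)) = UNIV"
      using real_arch_simple by (auto simp: set_eq_iff)
    then show "\<exists>A. countable A \<and> A \<subseteq> sets ?M \<and> \<Union> A = space ?M \<and> (\<forall>a\<in>A. emeasure ?M a \<noteq> \<infinity>)"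
      using * by (intro exI[of _ "range (\<lambda>n. cball (0::'a) (real n))"]) auto
  qed
  have eq: "emeasure ?M A = ?c * emeasure lborel A" if "A \<in> sets borel" for A
    using translation_invariant_eq_scaled_lborel[OF _ sf inv that] by simp
  have "reflection a b -` ball 0 1 = ball 0 1" by (auto simp: norm_reflection)
  then have "emeasure lborel (ball 0 1 :: 'a set) = ?c * emeasure lborel (ball 0 1 :: 'a set)"
    using eq[of "ball 0 1"] by (simp add: emeasure_distr less_top[symmetric])
  moreover have "unit_ball_vol (real DIM('a)) \<noteq> 0"
    by (rule less_imp_neq[symmetric]) (simp add: unit_ball_vol_pos)
  then have "emeasure lborel (ball 0 1 :: 'a set) \<noteq> 0" "emeasure lborel (ball 0 1 :: 'a set) \<noteq> top"
    by (auto simp: emeasure_ball)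
  ultimately have "?c = 1"
    using \<open>emeasure lborel (ball 0 1 :: 'a set) \<noteq> 0\<close>
    by (metis ennreal_mult_divide_eq mult.left_neutral)
  with eq show ?thesis by (intro measure_eqI) auto
qed

text \<open>Lebesgue measure rebuilt by Fubini from the hyperplane orthogonal to \<open>v\<close>
  and the lines parallel to \<open>v\<close>. The map is not injective on the full product, but the
  first factor charges only the hyperplane, where \<open>h\<close> and \<open>t\<close> are
  orthogonal coordinates.\<close>

definition slice_measure :: "'a::euclidean_space \<Rightarrow> 'a measure" where
  "slice_measure v = distr (hyperplane_measure v \<Otimes>\<^sub>M lborel) borel (\<lambda>(h, t). h + t *\<^sub>R v)"

lemma sets_slice_measure [simp, measurable_cong]: "sets (slice_measure v) = sets borel"
  by (simp add: slice_measure_def)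

lemma nn_integral_slice_measure:
  fixes v :: "'a::euclidean_space"
  assumes [measurable]: "f \<in> borel_measurable borel"
  shows "(\<integral>\<^sup>+ x. f x \<partial>slice_measure v)
    = (\<integral>\<^sup>+ h. (\<integral>\<^sup>+ t. f (h + t *\<^sub>R v) \<partial>lborel) \<partial>hyperplane_measure v)"
  unfolding slice_measure_def
  by (subst nn_integral_distr) (auto simp: lborel.nn_integral_fst[symmetric] case_prod_beta)

lemma emeasure_slice_measure:
  fixes v :: "'a::euclidean_space"
  assumes [measurable]: "A \<in> sets borel"
  shows "emeasure (slice_measure v) A
    = (\<integral>\<^sup>+ h. (\<integral>\<^sup>+ t. indicator A (h + t *\<^sub>R v) \<partial>lborel) \<partial>hyperplane_measure v)"
  by (subst nn_integral_slice_measure[symmetric]) auto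

text \<open>The part of \<open>a\<close> orthogonal to \<open>v\<close> is absorbed by the
  hyperplane measure, and the part along \<open>v\<close> by Lebesgue measure on the lines.\<close>

lemma slice_measure_translate:
  fixes v :: "'a::euclidean_space"
  assumes v: "norm v = 1"
  shows "distr (slice_measure v) borel (\<lambda>x. x + a) = slice_measure v"
proof (rule measure_eqI)
  fix A assume "A \<in> sets (distr (slice_measure v) borel (\<lambda>x. x + a))"
  then have A[measurable]: "A \<in> sets borel" by simp
  have vv: "v \<bullet> v = 1" using v by (simp add: norm_eq_1)
  define s where "s = v \<bullet> a"
  define c where "c = a - s *\<^sub>R v"
  have c: "v \<bullet> c = 0" "a = c + s *\<^sub>R v" by (auto simp: c_def s_def inner_diff_right vv)
  have "emeasure (distr (slice_measure v) borel (\<lambda>x. x + a)) A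
      = emeasure (slice_measure v) ((\<lambda>x. x + a) -` A)"
    by (subst emeasure_distr) (auto simp: slice_measure_def)
  also have "\<dots> = (\<integral>\<^sup>+ h. (\<integral>\<^sup>+ t. indicator A ((h + c) + (t + s) *\<^sub>R v) \<partial>lborel) \<partial>hyperplane_measure v)"
  proof (subst emeasure_slice_measure)
    show "(\<lambda>x. x + a) -` A \<in> sets borel"
      using measurable_sets[of "\<lambda>x. x + a" borel borel A] by simp
  qed (auto simp: c(2) algebra_simps indicator_def)
  also have "\<dots> = (\<integral>\<^sup>+ h. (\<integral>\<^sup>+ t. indicator A ((h + c) + t *\<^sub>R v) \<partial>lborel) \<partial>hyperplane_measure v)"
    by (intro nn_integral_cong nn_integral_lborel_translate[of "\<lambda>t. indicator A ((_ + c) + t *\<^sub>R v)"]) auto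
  also have "\<dots> = (\<integral>\<^sup>+ h. (\<integral>\<^sup>+ t. indicator A (h + t *\<^sub>R v) \<partial>lborel) \<partial>distr (hyperplane_measure v) borel (\<lambda>x. x + c))"
    by (subst nn_integral_distr) auto
  also have "\<dots> = emeasure (slice_measure v) A"
    by (simp add: hyperplane_measure_translate[OF c(1)] emeasure_slice_measure)
  finally show "emeasure (distr (slice_measure v) borel (\<lambda>x. x + a)) A = emeasure (slice_measure v) A" .
qed simp

text \<open>By Pythagoras a line that meets a set inside the ball of radius \<open>R\<close> has its
  foot in that ball and meets the set in length at most \<open>2 * R\<close>.\<close>

lemma emeasure_slice_measure_bounded:
  fixes v :: "'a::euclidean_space"
  assumes v: "norm v = 1" and A: "A \<in> sets borel" "bounded A"
  shows "emeasure (slice_measure v) A < \<infinity>"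
proof -
  have vv: "v \<bullet> v = 1" using v by (simp add: norm_eq_1)
  obtain R where R: "0 < R" "\<And>x. x \<in> A \<Longrightarrow> norm x \<le> R"
    using A(2) bounded_pos[of A] by auto
  have mA[measurable]: "A \<in> sets borel" by fact
  have AE: "AE h in hyperplane_measure v. (\<integral>\<^sup>+ t. indicator A (h + t *\<^sub>R v) \<partial>lborel) \<le> ennreal (2 * R) * indicator (cball 0 R) h"
    using AE_hyperplane_measure
  proof eventually_elim
    fix h assume h: "v \<bullet> h = 0"
    have "norm h \<le> norm (h + t *\<^sub>R v)" "\<bar>t\<bar> \<le> norm (h + t *\<^sub>R v)" for t
    proof -
      have "norm (h + t *\<^sub>R v) ^ 2 = norm h ^ 2 + t ^ 2"
        unfolding power2_norm_eq_inner using h vv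
        by (simp add: inner_add_left inner_add_right inner_commute power2_eq_square)
      then have "norm h ^ 2 \<le> norm (h + t *\<^sub>R v) ^ 2" "\<bar>t\<bar> ^ 2 \<le> norm (h + t *\<^sub>R v) ^ 2" by auto
      then show "norm h \<le> norm (h + t *\<^sub>R v)" "\<bar>t\<bar> \<le> norm (h + t *\<^sub>R v)"
        by (auto intro: power2_le_imp_le)
    qed
    then have "h + t *\<^sub>R v \<in> A \<Longrightarrow> norm h \<le> R \<and> - R \<le> t \<and> t \<le> R" for t
      using R(2)[of "h + t *\<^sub>R v"] by (meson order_trans abs_le_iff minus_le_iff)
    then have "indicator A (h + t *\<^sub>R v) \<le> indicator (cball 0 R) h * indicator {-R..R} t * (1::ennreal)" for t
      by (auto simp: indicator_def)
    then have "(\<integral>\<^sup>+ t. indicator A (h + t *\<^sub>R v) \<partial>lborel) \<le> (\<integral>\<^sup>+ t. indicator (cball 0 R) h * indicator {-R..R} t \<partial>lborel)"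
      by (intro nn_integral_mono) simp
    also have "\<dots> = indicator (cball 0 R) h * ennreal (2 * R)"
      using R by (subst nn_integral_cmult) auto
    finally show "(\<integral>\<^sup>+ t. indicator A (h + t *\<^sub>R v) \<partial>lborel) \<le> ennreal (2 * R) * indicator (cball 0 R) h"
      by (simp add: mult.commute)
  qed
  have "emeasure (slice_measure v) A \<le> (\<integral>\<^sup>+ h. ennreal (2 * R) * indicator (cball 0 R) h \<partial>hyperplane_measure v)"
    unfolding emeasure_slice_measure[OF A(1)] using AE by (rule nn_integral_mono_AE)
  also have "\<dots> = ennreal (2 * R) * emeasure (hyperplane_measure v) (cball 0 R)"
    by (rule nn_integral_cmult_indicator) simp
  also have "\<dots> < \<infinity>"
    using hausdorff_outer_hyperplane_bounded_finite[OF v, of "cball 0 R \<inter> {h. v \<bullet> h = 0}"]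
    by (auto simp: emeasure_hyperplane_measure bounded_Int ennreal_mult_less_top)
  finally show ?thesis .
qed

lemma emeasure_slice_measure_cball_pos:
  fixes v :: "'a::euclidean_space"
  assumes v: "norm v = 1"
  shows "0 < emeasure (slice_measure v) (cball 0 2)"
proof -
  have "emeasure (hyperplane_measure v) (cball 0 1) = (\<integral>\<^sup>+ h. (\<integral>\<^sup>+ t. indicator (cball 0 1) h * indicator {0..1::real} t \<partial>lborel) \<partial>hyperplane_measure v)"
    by (simp add: nn_integral_cmult_indicator)
  also have "\<dots> \<le> emeasure (slice_measure v) (cball 0 2)"
    unfolding emeasure_slice_measure[OF borel_closed[OF closed_cball]]
  proof (intro nn_integral_mono)
    fix h t
    have "norm (h + t *\<^sub>R v) \<le> norm h + \<bar>t\<bar>"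
      using norm_triangle_ineq[of h "t *\<^sub>R v"] v by simp
    then show "indicator (cball 0 1) h * indicator {0..1} t \<le> (indicator (cball 0 2) (h + t *\<^sub>R v) :: ennreal)"
      by (auto simp: indicator_def)
  qed
  finally show ?thesis
    using hausdorff_outer_hyperplane_ball_pos[OF v zero_less_one]
    by (simp add: emeasure_hyperplane_measure Int_commute)
qed

lemma slice_measure_scaled_lborel:
  fixes v :: "'a::euclidean_space"
  assumes v: "norm v = 1"
  shows "\<exists>\<kappa>>0. \<forall>A\<in>sets borel. emeasure (slice_measure v) A = ennreal \<kappa> * emeasure lborel A"
proof -
  let ?M = "slice_measure v"
  let ?c = "emeasure ?M {x. - x \<in> cbox 0 One}"
  have sf: "sigma_finite_measure ?M"
  proof
    have "emeasure ?M (cball 0 (real n)) \<noteq> \<infinity>" for n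
      using emeasure_slice_measure_bounded[OF v, of "cball 0 (real n)"] by simp
    moreover have "(\<Union>n. cball (0::'a) (real n)) = UNIV"
      using real_arch_simple by (auto simp: set_eq_iff)
    moreover have "space ?M = UNIV" by (simp add: slice_measure_def)
    ultimately show "\<exists>A. countable A \<and> A \<subseteq> sets ?M \<and> \<Union> A = space ?M \<and> (\<forall>a\<in>A. emeasure ?M a \<noteq> \<infinity>)"
      by (intro exI[of _ "range (\<lambda>n. cball (0::'a) (real n))"]) auto
  qed
  have eq: "emeasure ?M A = ?c * emeasure lborel A" if "A \<in> sets borel" for A
    using translation_invariant_eq_scaled_lborel[OF _ sf slice_measure_translate[OF v] that] by simp
  have Q: "{x. - x \<in> cbox 0 One} = cbox (- One) (0::'a)"
    by (auto simp: mem_box)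
  have "?c < \<infinity>"
    unfolding Q by (intro emeasure_slice_measure_bounded[OF v]) auto
  moreover have "?c \<noteq> 0"
    using eq[of "cball 0 2"] emeasure_slice_measure_cball_pos[OF v] by auto
  ultimately obtain \<kappa> where "?c = ennreal \<kappa>" "0 < \<kappa>"
    by (cases ?c) (auto simp: less_le)
  with eq show ?thesis by auto
qed

text \<open>The condition quantifies over all unit vectors at once, so that a single factor serves
  every direction; \<open>local_divergence\<close> compares different directions and relies on
  this.\<close>

definition slice_constant :: "'a::euclidean_space itself \<Rightarrow> real" where
  "slice_constant _ = (SOME \<kappa>. 0 < \<kappa> \<and> (\<forall>v::'a. norm v = 1 \<longrightarrow>
     (\<forall>A\<in>sets borel. emeasure (slice_measure v) A = ennreal \<kappa> * emeasure lborel A)))"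

text \<open>A reflection that takes a basis vector to \<open>v\<close> carries one slicing to the
  other and preserves Lebesgue measure, so the factor found for the basis vector is valid for
  \<open>v\<close>.\<close>

lemma slice_constant:
  shows slice_constant_pos: "0 < slice_constant TYPE('a::euclidean_space)"
    and emeasure_slice_measure_lborel: "norm v = 1 \<Longrightarrow> A \<in> sets borel \<Longrightarrow>
      emeasure (slice_measure v) A = ennreal (slice_constant TYPE('a)) * emeasure lborel (A :: 'a set)"
proof -
  obtain b :: 'a where b: "b \<in> Basis" using nonempty_Basis by blast
  then have nb: "norm b = 1" by simp
  obtain \<kappa> where \<kappa>: "0 < \<kappa>" "\<And>A. A \<in> sets borel \<Longrightarrow> emeasure (slice_measure b) A = ennreal \<kappa> * emeasure lborel A"
    using slice_measure_scaled_lborel[OF nb] by blast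
  have eq: "emeasure (slice_measure v) A = ennreal \<kappa> * emeasure lborel A"
    if v: "norm v = 1" and A[measurable]: "A \<in> sets borel" for v :: 'a and A
  proof -
    let ?O = "reflection b v"
    have Ob: "?O b = v" using nb v by (intro reflection_maps) simp
    have mO[measurable]: "?O -` A \<in> sets borel"
      using measurable_sets[OF borel_measurable_reflection, of A b v] by simp
    have "emeasure (slice_measure v) A
        = (\<integral>\<^sup>+ h. (\<integral>\<^sup>+ t. indicator A (h + t *\<^sub>R v) \<partial>lborel) \<partial>distr (hyperplane_measure b) borel ?O)"
      using nb v by (simp add: hyperplane_measure_reflection emeasure_slice_measure)
    also have "\<dots> = (\<integral>\<^sup>+ h. (\<integral>\<^sup>+ t. indicator A (?O h + t *\<^sub>R v) \<partial>lborel) \<partial>hyperplane_measure b)"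
      by (subst nn_integral_distr) auto
    also have "\<dots> = (\<integral>\<^sup>+ h. (\<integral>\<^sup>+ t. indicator (?O -` A) (h + t *\<^sub>R b) \<partial>lborel) \<partial>hyperplane_measure b)"
      using Ob by (simp add: indicator_def linear_add[OF linear_reflection] linear_cmul[OF linear_reflection])
    also have "\<dots> = emeasure (slice_measure b) (?O -` A)"
      by (simp add: emeasure_slice_measure)
    also have "\<dots> = ennreal \<kappa> * emeasure lborel (?O -` A)"
      by (simp add: \<kappa>)
    also have "emeasure lborel (?O -` A) = emeasure (distr lborel borel ?O) A"
      by (simp add: emeasure_distr less_top[symmetric])
    finally show ?thesis by (simp add: lborel_distr_reflection)
  qed
  have "\<exists>\<kappa>. 0 < \<kappa> \<and> (\<forall>v::'a. norm v = 1 \<longrightarrow>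
     (\<forall>A\<in>sets borel. emeasure (slice_measure v) A = ennreal \<kappa> * emeasure lborel A))"
    using \<kappa>(1) eq by blast
  from someI_ex[OF this, folded slice_constant_def]
  show "0 < slice_constant TYPE('a)"
    and "norm v = 1 \<Longrightarrow> A \<in> sets borel \<Longrightarrow>
      emeasure (slice_measure v) A = ennreal (slice_constant TYPE('a)) * emeasure lborel (A :: 'a set)"
    by (auto simp: slice_constant_def)
qed

lemma slice_measure_eq:
  fixes v :: "'a::euclidean_space"
  assumes "norm v = 1"
  shows "slice_measure v = density lborel (\<lambda>_. ennreal (slice_constant TYPE('a)))"
  using emeasure_slice_measure_lborel[OF assms]
  by (intro measure_eqI) (auto simp: emeasure_density_const)

lemma
  fixes v :: "'a::euclidean_space" and f :: "'a \<Rightarrow> real"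
  assumes v: "norm v = 1" and f: "integrable lborel f"
  shows integrable_slice: "integrable (hyperplane_measure v) (\<lambda>h. \<integral>t. f (h + t *\<^sub>R v) \<partial>lborel)"
    and integral_slice: "(\<integral>h. (\<integral>t. f (h + t *\<^sub>R v) \<partial>lborel) \<partial>hyperplane_measure v)
      = slice_constant TYPE('a) * (\<integral>x. f x \<partial>lborel)"
proof -
  interpret H: sigma_finite_measure "hyperplane_measure v"
    using v by (rule sigma_finite_hyperplane_measure)
  interpret P: pair_sigma_finite "hyperplane_measure v" "lborel :: real measure" ..
  let ?g = "\<lambda>p. f ((\<lambda>(h, t). h + t *\<^sub>R v) p)"
  have mf[measurable]: "f \<in> borel_measurable borel"
    using borel_measurable_integrable[OF f] by simp
  have int: "integrable (slice_measure v) f"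
    unfolding slice_measure_eq[OF v] using f slice_constant_pos[where 'a='a]
    by (subst integrable_density) auto
  have int2: "integrable (hyperplane_measure v \<Otimes>\<^sub>M lborel) ?g"
    by (rule integrable_distr[OF _ int[unfolded slice_measure_def]]) measurable
  show "integrable (hyperplane_measure v) (\<lambda>h. \<integral>t. f (h + t *\<^sub>R v) \<partial>lborel)"
    using P.integrable_fst'[OF int2] by simp
  have "(\<integral>h. (\<integral>t. f (h + t *\<^sub>R v) \<partial>lborel) \<partial>hyperplane_measure v)
      = (\<integral>p. ?g p \<partial>(hyperplane_measure v \<Otimes>\<^sub>M lborel))"
    using P.integral_fst'[OF int2] by simp
  also have "\<dots> = (\<integral>x. f x \<partial>slice_measure v)"
    unfolding slice_measure_def by (subst integral_distr) auto
  also have "\<dots> = slice_constant TYPE('a) * (\<integral>x. f x \<partial>lborel)"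
    unfolding slice_measure_eq[OF v] using slice_constant_pos[where 'a='a]
    by (subst integral_density) auto
  finally show "(\<integral>h. (\<integral>t. f (h + t *\<^sub>R v) \<partial>lborel) \<partial>hyperplane_measure v)
      = slice_constant TYPE('a) * (\<integral>x. f x \<partial>lborel)" .
qed

section \<open>Orthogonal projections onto hyperplanes\<close>

definition proj :: "'a::real_inner \<Rightarrow> 'a \<Rightarrow> 'a" where
  "proj v x = x - (v \<bullet> x) *\<^sub>R v"

lemma proj_diff: "proj v (x - y) = proj v x - proj v y"
  by (simp add: proj_def inner_diff_right algebra_simps)

lemma proj_add: "proj v (x + y) = proj v x + proj v y"
  by (simp add: proj_def inner_add_right algebra_simps)

lemma proj_scaleR: "proj v (c *\<^sub>R x) = c *\<^sub>R proj v x"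
  by (simp add: proj_def algebra_simps)

lemma proj_eq: "proj v x + (v \<bullet> x) *\<^sub>R v = x"
  by (simp add: proj_def)

lemma inner_proj: "norm v = 1 \<Longrightarrow> v \<bullet> proj v x = 0"
  by (simp add: proj_def inner_diff_right norm_eq_1)

lemma norm_proj_square: "norm v = 1 \<Longrightarrow> norm (proj v x) ^ 2 = norm x ^ 2 - (v \<bullet> x) ^ 2"
  unfolding power2_norm_eq_inner
  by (simp add: proj_def inner_diff_right inner_diff_left norm_eq_1 inner_commute power2_eq_square)

lemma norm_proj_le:
  assumes "norm v = 1"
  shows "norm (proj v x) \<le> norm x"
proof (rule power2_le_imp_le)
  show "norm (proj v x) ^ 2 \<le> norm x ^ 2" using assms by (simp add: norm_proj_square)
qed simp

lemma continuous_on_proj [continuous_intros]: "continuous_on S f \<Longrightarrow> continuous_on S (\<lambda>x. proj v (f x))"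
  unfolding proj_def by (intro continuous_intros)

lemma borel_measurable_proj [measurable]: "proj v \<in> borel_measurable (borel :: 'a::euclidean_space measure)"
  unfolding proj_def[abs_def] by measurable

text \<open>Since \<open>w\<close> is orthogonal to \<open>n\<close>, only the component
  \<open>proj n v\<close> contributes to \<open>v \<bullet> w\<close>, and its squared length is
  \<open>1 - (n \<bullet> v)\<^sup>2\<close>. What Cauchy-Schwarz leaves for the projection of
  \<open>w\<close> is at least the cosine of the angle between the hyperplanes.\<close>

lemma norm_proj_ge_of_orthogonal:
  assumes v: "norm v = 1" and n: "norm n = 1" and nw: "n \<bullet> w = 0" and c: "0 \<le> n \<bullet> v"
  shows "(n \<bullet> v) * norm w \<le> norm (proj v w)"
proof (rule power2_le_imp_le)
  have "v \<bullet> w = proj n v \<bullet> w"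
    by (simp add: proj_def inner_diff_left nw)
  then have "(v \<bullet> w)\<^sup>2 \<le> (norm (proj n v) * norm w)\<^sup>2"
    using Cauchy_Schwarz_ineq2[of "proj n v" w] by (simp add: abs_le_square_iff[symmetric] abs_mult)
  also have "\<dots> = (1 - (n \<bullet> v)\<^sup>2) * (norm w)\<^sup>2"
    using n v by (simp add: power_mult_distrib norm_proj_square)
  finally show "((n \<bullet> v) * norm w)\<^sup>2 \<le> (norm (proj v w))\<^sup>2"
    using v by (simp add: norm_proj_square power_mult_distrib algebra_simps)
qed simp

text \<open>
  Both sides are, up to the slicing constant, the volume of the sheared cylinder with base \<open>A\<close>
  and generator \<open>v\<close>, sliced once in direction \<open>v\<close> and once in direction \<open>n\<close>.
\<close>

lemma hausdorff_outer_proj_hyperplane: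
  fixes v n :: "'a::euclidean_space"
  assumes v: "norm v = 1" and n: "norm n = 1" and c: "0 < n \<bullet> v"
    and A[measurable]: "A \<in> sets borel" and An: "A \<subseteq> {h. n \<bullet> h = 0}"
  shows "hausdorff_outer (DIM('a) - 1) (proj v ` A) = ennreal (n \<bullet> v) * hausdorff_outer (DIM('a) - 1) A"
proof -
  define c where "c = n \<bullet> v"
  have c0: "0 < c" using c by (simp add: c_def)
  have nn: "n \<bullet> n = 1" and vv: "v \<bullet> v = 1" using n v by (auto simp: norm_eq_1)
  \<comment> \<open>The oblique projection along \<open>v\<close> onto the hyperplane orthogonal to
    \<open>n\<close>. In these terms \<open>Z\<close> consists of the points
    \<open>a + t *\<^sub>R v\<close> with \<open>a\<close> in \<open>A\<close> and \<open>t\<close>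
    between 0 and 1.\<close>
  define Ob where "Ob x = x - ((n \<bullet> x) / c) *\<^sub>R v" for x
  define Z where "Z = {x. 0 \<le> n \<bullet> x / c \<and> n \<bullet> x / c \<le> 1 \<and> Ob x \<in> A}"
  have mOb[measurable]: "Ob \<in> borel_measurable borel"
    unfolding Ob_def[abs_def] by measurable
  have mOA[measurable]: "Ob -` A \<in> sets borel"
    using measurable_sets[OF mOb A] by simp
  have mZ[measurable]: "Z \<in> sets borel"
    unfolding Z_def by measurable
  have image: "proj v ` A = Ob -` A \<inter> {h. v \<bullet> h = 0}"
  proof (intro equalityI subsetI)
    fix h assume "h \<in> proj v ` A"
    then obtain a where a: "a \<in> A" "h = proj v a" by blast
    have "n \<bullet> h = - (v \<bullet> a) * c"
      using a An by (auto simp: proj_def inner_diff_right c_def)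
    then have "Ob h = a"
      using c0 a by (simp add: Ob_def proj_def)
    with a v show "h \<in> Ob -` A \<inter> {h. v \<bullet> h = 0}" by (simp add: inner_proj)
  next
    fix h assume h: "h \<in> Ob -` A \<inter> {h. v \<bullet> h = 0}"
    then have "proj v (Ob h) = h"
      using vv by (simp add: proj_def Ob_def inner_diff_right)
    then show "h \<in> proj v ` A" using h by (metis IntD1 imageI vimageE)
  qed
  \<comment> \<open>A line parallel to \<open>v\<close> meets \<open>Z\<close> in an interval of
    length 1 if its oblique foot lies in \<open>A\<close>, and not at all otherwise.\<close>
  have "emeasure (slice_measure v) Z
      = (\<integral>\<^sup>+ h. (\<integral>\<^sup>+ t. indicator (Ob -` A) h * indicator {- (n \<bullet> h) / c .. - (n \<bullet> h) / c + 1} t \<partial>lborel) \<partial>hyperplane_measure v)"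
    unfolding emeasure_slice_measure[OF mZ]
  proof (intro nn_integral_cong)
    fix h t
    have 1: "n \<bullet> (h + t *\<^sub>R v) / c = n \<bullet> h / c + t"
      using c0 by (simp add: inner_add_right c_def[symmetric] add_divide_distrib)
    have 2: "Ob (h + t *\<^sub>R v) = Ob h"
      unfolding Ob_def 1 by (simp add: algebra_simps)
    show "indicator Z (h + t *\<^sub>R v) = (indicator (Ob -` A) h * indicator {- (n \<bullet> h) / c .. - (n \<bullet> h) / c + 1} t :: ennreal)"
      unfolding Z_def indicator_def mem_Collect_eq 1 2 by auto
  qed
  also have "\<dots> = (\<integral>\<^sup>+ h. indicator (Ob -` A) h \<partial>hyperplane_measure v)"
    by (intro nn_integral_cong, subst nn_integral_cmult) auto
  also have "\<dots> = hausdorff_outer (DIM('a) - 1) (proj v ` A)"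
    by (subst nn_integral_indicator) (auto simp: emeasure_hyperplane_measure image)
  finally have 1: "emeasure (slice_measure v) Z = hausdorff_outer (DIM('a) - 1) (proj v ` A)" .
  interpret H: sigma_finite_measure "hyperplane_measure n"
    using n by (rule sigma_finite_hyperplane_measure)
  interpret P: pair_sigma_finite "lborel :: real measure" "hyperplane_measure n" ..
  \<comment> \<open>The slice of \<open>Z\<close> at height \<open>t\<close> over the hyperplane
    orthogonal to \<open>n\<close> is \<open>A\<close> shifted by \<open>- t *\<^sub>R w\<close>, a
    vector of the same hyperplane; its measure is that of \<open>A\<close>, and the heights fill
    \<open>{0..c}\<close>.\<close>
  define w where "w = n - (1 / c) *\<^sub>R v"
  have w: "n \<bullet> w = 0" using c0 by (simp add: w_def inner_diff_right nn c_def[symmetric])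
  have "emeasure (slice_measure n) Z
      = (\<integral>\<^sup>+ h. (\<integral>\<^sup>+ t. indicator {0..c} t * indicator A (h + t *\<^sub>R w) \<partial>lborel) \<partial>hyperplane_measure n)"
    unfolding emeasure_slice_measure[OF mZ]
  proof (rule nn_integral_cong_AE)
    show "AE h in hyperplane_measure n. (\<integral>\<^sup>+ t. indicator Z (h + t *\<^sub>R n) \<partial>lborel)
        = (\<integral>\<^sup>+ t. indicator {0..c} t * indicator A (h + t *\<^sub>R w) \<partial>lborel)"
      using AE_hyperplane_measure
    proof eventually_elim
      fix h assume h: "n \<bullet> h = 0"
      show "(\<integral>\<^sup>+ t. indicator Z (h + t *\<^sub>R n) \<partial>lborel)
        = (\<integral>\<^sup>+ t. indicator {0..c} t * indicator A (h + t *\<^sub>R w) \<partial>lborel)"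
      proof (intro nn_integral_cong)
        fix t
        have 1: "n \<bullet> (h + t *\<^sub>R n) = t" using h nn by (simp add: inner_add_right)
        have 2: "Ob (h + t *\<^sub>R n) = h + t *\<^sub>R w" unfolding Ob_def 1 by (simp add: w_def algebra_simps)
        show "indicator Z (h + t *\<^sub>R n) = (indicator {0..c} t * indicator A (h + t *\<^sub>R w) :: ennreal)"
          using c0 unfolding Z_def indicator_def mem_Collect_eq 1 2 by (auto simp: field_simps)
      qed
    qed
  qed
  also have "\<dots> = (\<integral>\<^sup>+ t. (\<integral>\<^sup>+ h. indicator {0..c} t * indicator A (h + t *\<^sub>R w) \<partial>hyperplane_measure n) \<partial>lborel)"
    by (rule P.Fubini') measurable
  also have "\<dots> = (\<integral>\<^sup>+ t. indicator {0..c} t * hausdorff_outer (DIM('a) - 1) A \<partial>lborel)"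
  proof (intro nn_integral_cong)
    fix t
    have "(\<integral>\<^sup>+ h. indicator A (h + t *\<^sub>R w) \<partial>hyperplane_measure n)
        = (\<integral>\<^sup>+ h. indicator A h \<partial>distr (hyperplane_measure n) borel (\<lambda>h. h + t *\<^sub>R w))"
      by (subst nn_integral_distr) auto
    also have "\<dots> = emeasure (hyperplane_measure n) A"
      using w by (simp add: hyperplane_measure_translate)
    also have "\<dots> = hausdorff_outer (DIM('a) - 1) A"
      using An by (simp add: emeasure_hyperplane_measure Int_absorb2)
    finally show "(\<integral>\<^sup>+ h. indicator {0..c} t * indicator A (h + t *\<^sub>R w) \<partial>hyperplane_measure n)
        = indicator {0..c} t * hausdorff_outer (DIM('a) - 1) A"
      by (subst nn_integral_cmult) auto
  qed
  also have "\<dots> = ennreal c * hausdorff_outer (DIM('a) - 1) A"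
    using c0 by (subst nn_integral_multc) auto
  finally have "emeasure (slice_measure n) Z = ennreal c * hausdorff_outer (DIM('a) - 1) A" .
  with 1 show ?thesis
    using emeasure_slice_measure_lborel[OF v mZ] emeasure_slice_measure_lborel[OF n mZ]
    by (simp add: c_def)
qed

section \<open>Nearly flat pieces\<close>

text \<open>Induction over the sigma-algebra: closed sets have compact images, and injectivity makes
  images commute with complements relative to \<open>K\<close>.\<close>

lemma borel_image_inj_on_compact:
  fixes f :: "'a::t2_space \<Rightarrow> 'b::t2_space"
  assumes K: "compact K" and f: "continuous_on K f" "inj_on f K" and E: "E \<in> sets borel" "E \<subseteq> K"
  shows "f ` E \<in> sets borel"
proof -
  have "E \<in> sigma_sets UNIV (Collect closed)"
    using E(1) by (simp add: borel_eq_closed)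
  then have "f ` (E \<inter> K) \<in> sets borel"
  proof (induction rule: sigma_sets.induct)
    case (Basic C)
    then have "compact (C \<inter> K)" using K by (simp add: closed_Int_compact)
    then show ?case
      using f(1) by (meson borel_compact compact_continuous_image continuous_on_subset inf_le2)
  next
    case (Compl C)
    have "f ` ((UNIV - C) \<inter> K) = f ` K - f ` (C \<inter> K)"
      using f(2) by (auto simp: inj_on_def)
    then show ?case
      using Compl K f(1) by (simp add: borel_compact compact_continuous_image sets.Diff)
  next
    case (Union C)
    have "f ` (\<Union> (range C) \<inter> K) = (\<Union>i. f ` (C i \<inter> K))" by auto
    then show ?case using Union by auto
  qed simp
  then show ?thesis using E(2) by (simp add: Int_absorb2)
qed

text \<open>For a chord \<open>z\<close> nearly orthogonal to \<open>n\<close>, passing to the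
  tangential part \<open>proj n z\<close> changes lengths little. After projecting along
  \<open>v\<close> the error is \<open>(n \<bullet> z) *\<^sub>R proj v n\<close>, of length at most
  \<open>\<delta> * norm z\<close>; since \<open>proj v\<close> shrinks tangential vectors at most
  by \<open>n \<bullet> v\<close>, the relative error is at most \<open>\<theta>\<close>.\<close>

lemma
  fixes n v :: "'a::euclidean_space"
  assumes v: "norm v = 1" and n: "norm n = 1" and \<delta>: "0 \<le> \<delta>" "\<delta> < 1"
    and \<theta>: "\<theta> = \<delta> / ((1 - \<delta>) * (n \<bullet> v))" "\<theta> < 1" and c: "0 < n \<bullet> v"
    and flat: "\<bar>n \<bullet> z\<bar> \<le> \<delta> * norm z"
  shows flat_norm_le_proj_normal: "norm z \<le> 1 / (1 - \<delta>) * norm (proj n z)"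
    and flat_proj_le_proj_proj: "norm (proj v z) \<le> (1 + \<theta>) * norm (proj v (proj n z))"
    and flat_proj_proj_le_proj: "norm (proj v (proj n z)) \<le> 1 / (1 - \<theta>) * norm (proj v z)"
proof -
  have "norm z \<le> norm (proj n z) + \<bar>n \<bullet> z\<bar>"
    using norm_triangle_ineq[of "proj n z" "(n \<bullet> z) *\<^sub>R n"] n by (simp add: proj_eq)
  with flat have 1: "(1 - \<delta>) * norm z \<le> norm (proj n z)" by (simp add: algebra_simps)
  then show "norm z \<le> 1 / (1 - \<delta>) * norm (proj n z)" using \<delta> by (simp add: field_simps)
  have "(n \<bullet> v) * norm (proj n z) \<le> norm (proj v (proj n z))"
    using norm_proj_ge_of_orthogonal[OF v n inner_proj[OF n]] c by simp
  with 1 c have "(n \<bullet> v) * ((1 - \<delta>) * norm z) \<le> norm (proj v (proj n z))"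
    by (meson less_imp_le mult_left_mono order_trans)
  then have "norm z \<le> norm (proj v (proj n z)) / ((1 - \<delta>) * (n \<bullet> v))"
    using c \<delta> by (simp add: field_simps)
  then have 2: "\<delta> * norm z \<le> \<theta> * norm (proj v (proj n z))"
    using mult_left_mono[OF _ \<delta>(1)] unfolding \<theta>(1) by fastforce
  have "proj v z = proj v (proj n z) + (n \<bullet> z) *\<^sub>R proj v n"
    by (metis proj_add proj_eq proj_scaleR)
  moreover have "norm ((n \<bullet> z) *\<^sub>R proj v n) \<le> \<bar>n \<bullet> z\<bar> * 1"
    using norm_proj_le[OF v, of n] n unfolding norm_scaleR by (intro mult_left_mono) auto
  ultimately have 3: "norm (proj v z - proj v (proj n z)) \<le> \<theta> * norm (proj v (proj n z))"
    using flat 2 by simp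
  show "norm (proj v z) \<le> (1 + \<theta>) * norm (proj v (proj n z))"
    using 3 norm_triangle_ineq2[of "proj v z" "proj v (proj n z)"] by (simp add: algebra_simps)
  have "(1 - \<theta>) * norm (proj v (proj n z)) \<le> norm (proj v z)"
    using 3 norm_triangle_ineq2[of "proj v (proj n z)" "proj v z"] by (simp add: algebra_simps norm_minus_commute)
  then show "norm (proj v (proj n z)) \<le> 1 / (1 - \<theta>) * norm (proj v z)"
    using \<theta>(2) by (simp add: field_simps)
qed

text \<open>A flat piece is compared with its projection to the tangent hyperplane, where
  \<open>proj v\<close> scales area exactly by \<open>n \<bullet> v\<close>. The two passages cost
  only powers of Lipschitz constants close to 1.\<close>

lemma
  fixes n v :: "'a::euclidean_space"
  assumes v: "norm v = 1" and n: "norm n = 1" and \<delta>: "0 \<le> \<delta>" "\<delta> < 1"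
    and \<theta>: "\<theta> = \<delta> / ((1 - \<delta>) * (n \<bullet> v))" "\<theta> < 1" and c: "0 < n \<bullet> v"
    and flat: "\<And>x y. x \<in> K \<Longrightarrow> y \<in> K \<Longrightarrow> \<bar>n \<bullet> (x - y)\<bar> \<le> \<delta> * norm (x - y)"
    and K: "compact K" and E: "E \<in> sets borel" "E \<subseteq> K"
  shows hausdorff_outer_proj_flat_le:
      "hausdorff_outer (DIM('a) - 1) (proj v ` E)
        \<le> ennreal ((1 + \<theta>) ^ (DIM('a) - 1) * (n \<bullet> v)) * hausdorff_outer (DIM('a) - 1) E"
    and hausdorff_outer_flat_le_proj:
      "ennreal (n \<bullet> v) * hausdorff_outer (DIM('a) - 1) E
        \<le> ennreal ((1 / (1 - \<delta>)) ^ (DIM('a) - 1) * (1 / (1 - \<theta>)) ^ (DIM('a) - 1)) * hausdorff_outer (DIM('a) - 1) (proj v ` E)"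
    and hausdorff_outer_flat_finite: "hausdorff_outer (DIM('a) - 1) E < \<infinity>"
proof -
  let ?H = "hausdorff_outer (DIM('a) - 1) :: 'a set \<Rightarrow> ennreal"
  have \<theta>0: "0 \<le> \<theta>" using \<theta>(1) \<delta> c by simp
  note bounds = flat_norm_le_proj_normal flat_proj_le_proj_proj flat_proj_proj_le_proj
  note bounds = bounds[OF v n \<delta> \<theta> c flat]
  have "x = y" if "x \<in> K" "y \<in> K" "proj n x = proj n y" for x y
    using bounds(1)[OF that(1,2)] that(3) by (simp add: proj_diff)
  then have injn: "inj_on (proj n) K" by (auto simp: inj_on_def)
  have Bn: "proj n ` E \<in> sets borel"
    using K injn E by (intro borel_image_inj_on_compact[where K = K]) (auto intro: continuous_intros)
  have EK: "x \<in> E \<Longrightarrow> x \<in> K" for x using E by auto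
  have 1: "?H (proj n ` E) \<le> ?H E"
    using hausdorff_outer_image_le[of 1 E "proj n" "\<lambda>x. x" "DIM('a) - 1"] norm_proj_le[OF n]
    by (simp add: dist_norm proj_diff[symmetric])
  have 2: "?H E \<le> ennreal ((1 / (1 - \<delta>)) ^ (DIM('a) - 1)) * ?H (proj n ` E)"
    using hausdorff_outer_image_le[of "1 / (1 - \<delta>)" E "\<lambda>x. x" "proj n" "DIM('a) - 1"] bounds(1)[OF EK EK] \<delta>
    by (simp add: dist_norm proj_diff[symmetric])
  have 3: "?H (proj v ` E) \<le> ennreal ((1 + \<theta>) ^ (DIM('a) - 1)) * ?H ((\<lambda>x. proj v (proj n x)) ` E)"
    using bounds(2)[OF EK EK] \<theta>0
    by (intro hausdorff_outer_image_le) (auto simp add: dist_norm proj_diff[symmetric])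
  have 4: "?H ((\<lambda>x. proj v (proj n x)) ` E) \<le> ennreal ((1 / (1 - \<theta>)) ^ (DIM('a) - 1)) * ?H (proj v ` E)"
    using bounds(3)[OF EK EK] \<theta>(2)
    by (intro hausdorff_outer_image_le) (auto simp add: dist_norm proj_diff[symmetric])
  have 5: "?H ((\<lambda>x. proj v (proj n x)) ` E) = ennreal (n \<bullet> v) * ?H (proj n ` E)"
    
  proof -
    have "proj n ` E \<subseteq> {h. n \<bullet> h = 0}" using inner_proj[OF n] by blast
    from hausdorff_outer_proj_hyperplane[OF v n c Bn this] show ?thesis by (simp only: image_image)
  qed
  have "?H (proj v ` E) \<le> ennreal ((1 + \<theta>) ^ (DIM('a) - 1)) * (ennreal (n \<bullet> v) * ?H E)"
    using 3 1 unfolding 5 by (meson mult_left_mono order_trans zero_le)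
  then show "?H (proj v ` E) \<le> ennreal ((1 + \<theta>) ^ (DIM('a) - 1) * (n \<bullet> v)) * ?H E"
    using c \<theta>0 by (simp add: ennreal_mult mult.assoc)
  have "ennreal (n \<bullet> v) * ?H E \<le> ennreal (n \<bullet> v) * (ennreal ((1 / (1 - \<delta>)) ^ (DIM('a) - 1)) * ?H (proj n ` E))"
    using 2 by (intro mult_left_mono) auto
  also have "\<dots> = ennreal ((1 / (1 - \<delta>)) ^ (DIM('a) - 1)) * ?H ((\<lambda>x. proj v (proj n x)) ` E)"
    unfolding 5 by (simp add: mult.left_commute)
  also have "\<dots> \<le> ennreal ((1 / (1 - \<delta>)) ^ (DIM('a) - 1)) * (ennreal ((1 / (1 - \<theta>)) ^ (DIM('a) - 1)) * ?H (proj v ` E))"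
    using 4 by (intro mult_left_mono) auto
  finally show "ennreal (n \<bullet> v) * ?H E
        \<le> ennreal ((1 / (1 - \<delta>)) ^ (DIM('a) - 1) * (1 / (1 - \<theta>)) ^ (DIM('a) - 1)) * ?H (proj v ` E)"
    using \<delta> \<theta>(2) by (simp add: ennreal_mult mult.assoc)
  have "compact (proj n ` K)"
    using K by (intro compact_continuous_image continuous_intros)
  then have "bounded (proj n ` E)"
    using E(2) by (intro bounded_subset[OF compact_imp_bounded image_mono])
  then have "?H (proj n ` E) < \<infinity>"
    using n by (intro hausdorff_outer_hyperplane_bounded_finite[OF n]) (auto simp: inner_proj)
  with 2 show "?H E < \<infinity>"
    by (intro order_le_less_trans[OF 2]) (simp add: ennreal_mult_less_top)
qed

section \<open>Local area formula\<close>

lemma ennreal_le_of_le_factor: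
  fixes a b :: ennreal
  assumes "\<And>\<eta>. 0 < \<eta> \<Longrightarrow> a \<le> ennreal (1 + \<eta>) * b"
  shows "a \<le> b"
proof (cases "b = top")
  case False
  then obtain b' where b: "b = ennreal b'" "0 \<le> b'" by (cases b) auto
  show ?thesis
  proof (rule ennreal_le_epsilon)
    fix e :: real assume e: "0 < e"
    \<comment> \<open>The summand 1 in the denominator covers \<open>b' = 0\<close> and still keeps
      the excess below \<open>e\<close>.\<close>
    have "a \<le> ennreal (1 + e / (b' + 1)) * b" using e b by (intro assms) auto
    also have "\<dots> = ennreal ((1 + e / (b' + 1)) * b')" using e b by (simp add: ennreal_mult)
    also have "\<dots> \<le> ennreal (b' + e)"
    proof (rule ennreal_leI)
      have "e * b' \<le> e * (b' + 1)" using e by simp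
      then have "e * b' / (b' + 1) \<le> e" using b by (simp add: field_simps)
      then show "(1 + e / (b' + 1)) * b' \<le> b' + e" by (simp add: algebra_simps)
    qed
    also have "\<dots> = b + ennreal e" using b e by simp
    finally show "a \<le> b + ennreal e" .
  qed
qed simp

text \<open>At \<open>\<delta> = 0\<close> the bounds required hold strictly and the expressions are
  continuous there, so they persist for small positive \<open>\<delta>\<close>. The factors are
  those lost in \<open>local_comparison\<close>.\<close>

lemma exists_small_distortion:
  fixes c \<eta> :: real
  assumes c: "0 < c" and \<eta>: "0 < \<eta>"
  shows "\<exists>\<delta>>0. \<delta> < 1 \<and> \<delta> / ((1 - \<delta>) * c) < 1 \<and>
    (1 + \<delta> / ((1 - \<delta>) * c)) ^ k \<le> (1 + \<eta>) * (1 - \<delta>) \<and>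
    (1 + \<delta>) * ((1 / (1 - \<delta>)) ^ k * (1 / (1 - \<delta> / ((1 - \<delta>) * c))) ^ k) \<le> 1 + \<eta>"
proof -
  have 0: "((\<lambda>\<delta>. \<delta>) \<longlongrightarrow> (0::real)) (at_right 0)" by (rule tendsto_ident_at)
  have 1: "((\<lambda>\<delta>. \<delta> / ((1 - \<delta>) * c)) \<longlongrightarrow> 0 / ((1 - 0) * c)) (at_right 0)"
    using c by (intro tendsto_intros 0) auto
  have 2: "((\<lambda>\<delta>. (1 + \<delta> / ((1 - \<delta>) * c)) ^ k - (1 + \<eta>) * (1 - \<delta>))
      \<longlongrightarrow> (1 + 0 / ((1 - 0) * c)) ^ k - (1 + \<eta>) * (1 - 0)) (at_right 0)"
    by (intro tendsto_intros 0 1)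
  have 3: "((\<lambda>\<delta>. (1 + \<delta>) * ((1 / (1 - \<delta>)) ^ k * (1 / (1 - \<delta> / ((1 - \<delta>) * c))) ^ k))
      \<longlongrightarrow> (1 + 0) * ((1 / (1 - 0)) ^ k * (1 / (1 - 0 / ((1 - 0) * c))) ^ k)) (at_right 0)"
    by (intro tendsto_intros 0 1) auto
  have "\<forall>\<^sub>F \<delta> in at_right 0. 0 < \<delta> \<and> \<delta> < 1 \<and> \<delta> / ((1 - \<delta>) * c) < 1 \<and>
    (1 + \<delta> / ((1 - \<delta>) * c)) ^ k - (1 + \<eta>) * (1 - \<delta>) < 0 \<and>
    (1 + \<delta>) * ((1 / (1 - \<delta>)) ^ k * (1 / (1 - \<delta> / ((1 - \<delta>) * c))) ^ k) < 1 + \<eta>"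
    using \<eta> order_tendstoD(2)[OF 0, of 1] order_tendstoD(2)[OF 1, of 1] order_tendstoD(2)[OF 2, of 0]
      order_tendstoD(2)[OF 3, of "1 + \<eta>"] eventually_at_right_less[of "0::real"]
    by (intro eventually_conj) auto
  from eventually_happens[OF this] show ?thesis
    by (auto simp: less_imp_le)
qed

section \<open>Boundary pieces cut out by a defining function increasing along a fixed
  direction\<close>

text \<open>\<open>\<Phi>\<close> is positive inside the domain and \<open>G\<close> is its
  gradient, so the outward normal is \<open>- G\<close> normalised. The direction \<open>v\<close>
  is a separate parameter because the same \<open>\<Phi>\<close> is used later with a whole cone of
  directions.\<close>

locale transversal_patch =
  fixes \<Omega> :: "'a::euclidean_space set" and p :: 'a and r :: real and \<Phi> :: "'a \<Rightarrow> real"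
    and G :: "'a \<Rightarrow> 'a" and v :: 'a
  assumes open_dom: "open \<Omega>"
    and deriv: "\<And>x. x \<in> ball p r \<Longrightarrow> (\<Phi> has_derivative (\<lambda>h. G x \<bullet> h)) (at x)"
    and cont_grad: "continuous_on (ball p r) G"
    and dir: "norm v = 1"
    and transversal: "\<And>x. x \<in> ball p r \<Longrightarrow> 0 < G x \<bullet> v"
    and dom_eq: "\<Omega> \<inter> ball p r = {x \<in> ball p r. 0 < \<Phi> x}"
begin

lemma continuous_on_defining: "continuous_on (ball p r) \<Phi>"
  using deriv by (meson continuous_at_imp_continuous_on has_derivative_continuous)

lemma dom_iff: "x \<in> ball p r \<Longrightarrow> x \<in> \<Omega> \<longleftrightarrow> 0 < \<Phi> x"
  using dom_eq by blast

lemma defining_MVT: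
  assumes "x \<in> ball p r" "y \<in> ball p r"
  shows "\<exists>z\<in>closed_segment x y. \<Phi> y - \<Phi> x = G z \<bullet> (y - x)"
proof -
  have seg: "x + t *\<^sub>R (y - x) \<in> closed_segment x y" if "0 \<le> t" "t \<le> 1" for t
    using that by (auto simp: in_segment algebra_simps intro!: exI[of _ t])
  have sub: "closed_segment x y \<subseteq> ball p r"
    using assms by (intro closed_segment_subset) auto
  have "((\<lambda>t. \<Phi> (x + t *\<^sub>R (y - x))) has_real_derivative G (x + t *\<^sub>R (y - x)) \<bullet> (y - x)) (at t)"
    if "0 \<le> t" "t \<le> 1" for t
  proof -
    have "((\<lambda>t. x + t *\<^sub>R (y - x)) has_derivative (\<lambda>s. s *\<^sub>R (y - x))) (at t)"
      by (auto intro!: derivative_eq_intros)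
    from has_derivative_compose[OF this deriv] seg[OF that] sub
    have "((\<lambda>t. \<Phi> (x + t *\<^sub>R (y - x))) has_derivative (\<lambda>s. G (x + t *\<^sub>R (y - x)) \<bullet> (s *\<^sub>R (y - x)))) (at t)"
      by blast
    then show ?thesis
      by (simp add: has_field_derivative_def mult_commute_abs mult.commute)
  qed
  from MVT2[OF zero_less_one this]
  obtain z where z: "0 < z" "z < 1" "\<Phi> (x + 1 *\<^sub>R (y - x)) - \<Phi> (x + 0 *\<^sub>R (y - x))
      = (1 - 0) * (G (x + z *\<^sub>R (y - x)) \<bullet> (y - x))" by blast
  then show ?thesis using seg[of z] by (intro bexI[of _ "x + z *\<^sub>R (y - x)"]) auto
qed

lemma defining_increasing:
  assumes "x \<in> ball p r" "x + t *\<^sub>R v \<in> ball p r" "0 < t"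
  shows "\<Phi> x < \<Phi> (x + t *\<^sub>R v)"
proof -
  obtain z where z: "z \<in> closed_segment x (x + t *\<^sub>R v)" "\<Phi> (x + t *\<^sub>R v) - \<Phi> x = G z \<bullet> (t *\<^sub>R v)"
    using defining_MVT[OF assms(1,2)] by auto
  have "z \<in> ball p r"
    using z(1) closed_segment_subset[OF assms(1,2)] by auto
  then have "0 < t * (G z \<bullet> v)" using transversal[of z] assms(3) by simp
  then show ?thesis using z(2) by simp
qed

text \<open>Strict growth along \<open>v\<close> puts points of the domain arbitrarily close above
  any zero of \<open>\<Phi>\<close>, while a negative value persists on a neighbourhood that misses
  the domain.\<close>

lemma frontier_iff:
  assumes x: "x \<in> ball p r"
  shows "x \<in> frontier \<Omega> \<longleftrightarrow> \<Phi> x = 0"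
proof
  have fr: "x \<in> frontier \<Omega> \<longleftrightarrow> x \<in> closure \<Omega> \<and> x \<notin> \<Omega>"
    using open_dom by (simp add: frontier_def interior_open)
  assume "x \<in> frontier \<Omega>"
  then have cl: "x \<in> closure \<Omega>" and "\<Phi> x \<le> 0" using fr dom_iff[OF x] by auto
  moreover have False if neg: "\<Phi> x < 0"
  proof -
    have "open {y \<in> ball p r. \<Phi> y < 0}"
      using continuous_on_open_vimage[THEN iffD1, OF open_ball continuous_on_defining, rule_format, of "{..<0}"]
      by (simp add: vimage_def Int_def conj_commute)
    moreover have "{y \<in> ball p r. \<Phi> y < 0} \<inter> \<Omega> = {}" using dom_iff by force
    ultimately have "{y \<in> ball p r. \<Phi> y < 0} \<inter> closure \<Omega> = {}"
      by (simp add: open_Int_closure_eq_empty)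
    with neg x cl show False by auto
  qed
  ultimately show "\<Phi> x = 0" by force
next
  assume 0: "\<Phi> x = 0"
  then have "x \<notin> \<Omega>" using dom_iff[OF x] by simp
  moreover have "x \<in> closure \<Omega>"
    unfolding closure_approachable
  proof (intro allI impI)
    fix e :: real assume "0 < e"
    obtain s where s: "0 < s" "ball x s \<subseteq> ball p r" using x by (metis open_ball open_contains_ball)
    define t where "t = min e s / 2"
    have t: "0 < t" "t < e" "t < s" using \<open>0 < e\<close> s by (auto simp: t_def)
    then have "x + t *\<^sub>R v \<in> ball x s" using dir by (simp add: dist_norm)
    then have B: "x + t *\<^sub>R v \<in> ball p r" using s by blast
    from defining_increasing[OF x this t(1)] 0 have "x + t *\<^sub>R v \<in> \<Omega>" using dom_iff[OF B] by simp
    then show "\<exists>y\<in>\<Omega>. dist y x < e" using t dir by (intro bexI[of _ "x + t *\<^sub>R v"]) (auto simp: dist_norm)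
  qed
  ultimately show "x \<in> frontier \<Omega>" using open_dom by (simp add: frontier_def interior_open)
qed

definition sheet :: "'a set" where "sheet = frontier \<Omega> \<inter> ball p r"

text \<open>The cosine of the angle between the inner normal and \<open>v\<close>, which is the
  factor by which \<open>proj v\<close> scales area at \<open>x\<close>.\<close>

definition slope :: "'a \<Rightarrow> real" where "slope x = (G x \<bullet> v) / norm (G x)"

lemma sheet_borel [measurable]: "sheet \<in> sets borel"
  by (simp add: sheet_def)

lemma sheetD: "x \<in> sheet \<Longrightarrow> x \<in> ball p r" "x \<in> sheet \<Longrightarrow> \<Phi> x = 0"
  using frontier_iff by (auto simp: sheet_def)

lemma inj_on_proj_sheet: "inj_on (proj v) sheet"
proof (rule inj_onI)
  fix x y assume xy: "x \<in> sheet" "y \<in> sheet" "proj v x = proj v y"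
  define t where "t = v \<bullet> y - v \<bullet> x"
  have "proj v x + (v \<bullet> x) *\<^sub>R v + t *\<^sub>R v = proj v x + (v \<bullet> y) *\<^sub>R v"
    by (simp add: t_def scaleR_left_diff_distrib)
  then have y: "y = x + t *\<^sub>R v"
    using xy(3) proj_eq[of v x] proj_eq[of v y] by simp
  then have x: "x = y + (- t) *\<^sub>R v" by simp
  have "\<not> 0 < t" using defining_increasing[of x t] xy sheetD y by force
  moreover have "\<not> 0 < - t" using defining_increasing[of y "- t"] xy sheetD x by force
  ultimately show "x = y" using y by simp
qed

lemma grad_nonzero: "x \<in> ball p r \<Longrightarrow> G x \<noteq> 0"
  using transversal by force

lemma slope_pos: "x \<in> ball p r \<Longrightarrow> 0 < slope x"
  using transversal grad_nonzero by (simp add: slope_def)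

lemma continuous_on_slope: "continuous_on (ball p r) slope"
  unfolding slope_def using cont_grad grad_nonzero by (intro continuous_intros) auto

definition weight :: "'a \<Rightarrow> real" where "weight x = indicator sheet x * slope x"

lemma weight_nonneg: "0 \<le> weight x"
  using slope_pos sheetD by (auto simp: weight_def indicator_def less_imp_le)

lemma borel_measurable_weight [measurable]: "weight \<in> borel_measurable borel"
proof -
  have "(\<lambda>x. indicator (ball p r) x *\<^sub>R slope x) \<in> borel_measurable borel"
    by (intro borel_measurable_continuous_on_indicator continuous_on_slope) simp
  then have "(\<lambda>x. indicator sheet x * (indicator (ball p r) x *\<^sub>R slope x)) \<in> borel_measurable borel"
    by measurable
  also have "(\<lambda>x. indicator sheet x * (indicator (ball p r) x *\<^sub>R slope x)) = weight"
    by (auto simp: weight_def indicator_def sheet_def)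
  finally show ?thesis .
qed

text \<open>Area weighted by the cosine. The aim of what follows is that \<open>proj v\<close>
  pushes it forward to Hausdorff measure on the shadow of the sheet, which is the area formula for
  this projection.\<close>

definition sheet_measure :: "'a measure" where
  "sheet_measure = density (hausdorff_measure (DIM('a) - 1)) (\<lambda>x. ennreal (weight x))"

lemma sets_sheet_measure [simp, measurable_cong]: "sets sheet_measure = sets borel"
  by (simp add: sheet_measure_def)

lemma emeasure_sheet_measure:
  "E \<in> sets borel \<Longrightarrow> emeasure sheet_measure E
    = (\<integral>\<^sup>+ x. ennreal (weight x) * indicator E x \<partial>hausdorff_measure (DIM('a) - 1))"
  unfolding sheet_measure_def by (rule emeasure_density) auto

lemma gradient_control:
  assumes q: "q \<in> ball p r" and e: "0 < e"
  shows "\<exists>\<rho>>0. cball q \<rho> \<subseteq> ball p r \<and>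
    (\<forall>x\<in>cball q \<rho>. norm (G x - G q) \<le> e \<and> \<bar>slope x - slope q\<bar> \<le> e)"
proof -
  have "isCont G q" "isCont slope q"
    using q cont_grad continuous_on_slope by (auto simp: continuous_on_eq_continuous_at)
  then obtain d1 d2 where d: "0 < d1" "\<And>x. dist x q < d1 \<Longrightarrow> dist (G x) (G q) < e"
      "0 < d2" "\<And>x. dist x q < d2 \<Longrightarrow> dist (slope x) (slope q) < e"
    using e unfolding continuous_at_eps_delta by metis
  obtain s where s: "0 < s" "cball q s \<subseteq> ball p r"
    using q by (metis open_ball open_contains_cball)
  define \<rho> where "\<rho> = min s (min d1 d2 / 2)"
  have \<rho>: "0 < \<rho>" "\<rho> \<le> s" "\<rho> < d1" "\<rho> < d2" using d s by (auto simp: \<rho>_def)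
  show ?thesis
  proof (intro exI[of _ \<rho>] conjI ballI \<rho>(1))
    show "cball q \<rho> \<subseteq> ball p r" using s \<rho> by (meson cball_subset_cball_iff order_trans subset_cball)
    fix x assume "x \<in> cball q \<rho>"
    then have "dist x q < d1" "dist x q < d2" using \<rho> by (auto simp: dist_commute)
    then show "norm (G x - G q) \<le> e" "\<bar>slope x - slope q\<bar> \<le> e"
      using d(2)[of x] d(4)[of x] by (auto simp: dist_norm)
  qed
qed

text \<open>Near \<open>q\<close> the gradient hardly turns, so the sheet is flat with respect to
  the normal at \<open>q\<close> and the cosine is almost constant. This brings the area formula
  within a factor \<open>1 + \<eta>\<close> on all small Borel pieces.\<close>

lemma local_comparison:
  assumes q: "q \<in> sheet" and \<eta>: "0 < \<eta>"
  shows "\<exists>\<rho>>0. cball q \<rho> \<subseteq> ball p r \<and> (\<forall>E\<in>sets borel. E \<subseteq> frontier \<Omega> \<inter> cball q \<rho> \<longrightarrow>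
    hausdorff_outer (DIM('a) - 1) (proj v ` E) \<le> ennreal (1 + \<eta>) * emeasure sheet_measure E \<and>
    emeasure sheet_measure E \<le> ennreal (1 + \<eta>) * hausdorff_outer (DIM('a) - 1) (proj v ` E) \<and>
    hausdorff_outer (DIM('a) - 1) E < \<infinity>)"
proof -
  let ?k = "DIM('a) - 1"
  let ?H = "hausdorff_outer ?k :: 'a set \<Rightarrow> ennreal"
  have qB: "q \<in> ball p r" using q sheetD by blast
  define n where "n = G q /\<^sub>R norm (G q)"
  define c where "c = slope q"
  have Gq: "0 < norm (G q)" using grad_nonzero[OF qB] by simp
  have n: "norm n = 1" using Gq by (simp add: n_def)
  have nv: "n \<bullet> v = c" by (simp add: n_def c_def slope_def divide_inverse_commute)
  have c: "0 < c" using slope_pos[OF qB] by (simp add: c_def)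
  obtain \<delta> where \<delta>: "0 < \<delta>" "\<delta> < 1" and \<theta>1: "\<delta> / ((1 - \<delta>) * c) < 1"
    and f1: "(1 + \<delta> / ((1 - \<delta>) * c)) ^ ?k \<le> (1 + \<eta>) * (1 - \<delta>)"
    and f2: "(1 + \<delta>) * ((1 / (1 - \<delta>)) ^ ?k * (1 / (1 - \<delta> / ((1 - \<delta>) * c))) ^ ?k) \<le> 1 + \<eta>"
    using exists_small_distortion[OF c \<eta>, of ?k] by blast
  define \<theta> where "\<theta> = \<delta> / ((1 - \<delta>) * c)"
  \<comment> \<open>The first bound on the gradient yields flatness \<open>\<delta>\<close>, the
    second keeps the slope between \<open>c * (1 - \<delta>)\<close> and
    \<open>c * (1 + \<delta>)\<close>.\<close>
  define e where "e = min (\<delta> * norm (G q)) (\<delta> * c)"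
  have e: "0 < e" using \<delta> Gq c by (simp add: e_def)
  obtain \<rho> where \<rho>: "0 < \<rho>" "cball q \<rho> \<subseteq> ball p r"
    "\<And>x. x \<in> cball q \<rho> \<Longrightarrow> norm (G x - G q) \<le> e" "\<And>x. x \<in> cball q \<rho> \<Longrightarrow> \<bar>slope x - slope q\<bar> \<le> e"
    using gradient_control[OF qB e] by metis
  define K where "K = frontier \<Omega> \<inter> cball q \<rho>"
  have K: "compact K" by (simp add: K_def closed_Int_compact frontier_closed)
  have KS: "K \<subseteq> sheet" using \<rho>(2) by (auto simp: K_def sheet_def)
  have flat: "\<bar>n \<bullet> (x - y)\<bar> \<le> \<delta> * norm (x - y)" if "x \<in> K" "y \<in> K" for x y
  proof -
    have xy: "x \<in> ball p r" "y \<in> ball p r" "\<Phi> x = 0" "\<Phi> y = 0"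
      using that KS sheetD by blast+
    obtain z where z: "z \<in> closed_segment x y" "\<Phi> y - \<Phi> x = G z \<bullet> (y - x)"
      using defining_MVT[OF xy(1,2)] by blast
    have "closed_segment x y \<subseteq> cball q \<rho>"
      using that by (intro closed_segment_subset) (auto simp: K_def)
    then have Gz: "norm (G z - G q) \<le> \<delta> * norm (G q)" using z(1) \<rho>(3)[of z] by (auto simp: e_def)
    \<comment> \<open>\<open>\<Phi>\<close> vanishes at both ends, so the mean value gradient is
      orthogonal to the chord and only its deviation from \<open>G q\<close> remains.\<close>
    have "G q \<bullet> (x - y) = (G z - G q) \<bullet> (y - x)"
      using z(2) xy by (simp add: inner_diff_left inner_diff_right)
    then have "\<bar>G q \<bullet> (x - y)\<bar> \<le> norm (G z - G q) * norm (y - x)"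
      using Cauchy_Schwarz_ineq2 by simp
    also have "\<dots> \<le> \<delta> * norm (G q) * norm (x - y)"
      using Gz by (simp add: norm_minus_commute mult_right_mono)
    finally show ?thesis using Gq
      by (simp add: n_def abs_mult field_simps)
  qed
  show ?thesis
  proof (intro exI[of _ \<rho>] conjI ballI impI \<rho>(1,2))
    fix E assume E: "E \<in> sets borel" "E \<subseteq> frontier \<Omega> \<inter> cball q \<rho>"
    then have EK: "E \<subseteq> K" by (simp add: K_def)
    have w: "c * (1 - \<delta>) \<le> weight x" "weight x \<le> c * (1 + \<delta>)" if "x \<in> E" for x
    proof -
      have "x \<in> sheet" "x \<in> cball q \<rho>" using that EK KS E by auto
      then show "c * (1 - \<delta>) \<le> weight x" "weight x \<le> c * (1 + \<delta>)"
        using \<rho>(4)[of x] by (auto simp: weight_def c_def e_def algebra_simps abs_le_iff)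
    qed
    have const: "(\<integral>\<^sup>+ x. ennreal b * indicator E x \<partial>hausdorff_measure ?k) = ennreal b * ?H E" for b
      using E by (subst nn_integral_cmult_indicator) (auto simp: emeasure_hausdorff_measure)
    have lower: "ennreal (c * (1 - \<delta>)) * ?H E \<le> emeasure sheet_measure E"
      unfolding emeasure_sheet_measure[OF E(1)] const[symmetric]
      by (intro nn_integral_mono) (auto simp: indicator_def w ennreal_leI)
    have upper: "emeasure sheet_measure E \<le> ennreal (c * (1 + \<delta>)) * ?H E"
      unfolding emeasure_sheet_measure[OF E(1)] const[symmetric]
      by (intro nn_integral_mono) (auto simp: indicator_def w ennreal_leI)
    have \<delta>': "0 \<le> \<delta>" using \<delta> by simp
    have \<theta>: "\<theta> = \<delta> / ((1 - \<delta>) * (n \<bullet> v))" "\<theta> < 1" "0 < n \<bullet> v" using \<theta>1 c by (auto simp: \<theta>_def nv)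
    note fl = hausdorff_outer_proj_flat_le hausdorff_outer_flat_le_proj hausdorff_outer_flat_finite
    note fl = fl[OF dir n \<delta>' \<delta>(2) \<theta> flat K E(1) EK]
    have \<theta>0: "0 \<le> \<theta>" using \<delta> c by (simp add: \<theta>_def)
    have "?H (proj v ` E) \<le> ennreal ((1 + \<theta>) ^ ?k * c) * ?H E" using fl(1) by (simp add: nv)
    also have "\<dots> \<le> ennreal ((1 + \<eta>) * (1 - \<delta>) * c) * ?H E"
      using f1 c by (intro mult_right_mono ennreal_leI) (auto simp: \<theta>_def)
    also have "\<dots> = ennreal (1 + \<eta>) * (ennreal (c * (1 - \<delta>)) * ?H E)"
    proof -
      have "ennreal ((1 + \<eta>) * (1 - \<delta>) * c) = ennreal (1 + \<eta>) * ennreal (c * (1 - \<delta>))"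
        using \<eta> \<delta> c by (subst ennreal_mult[symmetric]) (auto simp: mult.commute mult.left_commute)
      then show ?thesis by (simp only: mult.assoc)
    qed
    also have "\<dots> \<le> ennreal (1 + \<eta>) * emeasure sheet_measure E"
      using lower by (intro mult_left_mono) auto
    finally show "?H (proj v ` E) \<le> ennreal (1 + \<eta>) * emeasure sheet_measure E" .
    have "emeasure sheet_measure E \<le> ennreal (1 + \<delta>) * (ennreal c * ?H E)"
    proof -
      have "ennreal (c * (1 + \<delta>)) = ennreal (1 + \<delta>) * ennreal c"
        using \<delta> c by (subst ennreal_mult[symmetric]) (auto simp: mult.commute)
      then show ?thesis using upper by (simp only: mult.assoc)
    qed
    also have "\<dots> \<le> ennreal (1 + \<delta>) * (ennreal ((1 / (1 - \<delta>)) ^ ?k * (1 / (1 - \<theta>)) ^ ?k) * ?H (proj v ` E))"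
    proof (rule mult_left_mono)
      show "ennreal c * ?H E \<le> ennreal ((1 / (1 - \<delta>)) ^ ?k * (1 / (1 - \<theta>)) ^ ?k) * ?H (proj v ` E)"
        using fl(2) unfolding nv by blast
    qed simp
    also have "\<dots> = ennreal ((1 + \<delta>) * ((1 / (1 - \<delta>)) ^ ?k * (1 / (1 - \<theta>)) ^ ?k)) * ?H (proj v ` E)"
      using \<delta> \<theta>(2) by (simp add: ennreal_mult mult.assoc)
    also have "\<dots> \<le> ennreal (1 + \<eta>) * ?H (proj v ` E)"
      using f2 by (intro mult_right_mono ennreal_leI) (auto simp: \<theta>_def)
    finally show "emeasure sheet_measure E \<le> ennreal (1 + \<eta>) * ?H (proj v ` E)" .
    show "?H E < \<infinity>" by (rule fl(3))
  qed
qed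

text \<open>The sheet lies in an open ball and may fail to be compact, so a Lindelof subcover
  supplies countably many pieces. They are compact in order that
  \<open>borel_image_inj_on_compact\<close> applies to them.\<close>

lemma sheet_decomposition:
  assumes \<eta>: "0 < \<eta>"
  shows "\<exists>N :: nat \<Rightarrow> 'a set. (\<forall>i. compact (N i)) \<and> (\<Union>i. N i) = sheet \<and> (\<forall>i. \<forall>E\<in>sets borel. E \<subseteq> N i \<longrightarrow>
    hausdorff_outer (DIM('a) - 1) (proj v ` E) \<le> ennreal (1 + \<eta>) * emeasure sheet_measure E \<and>
    emeasure sheet_measure E \<le> ennreal (1 + \<eta>) * hausdorff_outer (DIM('a) - 1) (proj v ` E))"
    (is "\<exists>N. _ \<and> _ \<and> (\<forall>i. \<forall>E\<in>sets borel. E \<subseteq> N i \<longrightarrow> ?P E)")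
proof (cases "sheet = {}")
  case True
  then show ?thesis
    by (intro exI[of _ "\<lambda>_. {}"]) (auto simp: hausdorff_outer_empty)
next
  case False
  obtain \<rho> where \<rho>: "\<And>q. q \<in> sheet \<Longrightarrow> 0 < \<rho> q" "\<And>q. q \<in> sheet \<Longrightarrow> cball q (\<rho> q) \<subseteq> ball p r"
    "\<And>q E. q \<in> sheet \<Longrightarrow> E \<in> sets borel \<Longrightarrow> E \<subseteq> frontier \<Omega> \<inter> cball q (\<rho> q) \<Longrightarrow> ?P E"
    using local_comparison[OF _ \<eta>] by metis
  obtain F where F: "F \<subseteq> (\<lambda>q. ball q (\<rho> q)) ` sheet" "countable F" "\<Union> F = (\<Union>q\<in>sheet. ball q (\<rho> q))"
    using Lindelof[of "(\<lambda>q. ball q (\<rho> q)) ` sheet"] by auto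
  obtain Q where Q: "Q \<subseteq> sheet" "countable Q" "F = (\<lambda>q. ball q (\<rho> q)) ` Q"
    using F(1,2) by (meson countable_subset_image)
  have cover: "sheet \<subseteq> (\<Union>q\<in>Q. ball q (\<rho> q))"
    using F(3) Q(3) \<rho>(1) by fastforce
  then have "Q \<noteq> {}" using False by auto
  define N where "N i = frontier \<Omega> \<inter> cball (from_nat_into Q i) (\<rho> (from_nat_into Q i))" for i
  have qi: "from_nat_into Q i \<in> sheet" for i
    using from_nat_into[OF \<open>Q \<noteq> {}\<close>] Q(1) by blast
  show ?thesis
  proof (intro exI[of _ N] conjI allI)
    show "compact (N i)" for i by (simp add: N_def closed_Int_compact frontier_closed)
    show "(\<Union>i. N i) = sheet"
    proof (intro equalityI subsetI)
      fix x assume "x \<in> (\<Union>i. N i)"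
      then show "x \<in> sheet" using \<rho>(2)[OF qi] unfolding N_def sheet_def by blast
    next
      fix x assume x: "x \<in> sheet"
      then obtain q where q: "q \<in> Q" "x \<in> ball q (\<rho> q)" using cover by blast
      obtain i where "from_nat_into Q i = q"
        using from_nat_into_surj[OF Q(2) q(1)] by blast
      with q x show "x \<in> (\<Union>i. N i)" by (auto simp: N_def sheet_def intro!: exI[of _ i])
    qed
    show "\<forall>E\<in>sets borel. E \<subseteq> N i \<longrightarrow> ?P E" for i
      using \<rho>(3)[OF qi] unfolding N_def by blast
  qed
qed

lemma proj_sheet_borel [measurable]: "proj v ` sheet \<in> sets borel"
proof -
  obtain N :: "nat \<Rightarrow> 'a set" where N: "\<And>i. compact (N i)" "(\<Union>i. N i) = sheet"
    using sheet_decomposition[OF zero_less_one] by blast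
  have "proj v ` sheet = (\<Union>i. proj v ` N i)" unfolding N(2)[symmetric] by (rule image_UN)
  moreover have "compact (proj v ` N i)" for i
    using N(1) by (intro compact_continuous_image continuous_intros)
  then have "proj v ` N i \<in> sets borel" for i by (intro borel_compact)
  ultimately show ?thesis by auto
qed

text \<open>The two-sided comparison with factor \<open>1 + \<eta>\<close> can be summed over a
  disjoint decomposition: the projected pieces stay disjoint because \<open>proj v\<close> is
  injective on the sheet. The decomposition depends on \<open>\<eta>\<close> but the sums do not, so
  \<open>\<eta>\<close> may tend to 0.\<close>

lemma proj_sheet_area:
  assumes A: "A \<in> sets borel"
  shows "hausdorff_outer (DIM('a) - 1) (A \<inter> proj v ` sheet) = emeasure sheet_measure (proj v -` A)"
proof -
  let ?H = "hausdorff_outer (DIM('a) - 1) :: 'a set \<Rightarrow> ennreal"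
  have pA: "proj v -` A \<in> sets borel"
    using measurable_sets[OF borel_measurable_proj A] by simp
  have "?H (A \<inter> proj v ` sheet) \<le> ennreal (1 + \<eta>) * emeasure sheet_measure (proj v -` A) \<and>
     emeasure sheet_measure (proj v -` A) \<le> ennreal (1 + \<eta>) * ?H (A \<inter> proj v ` sheet)" if \<eta>: "0 < \<eta>" for \<eta>
  proof -
    obtain N :: "nat \<Rightarrow> 'a set" where N0: "(\<forall>i. compact (N i)) \<and> (\<Union>i. N i) = sheet \<and>
        (\<forall>i. \<forall>E\<in>sets borel. E \<subseteq> N i \<longrightarrow>
          ?H (proj v ` E) \<le> ennreal (1 + \<eta>) * emeasure sheet_measure E \<and>
          emeasure sheet_measure E \<le> ennreal (1 + \<eta>) * ?H (proj v ` E))"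
      using sheet_decomposition[OF \<eta>] by (rule exE)
    then have N: "\<And>i. compact (N i)" "(\<Union>i. N i) = sheet" by simp_all
    have P: "?H (proj v ` E) \<le> ennreal (1 + \<eta>) * emeasure sheet_measure E"
        "emeasure sheet_measure E \<le> ennreal (1 + \<eta>) * ?H (proj v ` E)"
      if "E \<in> sets borel" "E \<subseteq> N i" for E i
      using N0 that by blast+
    define E where "E i = disjointed N i \<inter> proj v -` A" for i
    have EN: "E i \<subseteq> N i" for i using disjointed_subset[of N i] by (auto simp: E_def)
    have "range (disjointed N) \<subseteq> sets borel"
      using N(1) by (intro sets.range_disjointed_sets) (auto intro: borel_compact)
    then have Eb: "E i \<in> sets borel" for i using pA by (auto simp: E_def)
    have "(\<Union>i. E i) = (\<Union>i. disjointed N i) \<inter> proj v -` A" by (auto simp: E_def)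
    then have EU: "(\<Union>i. E i) = sheet \<inter> proj v -` A" by (simp add: UN_disjointed_eq N(2))
    have Ed: "disjoint_family E"
      using disjoint_family_disjointed[of N] by (auto simp: disjoint_family_on_def E_def)
    have ES: "E i \<subseteq> sheet" for i using EN N(2) by blast
    have pE: "proj v ` E i \<in> sets borel" for i
    proof (rule borel_image_inj_on_compact[OF N(1) _ _ Eb EN])
      show "continuous_on (N i) (proj v)" by (intro continuous_intros)
      have "N i \<subseteq> sheet" using N(2) by blast
      then show "inj_on (proj v) (N i)" by (rule inj_on_subset[OF inj_on_proj_sheet])
    qed
    have pEd: "disjoint_family (\<lambda>i. proj v ` E i)"
      unfolding disjoint_family_on_def
    proof (intro ballI impI)
      fix i j :: nat assume "i \<noteq> j"
      then have "E i \<inter> E j = {}" using Ed by (auto simp: disjoint_family_on_def)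
      then show "proj v ` E i \<inter> proj v ` E j = {}"
        using inj_on_image_Int[OF inj_on_proj_sheet ES ES, of i j] by simp
    qed
    have "A \<inter> proj v ` sheet = proj v ` (\<Union>i. E i)" unfolding EU by auto
    also have "\<dots> = (\<Union>i. proj v ` E i)" by (rule image_UN)
    finally have U: "A \<inter> proj v ` sheet = (\<Union>i. proj v ` E i)" .
    have "?H (A \<inter> proj v ` sheet) = emeasure (hausdorff_measure (DIM('a) - 1)) (\<Union>i. proj v ` E i)"
      using pE unfolding U by (subst emeasure_hausdorff_measure) auto
    also have "\<dots> = (\<Sum>i. emeasure (hausdorff_measure (DIM('a) - 1)) (proj v ` E i))"
      using pE pEd by (intro suminf_emeasure[symmetric]) auto
    finally have 1: "?H (A \<inter> proj v ` sheet) = (\<Sum>i. ?H (proj v ` E i))"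
      using pE by (simp add: emeasure_hausdorff_measure)
    have "emeasure sheet_measure (proj v -` A) = emeasure sheet_measure (sheet \<inter> proj v -` A)"
      using pA by (subst (1 2) emeasure_sheet_measure) (auto intro!: nn_integral_cong simp: weight_def indicator_def)
    also have "\<dots> = (\<Sum>i. emeasure sheet_measure (E i))"
      unfolding EU[symmetric] using Eb Ed by (intro suminf_emeasure[symmetric]) auto
    finally have 2: "emeasure sheet_measure (proj v -` A) = (\<Sum>i. emeasure sheet_measure (E i))" .
    show ?thesis
      unfolding 1 2 ennreal_suminf_cmult[symmetric]
      using P[OF Eb EN] by (intro conjI suminf_le) auto
  qed
  note bounds = this
  show ?thesis
    by (rule antisym; rule ennreal_le_of_le_factor) (use bounds in blast)+
qed

lemma distr_sheet_measure:
  "distr sheet_measure borel (proj v) = density (hyperplane_measure v) (indicator (proj v ` sheet))"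
proof (rule measure_eqI)
  fix A assume "A \<in> sets (distr sheet_measure borel (proj v))"
  then have A: "A \<in> sets borel" by simp
  have sub: "proj v ` sheet \<subseteq> {h. v \<bullet> h = 0}" using inner_proj[OF dir] by blast
  have AI: "proj v ` sheet \<inter> A \<in> sets borel" using A by auto
  have "emeasure (density (hyperplane_measure v) (indicator (proj v ` sheet))) A
      = (\<integral>\<^sup>+ h. indicator (proj v ` sheet) h * indicator A h \<partial>hyperplane_measure v)"
    using A by (intro emeasure_density) (simp_all add: borel_measurable_indicator)
  also have "\<dots> = emeasure (hyperplane_measure v) (proj v ` sheet \<inter> A)"
    unfolding indicator_inter_arith[symmetric] using AI by (intro nn_integral_indicator) simp
  also have "\<dots> = hausdorff_outer (DIM('a) - 1) (A \<inter> proj v ` sheet)"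
  proof -
    have "proj v ` sheet \<inter> A \<inter> {h. v \<bullet> h = 0} = A \<inter> proj v ` sheet" using sub by blast
    then show ?thesis using AI by (simp only: emeasure_hyperplane_measure)
  qed
  also have "\<dots> = emeasure (distr sheet_measure borel (proj v)) A"
  proof -
    have "space sheet_measure = UNIV" by (simp add: sheet_measure_def)
    then have "emeasure (distr sheet_measure borel (proj v)) A = emeasure sheet_measure (proj v -` A)"
      using A by (subst emeasure_distr) auto
    then show ?thesis using proj_sheet_area[OF A] by simp
  qed
  finally show "emeasure (distr sheet_measure borel (proj v)) A
    = emeasure (density (hyperplane_measure v) (indicator (proj v ` sheet))) A" ..
qed simp

lemma integral_hyperplane_sheet:
  fixes \<phi> :: "'a \<Rightarrow> real"
  assumes \<phi>[measurable]: "\<phi> \<in> borel_measurable borel"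
    and zero: "\<And>h. v \<bullet> h = 0 \<Longrightarrow> h \<notin> proj v ` sheet \<Longrightarrow> \<phi> h = 0"
  shows "(\<integral>h. \<phi> h \<partial>hyperplane_measure v) = (\<integral>x. weight x * \<phi> (proj v x) \<partial>hausdorff_measure (DIM('a) - 1))"
proof -
  have "(\<integral>h. \<phi> h \<partial>hyperplane_measure v) = (\<integral>h. indicator (proj v ` sheet) h *\<^sub>R \<phi> h \<partial>hyperplane_measure v)"
    using AE_hyperplane_measure[of v] zero
    by (intro integral_cong_AE) (auto elim!: eventually_mono simp: indicator_def)
  also have "\<dots> = (\<integral>h. \<phi> h \<partial>density (hyperplane_measure v) (\<lambda>h. ennreal (indicator (proj v ` sheet) h)))"
    by (subst integral_density) auto
  also have "(\<lambda>h. ennreal (indicator (proj v ` sheet) h)) = indicator (proj v ` sheet)"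
    by (auto simp: indicator_def)
  also have "(\<integral>h. \<phi> h \<partial>density (hyperplane_measure v) (indicator (proj v ` sheet)))
      = (\<integral>x. \<phi> (proj v x) \<partial>sheet_measure)"
    unfolding distr_sheet_measure[symmetric] by (subst integral_distr) auto
  also have "\<dots> = (\<integral>x. weight x * \<phi> (proj v x) \<partial>hausdorff_measure (DIM('a) - 1))"
    unfolding sheet_measure_def using weight_nonneg by (subst integral_density) auto
  finally show ?thesis .
qed

text \<open>\<open>\<Phi>\<close> changes sign along the line through \<open>q\<close> in direction
  \<open>v\<close>, hence along all nearby parallel lines, and each of them hits the boundary. The
  shadow of the boundary piece thus contains a small disc, and projecting does not increase
  Hausdorff measure. The equality case uses this to leave null sets behind.\<close>

lemma hausdorff_outer_sheet_pos:
  assumes q: "q \<in> sheet" and s: "0 < s"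
  shows "0 < hausdorff_outer (DIM('a) - 1) (frontier \<Omega> \<inter> ball q s)"
proof -
  let ?H = "hausdorff_outer (DIM('a) - 1) :: 'a set \<Rightarrow> ennreal"
  have qB: "q \<in> ball p r" "\<Phi> q = 0" using q sheetD by auto
  obtain s1 where s1: "0 < s1" "ball q s1 \<subseteq> ball p r" using qB(1) by (metis open_ball open_contains_ball)
  define s2 where "s2 = min s s1"
  have s2: "0 < s2" "ball q s2 \<subseteq> ball p r" "ball q s2 \<subseteq> ball q s"
    using s s1 by (auto simp: s2_def)
  define t where "t = s2 / 2"
  have t: "0 < t" "t < s2" using s2 by (auto simp: t_def)
  have B: "q + t *\<^sub>R v \<in> ball p r" "q - t *\<^sub>R v \<in> ball p r"
    using s2(2) t dir by (auto simp: subset_iff dist_norm)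
  have up: "0 < \<Phi> (q + t *\<^sub>R v)" using defining_increasing[OF qB(1) B(1) t(1)] qB by simp
  have down: "\<Phi> (q - t *\<^sub>R v) < 0" using defining_increasing[of "q - t *\<^sub>R v" t] B(2) qB t(1) by simp
  have "isCont \<Phi> (q + t *\<^sub>R v)" "isCont \<Phi> (q - t *\<^sub>R v)"
    using B deriv has_derivative_continuous by blast+
  then obtain d1 d2 where d: "0 < d1" "\<And>x. dist x (q + t *\<^sub>R v) < d1 \<Longrightarrow> dist (\<Phi> x) (\<Phi> (q + t *\<^sub>R v)) < \<Phi> (q + t *\<^sub>R v)"
      "0 < d2" "\<And>x. dist x (q - t *\<^sub>R v) < d2 \<Longrightarrow> dist (\<Phi> x) (\<Phi> (q - t *\<^sub>R v)) < - \<Phi> (q - t *\<^sub>R v)"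
    using up down unfolding continuous_at_eps_delta by (metis neg_0_less_iff_less)
  \<comment> \<open>Small enough to keep the signs of \<open>\<Phi>\<close> at both ends of every
    parallel segment, and to keep the segments inside the ball of radius \<open>s2\<close>.\<close>
  define \<epsilon> where "\<epsilon> = min (min d1 d2) (s2 - t) / 2"
  have \<epsilon>: "0 < \<epsilon>" "\<epsilon> < d1" "\<epsilon> < d2" "\<epsilon> + t < s2" using d t by (auto simp: \<epsilon>_def field_simps min_def)
  have "(\<lambda>h. h + proj v q) ` ({h. v \<bullet> h = 0} \<inter> cball 0 \<epsilon>) \<subseteq> proj v ` (frontier \<Omega> \<inter> ball q s)"
  proof
    fix y assume "y \<in> (\<lambda>h. h + proj v q) ` ({h. v \<bullet> h = 0} \<inter> cball 0 \<epsilon>)"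
    then obtain h where h: "v \<bullet> h = 0" "norm h \<le> \<epsilon>" "y = h + proj v q" by auto
    define L where "L \<tau> = q + h + \<tau> *\<^sub>R v" for \<tau>
    have L: "L \<tau> \<in> ball q s2" if "- t \<le> \<tau>" "\<tau> \<le> t" for \<tau>
    proof -
      have "norm (h + \<tau> *\<^sub>R v) \<le> norm h + \<bar>\<tau>\<bar>" using norm_triangle_ineq[of h "\<tau> *\<^sub>R v"] dir by simp
      also have "\<dots> < s2" using h that \<epsilon> by (auto simp: abs_le_iff)
      finally have "dist (L \<tau>) q < s2" by (simp add: L_def dist_norm add.assoc)
      then show ?thesis by (simp add: dist_commute)
    qed
    have "dist (L t) (q + t *\<^sub>R v) < d1" "dist (L (- t)) (q - t *\<^sub>R v) < d2"
      using h \<epsilon> by (auto simp: L_def dist_norm)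
    then have "0 < \<Phi> (L t)" "\<Phi> (L (- t)) < 0" using d(2)[of "L t"] d(4)[of "L (- t)"]
      by (auto simp: dist_real_def)
    moreover have "continuous_on {- t..t} (\<lambda>\<tau>. \<Phi> (L \<tau>))"
    proof (rule continuous_on_compose2[OF continuous_on_defining])
      show "continuous_on {- t..t} L" unfolding L_def by (intro continuous_intros)
      show "L ` {- t..t} \<subseteq> ball p r" using L s2(2) by auto
    qed
    ultimately obtain \<tau> where \<tau>: "- t \<le> \<tau>" "\<tau> \<le> t" "\<Phi> (L \<tau>) = 0"
      using IVT'[of "\<lambda>\<tau>. \<Phi> (L \<tau>)" "- t" 0 t] t by (auto simp: less_imp_le)
    have "L \<tau> \<in> ball p r" "L \<tau> \<in> ball q s" using L[OF \<tau>(1,2)] s2 by auto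
    then have "L \<tau> \<in> frontier \<Omega> \<inter> ball q s" using frontier_iff \<tau>(3) by auto
    moreover have "proj v (L \<tau>) = y"
    proof -
      have "v \<bullet> v = 1" using dir by (simp add: norm_eq_1)
      then have "proj v (\<tau> *\<^sub>R v) = 0" "proj v h = h" using h by (auto simp: proj_def)
      then show ?thesis unfolding L_def h(3) proj_add by (simp add: add.commute)
    qed
    ultimately show "y \<in> proj v ` (frontier \<Omega> \<inter> ball q s)" by blast
  qed
  then have "?H ((\<lambda>h. h + proj v q) ` ({h. v \<bullet> h = 0} \<inter> cball 0 \<epsilon>)) \<le> ?H (proj v ` (frontier \<Omega> \<inter> ball q s))"
    by (rule hausdorff_outer_mono)
  also have "\<dots> \<le> ?H (frontier \<Omega> \<inter> ball q s)"
    using hausdorff_outer_image_le[of 1 "frontier \<Omega> \<inter> ball q s" "proj v" "\<lambda>x. x" "DIM('a) - 1"] norm_proj_le[OF dir]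
    by (simp add: dist_norm proj_diff[symmetric])
  finally have "?H ((\<lambda>h. h + proj v q) ` ({h. v \<bullet> h = 0} \<inter> cball 0 \<epsilon>)) \<le> ?H (frontier \<Omega> \<inter> ball q s)" .
  moreover have "?H ((\<lambda>h. h + proj v q) ` ({h. v \<bullet> h = 0} \<inter> cball 0 \<epsilon>)) = ?H ({h. v \<bullet> h = 0} \<inter> cball 0 \<epsilon>)"
    by (rule hausdorff_outer_isometry) simp
  ultimately show ?thesis
    using hausdorff_outer_hyperplane_ball_pos[OF dir \<epsilon>(1)] by simp
qed

end

section \<open>The divergence theorem\<close>

definition C1_gradient :: "('a::euclidean_space \<Rightarrow> real) \<Rightarrow> ('a \<Rightarrow> 'a) \<Rightarrow> bool" where
  "C1_gradient f D \<longleftrightarrow> (\<forall>x. (f has_derivative (\<lambda>h. D x \<bullet> h)) (at x)) \<and> continuous_on UNIV D"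

lemma C1_gradient_continuous: "C1_gradient f D \<Longrightarrow> continuous_on S f" "C1_gradient f D \<Longrightarrow> continuous_on S D"
  unfolding C1_gradient_def
  by (meson continuous_at_imp_continuous_on has_derivative_continuous)
    (meson continuous_on_subset subset_UNIV)

lemma C1_gradient_mult:
  assumes "C1_gradient f D" "C1_gradient g E"
  shows "C1_gradient (\<lambda>x. f x * g x) (\<lambda>x. f x *\<^sub>R E x + g x *\<^sub>R D x)"
  unfolding C1_gradient_def
proof (intro conjI allI)
  fix x
  have "(f has_derivative (\<lambda>h. D x \<bullet> h)) (at x)" "(g has_derivative (\<lambda>h. E x \<bullet> h)) (at x)"
    using assms by (auto simp: C1_gradient_def)
  from has_derivative_mult[OF this]
  show "((\<lambda>x. f x * g x) has_derivative (\<lambda>h. (f x *\<^sub>R E x + g x *\<^sub>R D x) \<bullet> h)) (at x)"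
    by (simp add: inner_add_left mult.commute)
qed (use assms in \<open>auto intro!: continuous_intros dest: C1_gradient_continuous\<close>)

lemma C1_gradient_compose:
  assumes f: "C1_gradient f D" and \<phi>: "\<And>x. (\<phi> has_real_derivative \<psi> (f x)) (at (f x))"
    and \<psi>: "continuous_on (range f) \<psi>"
  shows "C1_gradient (\<lambda>x. \<phi> (f x)) (\<lambda>x. \<psi> (f x) *\<^sub>R D x)"
  unfolding C1_gradient_def
proof (intro conjI allI)
  fix x
  have "(f has_derivative (\<lambda>h. D x \<bullet> h)) (at x)"
    using f by (auto simp: C1_gradient_def)
  from has_derivative_compose[OF this \<phi>[unfolded has_field_derivative_def]]
  show "((\<lambda>x. \<phi> (f x)) has_derivative (\<lambda>h. (\<psi> (f x) *\<^sub>R D x) \<bullet> h)) (at x)"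
    by simp
  have "continuous_on UNIV (\<lambda>x. \<psi> (f x))"
    using C1_gradient_continuous(1)[OF f] by (intro continuous_on_compose2[OF \<psi>]) auto
  then show "continuous_on UNIV (\<lambda>x. \<psi> (f x) *\<^sub>R D x)"
    using C1_gradient_continuous(2)[OF f] by (intro continuous_intros)
qed

lemma C1_gradient_sum:
  assumes "\<And>i. i \<in> I \<Longrightarrow> C1_gradient (f i) (D i)"
  shows "C1_gradient (\<lambda>x. \<Sum>i\<in>I. f i x) (\<lambda>x. \<Sum>i\<in>I. D i x)"
  unfolding C1_gradient_def
proof (intro conjI allI)
  fix x
  show "((\<lambda>x. \<Sum>i\<in>I. f i x) has_derivative (\<lambda>h. (\<Sum>i\<in>I. D i x) \<bullet> h)) (at x)"
    unfolding inner_sum_left using assms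
    by (intro has_derivative_sum) (auto simp: C1_gradient_def)
qed (use assms in \<open>auto intro!: continuous_intros dest: C1_gradient_continuous\<close>)

lemma C1_gradient_add:
  assumes "C1_gradient f D" "C1_gradient g E"
  shows "C1_gradient (\<lambda>x. f x + g x) (\<lambda>x. D x + E x)"
  using C1_gradient_sum[of "{True, False}" "\<lambda>b. if b then f else g" "\<lambda>b. if b then D else E"] assms
  by simp

lemma C1_gradient_ball_defining: "C1_gradient (\<lambda>x. c - (x - p) \<bullet> (x - p)) (\<lambda>x. - 2 *\<^sub>R (x - p))"
  unfolding C1_gradient_def
proof (intro conjI allI)
  fix x
  show "((\<lambda>x. c - (x - p) \<bullet> (x - p)) has_derivative (\<lambda>h. (- 2 *\<^sub>R (x - p)) \<bullet> h)) (at x)"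
    by (auto intro!: derivative_eq_intros simp: inner_commute)
qed (intro continuous_intros)

text \<open>Squaring makes the positive part continuously differentiable at 0. Both the bumps
  supported in balls and the correction of their sum in the partition of unity are built from this
  function.\<close>

lemma max_zero_square_derivative:
  "((\<lambda>t. (max 0 t)\<^sup>2) has_real_derivative 2 * max 0 t) (at (t::real))"
proof -
  consider "t < 0" | "0 < t" | "t = 0" by linarith
  then show ?thesis
  proof cases
    case 1
    have "((\<lambda>t::real. 0) has_real_derivative 0) (at t)" by simp
    then have "((\<lambda>t. (max 0 t)\<^sup>2) has_real_derivative 0) (at t)"
      by (rule has_field_derivative_transform_within_open[where S = "{..<0}"]) (use 1 in auto)
    with 1 show ?thesis by simp
  next
    case 2
    have "((\<lambda>t::real. t\<^sup>2) has_real_derivative 2 * t) (at t)" by (auto intro!: derivative_eq_intros)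
    then have "((\<lambda>t. (max 0 t)\<^sup>2) has_real_derivative 2 * t) (at t)"
      by (rule has_field_derivative_transform_within_open[where S = "{0<..}"]) (use 2 in auto)
    with 2 show ?thesis by simp
  next
    case 3
    have "((\<lambda>h::real. (max 0 h)\<^sup>2 / h) \<longlongrightarrow> 0) (at 0)"
    proof (rule Lim_null_comparison)
      show "\<forall>\<^sub>F h::real in at 0. norm ((max 0 h)\<^sup>2 / h) \<le> \<bar>h\<bar>"
        by (intro always_eventually allI) (auto simp: max_def power2_eq_square)
      show "((\<lambda>h::real. \<bar>h\<bar>) \<longlongrightarrow> 0) (at 0)"
        using tendsto_rabs[OF tendsto_ident_at, of "0::real" UNIV] by simp
    qed
    with 3 show ?thesis by (simp add: has_field_derivative_iff)
  qed
qed

lemma C1_gradient_max_zero_square: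
  assumes "C1_gradient g E"
  shows "C1_gradient (\<lambda>x. (max 0 (g x))\<^sup>2) (\<lambda>x. (2 * max 0 (g x)) *\<^sub>R E x)"
  by (rule C1_gradient_compose[where \<phi> = "\<lambda>t. (max 0 t)\<^sup>2" and \<psi> = "\<lambda>t. 2 * max 0 t", OF assms])
    (auto intro!: max_zero_square_derivative continuous_intros)

lemma integrable_indicator_gradient:
  assumes D: "continuous_on UNIV D" and \<Omega>: "bounded \<Omega>" "\<Omega> \<in> sets borel"
  shows "integrable lborel (\<lambda>x. indicator \<Omega> x * (D x \<bullet> w) :: real)"
proof -
  have "integrable lborel (\<lambda>x. indicator (closure \<Omega>) x *\<^sub>R (D x \<bullet> w))"
    using \<Omega> D by (intro borel_integrable_compact continuous_intros) (auto intro: continuous_on_subset)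
  then have "integrable lborel (\<lambda>x. indicator \<Omega> x *\<^sub>R (indicator (closure \<Omega>) x *\<^sub>R (D x \<bullet> w)))"
    by (rule integrable_mult_indicator[rotated]) (use \<Omega>(2) in simp)
  also have "(\<lambda>x. indicator \<Omega> x *\<^sub>R (indicator (closure \<Omega>) x *\<^sub>R (D x \<bullet> w))) = (\<lambda>x. indicator \<Omega> x * (D x \<bullet> w))"
    using closure_subset by (auto simp: indicator_def fun_eq_iff)
  finally show ?thesis .
qed

section \<open>The divergence theorem along a transversal direction\<close>

context transversal_patch
begin

text \<open>The fundamental theorem of calculus from the entry parameter \<open>t0\<close> to a
  point beyond the support. The choices \<open>t0 = - R\<close> and \<open>t0 = R\<close> describe
  lines whose part in the ball lies wholly inside or wholly outside the domain.\<close>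

lemma line_integral_cut:
  assumes f: "C1_gradient f D" and supp: "\<And>x. x \<notin> ball p r \<Longrightarrow> f x = 0 \<and> D x = 0"
    and R: "\<And>t. R \<le> \<bar>t\<bar> \<Longrightarrow> h + t *\<^sub>R v \<notin> ball p r"
    and t0: "- R \<le> t0" "t0 \<le> R" "0 \<le> R"
    and cut: "\<And>t. h + t *\<^sub>R v \<in> ball p r \<Longrightarrow> t \<noteq> t0 \<Longrightarrow> h + t *\<^sub>R v \<in> \<Omega> \<longleftrightarrow> t0 < t"
  shows "(\<integral>t. indicator \<Omega> (h + t *\<^sub>R v) * (D (h + t *\<^sub>R v) \<bullet> v) \<partial>lborel) = - f (h + t0 *\<^sub>R v)"
proof -
  have der: "((\<lambda>t. f (h + t *\<^sub>R v)) has_real_derivative D (h + t *\<^sub>R v) \<bullet> v) (at t)" for t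
  proof -
    have "((\<lambda>t. h + t *\<^sub>R v) has_derivative (\<lambda>s. s *\<^sub>R v)) (at t)"
      by (auto intro!: derivative_eq_intros)
    from has_derivative_compose[OF this, of f "\<lambda>k. D (h + t *\<^sub>R v) \<bullet> k"] f
    show ?thesis
      by (simp add: C1_gradient_def has_field_derivative_def mult_commute_abs mult.commute)
  qed
  have contD: "continuous_on UNIV (\<lambda>t. D (h + t *\<^sub>R v) \<bullet> v)"
    by (intro continuous_intros continuous_on_compose2[OF C1_gradient_continuous(2)[OF f, of UNIV]]) auto
  then have contD': "isCont (\<lambda>t. D (h + t *\<^sub>R v) \<bullet> v) t" for t
    by (simp add: continuous_on_eq_continuous_at)
  have meas: "(\<lambda>t. D (h + t *\<^sub>R v) \<bullet> v) \<in> borel_measurable borel"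
    using contD by (rule borel_measurable_continuous_onI)
  have [measurable]: "\<Omega> \<in> sets borel" using open_dom by simp
  have "(\<integral>t. indicator \<Omega> (h + t *\<^sub>R v) * (D (h + t *\<^sub>R v) \<bullet> v) \<partial>lborel)
      = (\<integral>t. (D (h + t *\<^sub>R v) \<bullet> v) * indicator {t0..R} t \<partial>lborel)"
  proof (rule integral_cong_AE)
    show "AE t in lborel. indicator \<Omega> (h + t *\<^sub>R v) * (D (h + t *\<^sub>R v) \<bullet> v)
        = (D (h + t *\<^sub>R v) \<bullet> v) * indicator {t0..R} t"
      using AE_lborel_singleton[of t0]
    proof eventually_elim
      fix t assume t: "t \<noteq> t0"
      show "indicator \<Omega> (h + t *\<^sub>R v) * (D (h + t *\<^sub>R v) \<bullet> v) = (D (h + t *\<^sub>R v) \<bullet> v) * indicator {t0..R} t"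
      proof (cases "h + t *\<^sub>R v \<in> ball p r")
        case True
        then have "\<bar>t\<bar> < R" using R[of t] by force
        then show ?thesis using cut[OF True t] t by (auto simp: indicator_def)
      qed (use supp in simp)
    qed
  qed (use meas in measurable)
  also have "\<dots> = f (h + R *\<^sub>R v) - f (h + t0 *\<^sub>R v)"
    using t0(2) der contD' by (intro integral_FTC_Icc_real[where F = "\<lambda>t. f (h + t *\<^sub>R v)"]) auto
  also have "f (h + R *\<^sub>R v) = 0" using supp R[of R] t0 by auto
  finally show ?thesis by simp
qed

lemma line_leaves_ball:
  assumes "norm h + norm p + \<bar>r\<bar> + 1 \<le> \<bar>t\<bar>"
  shows "h + t *\<^sub>R v \<notin> ball p r"
proof
  assume "h + t *\<^sub>R v \<in> ball p r"
  then have "norm (h + t *\<^sub>R v - p) < r" by (simp add: dist_norm norm_minus_commute)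
  moreover have "norm (t *\<^sub>R v) \<le> norm (h + t *\<^sub>R v - p) + norm (p - h)"
    using norm_triangle_ineq[of "h + t *\<^sub>R v - p" "p - h"] by simp
  moreover have "norm (p - h) \<le> norm p + norm h" by (rule norm_triangle_ineq4)
  ultimately show False using assms dir by auto
qed

lemma line_integral_crossing:
  assumes f: "C1_gradient f D" and supp: "\<And>x. x \<notin> ball p r \<Longrightarrow> f x = 0 \<and> D x = 0"
    and x: "x \<in> sheet"
  shows "(\<integral>t. indicator \<Omega> (proj v x + t *\<^sub>R v) * (D (proj v x + t *\<^sub>R v) \<bullet> v) \<partial>lborel) = - f x"
proof -
  define R where "R = norm (proj v x) + norm p + \<bar>r\<bar> + 1"
  define t0 where "t0 = v \<bullet> x"
  have xt: "proj v x + t0 *\<^sub>R v = x" by (simp add: t0_def proj_eq)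
  have xB: "x \<in> ball p r" "\<Phi> x = 0" using x sheetD by auto
  have R: "proj v x + t *\<^sub>R v \<notin> ball p r" if "R \<le> \<bar>t\<bar>" for t
    using that by (intro line_leaves_ball) (simp add: R_def)
  have "\<bar>t0\<bar> < R" using R[of t0] xt xB by force
  moreover have "proj v x + t *\<^sub>R v \<in> \<Omega> \<longleftrightarrow> t0 < t" if "proj v x + t *\<^sub>R v \<in> ball p r" "t \<noteq> t0" for t
  proof -
    let ?y = "proj v x + t *\<^sub>R v"
    have y: "?y = x + (t - t0) *\<^sub>R v"
      using xt by (metis add.assoc add_diff_cancel_left' diff_add_cancel scaleR_left_distrib)
    then have x': "x = ?y + (t0 - t) *\<^sub>R v" by (simp add: algebra_simps)
    show ?thesis
    proof (cases "t0 < t")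
      case True
      then have "\<Phi> x < \<Phi> ?y" using defining_increasing[of x "t - t0"] xB that y by simp
      then show ?thesis using True dom_iff[OF that(1)] xB by simp
    next
      case False
      then have "0 < t0 - t" using that by simp
      then have "\<Phi> ?y < \<Phi> x" using defining_increasing[of ?y "t0 - t"] xB that x' by simp
      then show ?thesis using False dom_iff[OF that(1)] xB by simp
    qed
  qed
  ultimately have "(\<integral>t. indicator \<Omega> (proj v x + t *\<^sub>R v) * (D (proj v x + t *\<^sub>R v) \<bullet> v) \<partial>lborel)
      = - f (proj v x + t0 *\<^sub>R v)"
    by (intro line_integral_cut[OF f supp R]) auto
  then show ?thesis by (simp only: xt)
qed

text \<open>Without a boundary point on it, the chord of the line in the ball keeps one sign of
  \<open>\<Phi>\<close>, so the integral runs over the whole support or over nothing, and the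
  boundary term vanishes in both cases.\<close>

lemma line_integral_noncrossing:
  assumes f: "C1_gradient f D" and supp: "\<And>x. x \<notin> ball p r \<Longrightarrow> f x = 0 \<and> D x = 0"
    and h: "v \<bullet> h = 0" "h \<notin> proj v ` sheet"
  shows "(\<integral>t. indicator \<Omega> (h + t *\<^sub>R v) * (D (h + t *\<^sub>R v) \<bullet> v) \<partial>lborel) = 0"
proof -
  define R where "R = norm h + norm p + \<bar>r\<bar> + 1"
  have R0: "0 \<le> R" by (simp add: R_def)
  have R: "h + t *\<^sub>R v \<notin> ball p r" if "R \<le> \<bar>t\<bar>" for t
    using that by (intro line_leaves_ball) (simp add: R_def)
  have vv: "v \<bullet> v = 1" using dir by (simp add: norm_eq_1)
  have nz: "\<Phi> (h + t *\<^sub>R v) \<noteq> 0" if "h + t *\<^sub>R v \<in> ball p r" for t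
  proof
    assume "\<Phi> (h + t *\<^sub>R v) = 0"
    then have "h + t *\<^sub>R v \<in> sheet" using that frontier_iff by (auto simp: sheet_def)
    moreover have "proj v (h + t *\<^sub>R v) = h" using h vv by (simp add: proj_def inner_add_right)
    ultimately show False using h(2) by (metis imageI)
  qed
  \<comment> \<open>Monotonicity along \<open>v\<close> places the negative value before the
    positive one, and the intermediate value theorem on the chord between them produces the
    forbidden zero.\<close>
  have sgn: False if ab: "h + a *\<^sub>R v \<in> ball p r" "h + b *\<^sub>R v \<in> ball p r"
      "\<Phi> (h + a *\<^sub>R v) < 0" "0 < \<Phi> (h + b *\<^sub>R v)" for a b
  proof -
    have "a < b"
    proof (rule ccontr)
      assume "\<not> a < b"
      then consider "a = b" | "0 < a - b" by linarith
      then show False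
      proof cases
        case 2
        have "h + a *\<^sub>R v = h + b *\<^sub>R v + (a - b) *\<^sub>R v" by (simp add: algebra_simps)
        with defining_increasing[of "h + b *\<^sub>R v" "a - b"] 2 ab show False by simp
      qed (use ab in simp)
    qed
    have B: "h + t *\<^sub>R v \<in> ball p r" if "a \<le> t" "t \<le> b" for t
    proof -
      define u where "u = (t - a) / (b - a)"
      have u: "0 \<le> u" "u \<le> 1" using that \<open>a < b\<close> by (auto simp: u_def field_simps)
      have "a + u * (b - a) = t" using \<open>a < b\<close> by (simp add: u_def)
      then have "h + t *\<^sub>R v = (1 - u) *\<^sub>R (h + a *\<^sub>R v) + u *\<^sub>R (h + b *\<^sub>R v)"
      proof -
        have "(1 - u) *\<^sub>R (h + a *\<^sub>R v) + u *\<^sub>R (h + b *\<^sub>R v) = h + (a + u * (b - a)) *\<^sub>R v"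
          by (simp add: algebra_simps)
        then show ?thesis using \<open>a + u * (b - a) = t\<close> by simp
      qed
      then show ?thesis using convexD_alt[OF convex_ball ab(1,2) u] by simp
    qed
    have "continuous_on {a..b} (\<lambda>t. \<Phi> (h + t *\<^sub>R v))"
      by (rule continuous_on_compose2[OF continuous_on_defining]) (use B in \<open>auto intro!: continuous_intros\<close>)
    then obtain t where "a \<le> t" "t \<le> b" "\<Phi> (h + t *\<^sub>R v) = 0"
      using IVT'[of "\<lambda>t. \<Phi> (h + t *\<^sub>R v)" a 0 b] ab \<open>a < b\<close> by (auto simp: less_imp_le)
    with nz[OF B] show False by blast
  qed
  show ?thesis
  proof (cases "\<exists>b. h + b *\<^sub>R v \<in> ball p r \<and> 0 < \<Phi> (h + b *\<^sub>R v)")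
    case True
    then have pos: "0 < \<Phi> (h + t *\<^sub>R v)" if "h + t *\<^sub>R v \<in> ball p r" for t
      using nz[OF that] sgn that by (metis linorder_neqE_linordered_idom)
    have "h + t *\<^sub>R v \<in> \<Omega> \<longleftrightarrow> - R < t" if "h + t *\<^sub>R v \<in> ball p r" for t
    proof -
      have "\<bar>t\<bar> < R" using R[of t] that by force
      then show ?thesis using dom_iff[OF that] pos[OF that] by auto
    qed
    then have "(\<integral>t. indicator \<Omega> (h + t *\<^sub>R v) * (D (h + t *\<^sub>R v) \<bullet> v) \<partial>lborel) = - f (h + (- R) *\<^sub>R v)"
      using R0 R by (intro line_integral_cut[OF f supp]) auto
    then show ?thesis using supp R[of "- R"] R0 by simp
  next
    case False
    have "h + t *\<^sub>R v \<in> \<Omega> \<longleftrightarrow> R < t" if "h + t *\<^sub>R v \<in> ball p r" for t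
    proof -
      have "\<bar>t\<bar> < R" using R[of t] that by force
      then show ?thesis using dom_iff[OF that] False that by auto
    qed
    then have "(\<integral>t. indicator \<Omega> (h + t *\<^sub>R v) * (D (h + t *\<^sub>R v) \<bullet> v) \<partial>lborel) = - f (h + R *\<^sub>R v)"
      using R0 R by (intro line_integral_cut[OF f supp]) auto
    then show ?thesis using supp R[of R] R0 by simp
  qed
qed

text \<open>Each line parallel to \<open>v\<close> contributes minus the value of \<open>f\<close>
  at its crossing point, and the area formula turns the integral over lines into one over the sheet.
  There \<open>weight\<close> equals \<open>- (\<nu> x \<bullet> v)\<close> for the outward
  normal.\<close>

lemma transversal_divergence:
  assumes f: "C1_gradient f D" and supp: "\<And>x. x \<notin> ball p r \<Longrightarrow> f x = 0 \<and> D x = 0"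
    and bdd: "bounded \<Omega>"
  shows "slice_constant TYPE('a) * (\<integral>x. indicator \<Omega> x * (D x \<bullet> v) \<partial>lborel)
    = - (\<integral>x. weight x * f x \<partial>hausdorff_measure (DIM('a) - 1))"
proof -
  let ?F = "\<lambda>x. indicator \<Omega> x * (D x \<bullet> v)"
  let ?\<phi> = "\<lambda>h. \<integral>t. ?F (h + t *\<^sub>R v) \<partial>lborel"
  have int: "integrable lborel ?F"
    using bdd open_dom C1_gradient_continuous(2)[OF f] by (intro integrable_indicator_gradient) auto
  have "?\<phi> \<in> borel_measurable (hyperplane_measure v)"
    using integrable_slice[OF dir int] by (rule borel_measurable_integrable)
  then have m: "?\<phi> \<in> borel_measurable borel"
    by (simp cong: measurable_cong_sets)
  have "slice_constant TYPE('a) * (\<integral>x. ?F x \<partial>lborel) = (\<integral>h. ?\<phi> h \<partial>hyperplane_measure v)"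
    using integral_slice[OF dir int] by simp
  also have "\<dots> = (\<integral>x. weight x * ?\<phi> (proj v x) \<partial>hausdorff_measure (DIM('a) - 1))"
    using line_integral_noncrossing[OF f supp] by (intro integral_hyperplane_sheet[OF m]) auto
  also have "\<dots> = (\<integral>x. - (weight x * f x) \<partial>hausdorff_measure (DIM('a) - 1))"
  proof (intro Bochner_Integration.integral_cong refl)
    fix x
    show "weight x * ?\<phi> (proj v x) = - (weight x * f x)"
    proof (cases "x \<in> sheet")
      case True
      then show ?thesis using line_integral_crossing[OF f supp True] by simp
    qed (simp add: weight_def)
  qed
  finally show ?thesis by simp
qed

end

section \<open>Global divergence theorem on domains with continuously differentiable
  boundary\<close>

text \<open>No direction is singled out, since transversality to all directions near the gradient is
  recovered by shrinking the ball. The normal carries a minus sign because \<open>\<Phi>\<close> is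
  positive inside.\<close>

definition C1_patch :: "'a::euclidean_space set \<Rightarrow> ('a \<Rightarrow> 'a) \<Rightarrow> 'a \<Rightarrow> real \<Rightarrow> ('a \<Rightarrow> real) \<Rightarrow> ('a \<Rightarrow> 'a) \<Rightarrow> bool" where
  "C1_patch \<Omega> \<nu> p r \<Phi> G \<longleftrightarrow> 0 < r \<and>
     (\<forall>x\<in>ball p r. (\<Phi> has_derivative (\<lambda>h. G x \<bullet> h)) (at x)) \<and> continuous_on (ball p r) G \<and>
     (\<forall>x\<in>ball p r. G x \<noteq> 0) \<and> \<Omega> \<inter> ball p r = {x \<in> ball p r. 0 < \<Phi> x} \<and>
     (\<forall>x\<in>frontier \<Omega> \<inter> ball p r. \<nu> x = - (G x /\<^sub>R norm (G x)))"

text \<open>A full cone of directions that are transversal on one and the same ball is what allows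
  \<open>local_divergence\<close> to reach arbitrary directions by linearity.\<close>

lemma gradient_cone:
  fixes G :: "'a::euclidean_space \<Rightarrow> 'a"
  assumes r: "0 < r" and G: "continuous_on (ball p r) G" "G p \<noteq> 0"
  shows "\<exists>s>0. s \<le> r \<and> (\<forall>x\<in>ball p s. \<forall>u. norm (u - G p /\<^sub>R norm (G p)) \<le> 1/2 \<longrightarrow> 0 < G x \<bullet> u)"
proof -
  have "isCont G p" using G(1) r by (auto simp: continuous_on_eq_continuous_at)
  moreover have g: "0 < norm (G p)" using G by simp
  then have "0 < norm (G p) / 4" by simp
  ultimately obtain d where d: "0 < d" "\<And>x. dist x p < d \<Longrightarrow> dist (G x) (G p) < norm (G p) / 4"
    unfolding continuous_at_eps_delta by blast
  show ?thesis
  proof (intro exI[of _ "min d r"] conjI ballI allI impI)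
    fix x u assume x: "x \<in> ball p (min d r)" and u: "norm (u - G p /\<^sub>R norm (G p)) \<le> 1/2"
    define e where "e = G p /\<^sub>R norm (G p)"
    have e: "norm e = 1" "G p \<bullet> e = norm (G p)"
      using g by (auto simp: e_def power2_norm_eq_inner[symmetric] power2_eq_square field_simps)
    have ue: "norm (u - e) \<le> 1/2" using u by (simp add: e_def)
    have "norm (G x - G p) \<le> norm (G p) / 4"
      using d(2)[of x] x by (auto simp: dist_norm norm_minus_commute less_imp_le)
    moreover have "norm u \<le> 3/2" using ue e norm_triangle_ineq[of "u - e" e] by simp
    ultimately have "norm (G x - G p) * norm u \<le> (norm (G p) / 4) * (3/2)"
      by (intro mult_mono) auto
    then have "\<bar>(G x - G p) \<bullet> u\<bar> \<le> 3/8 * norm (G p)"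
      using Cauchy_Schwarz_ineq2[of "G x - G p" u] by linarith
    moreover have "\<bar>G p \<bullet> (u - e)\<bar> \<le> norm (G p) * (1/2)"
      using Cauchy_Schwarz_ineq2[of "G p" "u - e"] mult_left_mono[OF ue, of "norm (G p)"] by simp
    \<comment> \<open>In units of \<open>norm (G p)\<close> the errors are at most
      \<open>3/8\<close> and \<open>1/2\<close>, leaving \<open>1/8\<close>.\<close>
    moreover have "G x \<bullet> u = (G x - G p) \<bullet> u + G p \<bullet> (u - e) + norm (G p)"
      using e by (simp add: inner_diff_left inner_diff_right)
    ultimately show "0 < G x \<bullet> u" using g by linarith
  qed (use r d in auto)
qed

locale C1_domain =
  fixes \<Omega> :: "'a::euclidean_space set" and \<nu> :: "'a \<Rightarrow> 'a"
  assumes open_dom: "open \<Omega>" and bounded_dom: "bounded \<Omega>"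
    and patch: "\<And>p. p \<in> frontier \<Omega> \<Longrightarrow> \<exists>r \<Phi> G. C1_patch \<Omega> \<nu> p r \<Phi> G"
begin

abbreviation "\<sigma> \<equiv> surface_measure (frontier \<Omega>)"

text \<open>An interior point receives an affine function positive on a ball inside the domain. The
  boundary part of the patch is then empty, and one local formula covers interior and boundary
  points alike.\<close>

lemma patch_closure:
  assumes p: "p \<in> closure \<Omega>"
  shows "\<exists>r \<Phi> G. C1_patch \<Omega> \<nu> p r \<Phi> G"
proof (cases "p \<in> \<Omega>")
  case True
  obtain b :: 'a where b: "b \<in> Basis" using nonempty_Basis by blast
  obtain r where r: "0 < r" "ball p r \<subseteq> \<Omega>" using True open_dom by (metis open_contains_ball)
  have pos: "0 < (x - p) \<bullet> b + r" if "x \<in> ball p r" for x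
  proof -
    have "\<bar>(x - p) \<bullet> b\<bar> < r"
      using Basis_le_norm[OF b, of "x - p"] that by (simp add: dist_norm norm_minus_commute)
    then show ?thesis by linarith
  qed
  have fr: "frontier \<Omega> \<inter> ball p r = {}"
    using r open_dom by (auto simp: frontier_def interior_open)
  have "C1_patch \<Omega> \<nu> p r (\<lambda>x. (x - p) \<bullet> b + r) (\<lambda>_. b)"
    unfolding C1_patch_def fr
  proof (intro conjI ballI)
    show "((\<lambda>x. (x - p) \<bullet> b + r) has_derivative (\<bullet>) b) (at x)" for x
      by (auto intro!: derivative_eq_intros simp: inner_commute)
    show "\<Omega> \<inter> ball p r = {x \<in> ball p r. 0 < (x - p) \<bullet> b + r}"
      using r(2) pos by auto
  qed (use r b nonzero_Basis in auto)
  then show ?thesis by blast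
next
  case False
  then show ?thesis using p open_dom patch by (simp add: frontier_def interior_open)
qed

lemma cone_patch:
  assumes p: "p \<in> closure \<Omega>"
  obtains s e \<Phi> G where "0 < s" "norm e = 1"
    "\<And>u. norm (u - e) \<le> 1/2 \<Longrightarrow> transversal_patch \<Omega> p s \<Phi> G (u /\<^sub>R norm u)"
    "\<And>x. x \<in> frontier \<Omega> \<inter> ball p s \<Longrightarrow> \<nu> x = - (G x /\<^sub>R norm (G x))"
    "continuous_on (ball p s) G" "\<And>x. x \<in> ball p s \<Longrightarrow> G x \<noteq> 0"
proof -
  obtain r \<Phi> G where P: "C1_patch \<Omega> \<nu> p r \<Phi> G" using patch_closure[OF p] by blast
  then have r: "0 < r" and G: "continuous_on (ball p r) G" "G p \<noteq> 0"
    by (auto simp: C1_patch_def)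
  obtain s where s: "0 < s" "s \<le> r"
    and cone: "\<And>x u. x \<in> ball p s \<Longrightarrow> norm (u - G p /\<^sub>R norm (G p)) \<le> 1/2 \<Longrightarrow> 0 < G x \<bullet> u"
    using gradient_cone[OF r G] by blast
  have sub: "ball p s \<subseteq> ball p r" using s by (simp add: subset_ball)
  define e where "e = G p /\<^sub>R norm (G p)"
  have e: "norm e = 1" using G by (simp add: e_def)
  show ?thesis
  proof (rule that[of s e \<Phi> G])
    fix u assume u: "norm (u - e) \<le> 1/2"
    have "u \<noteq> 0" using u e by auto
    then show "transversal_patch \<Omega> p s \<Phi> G (u /\<^sub>R norm u)"
    proof (unfold_locales)
      show "continuous_on (ball p s) G" using G(1) sub by (rule continuous_on_subset)
      show "\<Omega> \<inter> ball p s = {x \<in> ball p s. 0 < \<Phi> x}" using P sub unfolding C1_patch_def by blast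
      show "0 < G x \<bullet> (u /\<^sub>R norm u)" if "x \<in> ball p s" for x
        using cone[OF that u[unfolded e_def]] \<open>u \<noteq> 0\<close> by simp
      show "(\<Phi> has_derivative (\<bullet>) (G x)) (at x)" if "x \<in> ball p s" for x
        using P that sub by (auto simp: C1_patch_def)
    qed (use open_dom in auto)
  next
    show "continuous_on (ball p s) G" using G(1) sub by (rule continuous_on_subset)
  qed (use s e P sub in \<open>auto simp: C1_patch_def\<close>)
qed

lemma frontier_subset_closure: "p \<in> frontier \<Omega> \<Longrightarrow> p \<in> closure \<Omega>"
  by (simp add: frontier_def)

lemma compact_frontier_dom: "compact (frontier \<Omega>)"
  using bounded_dom by (rule compact_frontier_bounded)

lemma hausdorff_outer_frontier_finite: "hausdorff_outer (DIM('a) - 1) (frontier \<Omega>) < \<infinity>"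
proof -
  let ?H = "hausdorff_outer (DIM('a) - 1) :: 'a set \<Rightarrow> ennreal"
  have "\<exists>\<rho>>0. ?H (frontier \<Omega> \<inter> ball p \<rho>) < \<infinity>" if p: "p \<in> frontier \<Omega>" for p
  proof -
    obtain s e \<Phi> G where s: "0 < s" "norm e = 1"
      "\<And>u. norm (u - e) \<le> 1/2 \<Longrightarrow> transversal_patch \<Omega> p s \<Phi> G (u /\<^sub>R norm u)"
      using cone_patch[OF frontier_subset_closure[OF p]] by metis
    interpret T: transversal_patch \<Omega> p s \<Phi> G "e /\<^sub>R norm e" by (rule s(3)) simp
    have "p \<in> T.sheet" using p s(1) by (simp add: T.sheet_def)
    from T.local_comparison[OF this zero_less_one]
    obtain \<rho> where \<rho>: "0 < \<rho>" "\<And>E. E \<in> sets borel \<Longrightarrow> E \<subseteq> frontier \<Omega> \<inter> cball p \<rho> \<Longrightarrow> ?H E < \<infinity>"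
      by blast
    have "?H (frontier \<Omega> \<inter> ball p \<rho>) < \<infinity>"
    proof (rule \<rho>(2))
      show "frontier \<Omega> \<inter> ball p \<rho> \<in> sets borel" by simp
    qed (use ball_subset_cball in blast)
    with \<rho>(1) show ?thesis by blast
  qed
  then obtain \<rho> where \<rho>: "\<And>p. p \<in> frontier \<Omega> \<Longrightarrow> 0 < \<rho> p"
    "\<And>p. p \<in> frontier \<Omega> \<Longrightarrow> ?H (frontier \<Omega> \<inter> ball p (\<rho> p)) < \<infinity>" by metis
  obtain I where I: "I \<subseteq> frontier \<Omega>" "finite I" "frontier \<Omega> \<subseteq> (\<Union>p\<in>I. ball p (\<rho> p))"
    by (rule compactE_image[OF compact_frontier_dom, of "frontier \<Omega>" "\<lambda>p. ball p (\<rho> p)"])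
      (use \<rho>(1) in auto)
  have "emeasure (hausdorff_measure (DIM('a) - 1)) (\<Union>p\<in>I. frontier \<Omega> \<inter> ball p (\<rho> p))
      \<le> (\<Sum>p\<in>I. emeasure (hausdorff_measure (DIM('a) - 1)) (frontier \<Omega> \<inter> ball p (\<rho> p)))"
    using I(2) by (intro emeasure_subadditive_finite) auto
  also have "\<dots> = (\<Sum>p\<in>I. ?H (frontier \<Omega> \<inter> ball p (\<rho> p)))"
    by (intro sum.cong refl emeasure_hausdorff_measure) auto
  also have "\<dots> < \<infinity>" using I \<rho>(2) by auto
  also have "(\<Union>p\<in>I. frontier \<Omega> \<inter> ball p (\<rho> p)) = frontier \<Omega>" using I(3) by blast
  finally show ?thesis by (subst (asm) emeasure_hausdorff_measure) auto
qed

lemma frontier_borel: "frontier \<Omega> \<inter> space (hausdorff_measure (DIM('a) - 1)) \<in> sets (hausdorff_measure (DIM('a) - 1) :: 'a measure)"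
  by simp

lemma space_surface [simp]: "space \<sigma> = frontier \<Omega>"
  by (simp add: surface_measure_def space_restrict_space)

lemma sets_surface [measurable_cong]: "sets \<sigma> = sets (restrict_space borel (frontier \<Omega>))"
  unfolding surface_measure_def by (intro sets_restrict_space_cong) simp

lemma emeasure_surface:
  assumes "A \<in> sets borel"
  shows "emeasure \<sigma> (A \<inter> frontier \<Omega>) = hausdorff_outer (DIM('a) - 1) (A \<inter> frontier \<Omega>)"
  unfolding surface_measure_def using assms
  by (subst emeasure_restrict_space[OF frontier_borel]) (auto simp: emeasure_hausdorff_measure)

lemma finite_measure_surface: "finite_measure \<sigma>"
proof
  show "emeasure \<sigma> (space \<sigma>) \<noteq> \<infinity>"
    using emeasure_surface[of UNIV] hausdorff_outer_frontier_finite by simp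
qed

lemma measurable_surface_continuous:
  assumes "continuous_on (frontier \<Omega>) f"
  shows "f \<in> borel_measurable \<sigma>"
  using borel_measurable_continuous_on_restrict[OF assms] by (simp cong: measurable_cong_sets add: sets_surface)

lemma measurable_surface_ident: "(\<lambda>x. x) \<in> borel_measurable \<sigma>"
  by (intro measurable_surface_continuous continuous_intros)

lemma integrable_surface_continuous:
  fixes f :: "'a \<Rightarrow> real"
  assumes f: "continuous_on (frontier \<Omega>) f"
  shows "integrable \<sigma> f"
proof -
  interpret finite_measure \<sigma> by (rule finite_measure_surface)
  have "bounded (f ` frontier \<Omega>)"
    using compact_frontier_dom f by (intro compact_imp_bounded compact_continuous_image)
  then obtain B where B: "\<And>x. x \<in> frontier \<Omega> \<Longrightarrow> norm (f x) \<le> B"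
    by (auto simp: bounded_iff)
  show ?thesis
  proof (rule integrable_const_bound[of f B])
    show "AE x in \<sigma>. norm (f x) \<le> B" using B by (intro AE_I2) simp
  qed (rule measurable_surface_continuous[OF f])
qed

lemma
  shows continuous_on_normal: "continuous_on (frontier \<Omega>) \<nu>"
    and norm_normal: "p \<in> frontier \<Omega> \<Longrightarrow> norm (\<nu> p) = 1"
proof -
  have "continuous (at p within frontier \<Omega>) \<nu> \<and> norm (\<nu> p) = 1" if p: "p \<in> frontier \<Omega>" for p
  proof -
    obtain r \<Phi> G where P: "C1_patch \<Omega> \<nu> p r \<Phi> G" using patch[OF p] by blast
    then have r: "0 < r" and G: "continuous_on (ball p r) G" "\<And>x. x \<in> ball p r \<Longrightarrow> G x \<noteq> 0"
      and \<nu>: "\<And>x. x \<in> frontier \<Omega> \<Longrightarrow> x \<in> ball p r \<Longrightarrow> \<nu> x = - (G x /\<^sub>R norm (G x))"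
      by (auto simp: C1_patch_def)
    have "continuous_on (ball p r) (\<lambda>x. - (G x /\<^sub>R norm (G x)))"
      using G by (intro continuous_intros) auto
    then have "isCont (\<lambda>x. - (G x /\<^sub>R norm (G x))) p"
      using r by (simp add: continuous_on_eq_continuous_at)
    then have "continuous (at p within frontier \<Omega>) (\<lambda>x. - (G x /\<^sub>R norm (G x)))"
      by (rule continuous_at_imp_continuous_at_within)
    then have "((\<lambda>x. - (G x /\<^sub>R norm (G x))) \<longlongrightarrow> \<nu> p) (at p within frontier \<Omega>)"
      using \<nu>[OF p] r by (simp add: continuous_within)
    then have "(\<nu> \<longlongrightarrow> \<nu> p) (at p within frontier \<Omega>)"
      by (rule Lim_transform_within[OF _ r]) (use \<nu> in \<open>auto simp: dist_commute\<close>)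
    moreover have "norm (\<nu> p) = 1" using \<nu>[OF p] G(2)[of p] r by simp
    ultimately show ?thesis by (simp add: continuous_within)
  qed
  then show "continuous_on (frontier \<Omega>) \<nu>" "p \<in> frontier \<Omega> \<Longrightarrow> norm (\<nu> p) = 1"
    by (auto simp: continuous_on_eq_continuous_within)
qed

text \<open>Both sides are linear in \<open>w\<close> and agree on the cone of transversal
  directions around \<open>e\<close>, which contains \<open>e\<close> and
  \<open>e + \<tau> *\<^sub>R w\<close> for small \<open>\<tau>\<close>; the difference of these two
  gives \<open>w\<close>.\<close>

lemma local_divergence:
  assumes p: "p \<in> closure \<Omega>"
  shows "\<exists>s>0. \<forall>f D w. C1_gradient f D \<longrightarrow> (\<forall>x. x \<notin> ball p s \<longrightarrow> f x = 0 \<and> D x = 0) \<longrightarrow>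
    slice_constant TYPE('a) * (\<integral>x. indicator \<Omega> x * (D x \<bullet> w) \<partial>lborel) = (\<integral>x. f x * (\<nu> x \<bullet> w) \<partial>\<sigma>)"
proof -
  obtain s e \<Phi> G where s: "0 < s" "norm e = 1"
    and tp: "\<And>u. norm (u - e) \<le> 1/2 \<Longrightarrow> transversal_patch \<Omega> p s \<Phi> G (u /\<^sub>R norm u)"
    and \<nu>: "\<And>x. x \<in> frontier \<Omega> \<inter> ball p s \<Longrightarrow> \<nu> x = - (G x /\<^sub>R norm (G x))"
    using cone_patch[OF p] by metis
  show ?thesis
  proof (intro exI[of _ s] conjI allI impI s(1))
    fix f :: "'a \<Rightarrow> real" and D :: "'a \<Rightarrow> 'a" and w :: 'a
    assume f: "C1_gradient f D" and supp: "\<forall>x. x \<notin> ball p s \<longrightarrow> f x = 0 \<and> D x = 0"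
    define L where "L u = slice_constant TYPE('a) * (\<integral>x. indicator \<Omega> x * (D x \<bullet> u) \<partial>lborel)" for u
    define R where "R u = (\<integral>x. f x * (\<nu> x \<bullet> u) \<partial>\<sigma>)" for u
    have intL: "integrable lborel (\<lambda>x. indicator \<Omega> x * (D x \<bullet> u) :: real)" for u
      using bounded_dom open_dom C1_gradient_continuous(2)[OF f] by (intro integrable_indicator_gradient) auto
    have intR: "integrable \<sigma> (\<lambda>x. f x * (\<nu> x \<bullet> u))" for u
      by (intro integrable_surface_continuous continuous_intros C1_gradient_continuous(1)[OF f] continuous_on_normal)
    have linL: "L (a *\<^sub>R u + b *\<^sub>R u') = a * L u + b * L u'" for a b u u'
    proof -
      have "(\<integral>x. indicator \<Omega> x * (D x \<bullet> (a *\<^sub>R u + b *\<^sub>R u')) \<partial>lborel)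
          = (\<integral>x. a * (indicator \<Omega> x * (D x \<bullet> u)) + b * (indicator \<Omega> x * (D x \<bullet> u')) \<partial>lborel)"
        by (intro Bochner_Integration.integral_cong) (auto simp: inner_add_right algebra_simps)
      then show ?thesis using intL by (simp add: L_def algebra_simps)
    qed
    have linR: "R (a *\<^sub>R u + b *\<^sub>R u') = a * R u + b * R u'" for a b u u'
    proof -
      have "R (a *\<^sub>R u + b *\<^sub>R u') = (\<integral>x. a * (f x * (\<nu> x \<bullet> u)) + b * (f x * (\<nu> x \<bullet> u')) \<partial>\<sigma>)"
        unfolding R_def by (intro Bochner_Integration.integral_cong) (auto simp: inner_add_right algebra_simps)
      then show ?thesis using intR by (simp add: R_def)
    qed
    have cone: "L u = R u" if u: "norm (u - e) \<le> 1/2" for u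
    proof -
      have u0: "u \<noteq> 0" using u s(2) by auto
      define v where "v = u /\<^sub>R norm u"
      interpret T: transversal_patch \<Omega> p s \<Phi> G v unfolding v_def by (rule tp[OF u])
      have "R v = (\<integral>x. indicator (frontier \<Omega>) x *\<^sub>R (f x * (\<nu> x \<bullet> v)) \<partial>hausdorff_measure (DIM('a) - 1))"
        unfolding R_def surface_measure_def by (rule integral_restrict_space[OF frontier_borel])
      also have "\<dots> = (\<integral>x. - (T.weight x * f x) \<partial>hausdorff_measure (DIM('a) - 1))"
      proof (intro Bochner_Integration.integral_cong refl)
        fix x
        show "indicator (frontier \<Omega>) x *\<^sub>R (f x * (\<nu> x \<bullet> v)) = - (T.weight x * f x)"
        proof (cases "x \<in> T.sheet")
          case True
          then have "\<nu> x = - (G x /\<^sub>R norm (G x))" using \<nu> by (auto simp: T.sheet_def)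
          then show ?thesis using True by (simp add: T.weight_def T.slope_def T.sheet_def divide_inverse_commute)
        next
          case False
          then show ?thesis using supp by (auto simp: T.weight_def T.sheet_def indicator_def)
        qed
      qed
      also have "\<dots> = L v"
        using T.transversal_divergence[OF f _ bounded_dom] supp by (simp add: L_def)
      finally have "L v = R v" ..
      then show ?thesis
        using linL[of "norm u" v 0 0] linR[of "norm u" v 0 0] u0 by (simp add: v_def)
    qed
    \<comment> \<open>Makes \<open>norm (\<tau> *\<^sub>R w)\<close> at most \<open>1/2\<close>, the
      aperture of the cone, also for \<open>w = 0\<close>.\<close>
    define \<tau> where "\<tau> = 1 / (2 * (norm w + 1))"
    have \<tau>: "0 < \<tau>" by (auto simp: \<tau>_def intro!: divide_pos_pos add_nonneg_pos)
    have "norm (\<tau> *\<^sub>R w) = norm w / (2 * (norm w + 1))" using \<tau> by (simp add: \<tau>_def)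
    also have "\<dots> \<le> 1/2" by (simp add: divide_le_eq add_nonneg_pos)
    finally have "L (e + \<tau> *\<^sub>R w) = R (e + \<tau> *\<^sub>R w)" by (intro cone) simp
    then have "L e + \<tau> * L w = R e + \<tau> * R w"
      using linL[of 1 e \<tau> w] linR[of 1 e \<tau> w] by simp
    moreover have "L e = R e" by (intro cone) simp
    ultimately have "L w = R w" using \<tau> by simp
    then show "slice_constant TYPE('a) * (\<integral>x. indicator \<Omega> x * (D x \<bullet> w) \<partial>lborel) = (\<integral>x. f x * (\<nu> x \<bullet> w) \<partial>\<sigma>)"
      by (simp add: L_def R_def)
  qed
qed

text \<open>
  The local formula is globalised with the partition \<open>b p / t\<close>, where \<open>t\<close> is the sum of the bumps
  \<open>b p\<close>, corrected away from \<open>closure \<Omega>\<close> so that it never vanishes.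
\<close>

theorem divergence:
  assumes f: "C1_gradient f D"
  shows "slice_constant TYPE('a) * (\<integral>x. indicator \<Omega> x * (D x \<bullet> w) \<partial>lborel) = (\<integral>x. f x * (\<nu> x \<bullet> w) \<partial>\<sigma>)"
proof (cases "\<Omega> = {}")
  \<comment> \<open>Separated because the minimum \<open>m\<close> below is attained only on a
    nonempty closure.\<close>
  case True
  have sp: "space \<sigma> = {}" using space_surface True by (simp only: frontier_empty)
  have "(\<integral>x. f x * (\<nu> x \<bullet> w) \<partial>\<sigma>) = 0"
    by (rule integral_eq_zero_AE, rule AE_I2) (use sp in blast)
  with True show ?thesis by simp
next
  case False
  define P where "P p s \<longleftrightarrow> 0 < s \<and> (\<forall>f D w. C1_gradient f D \<longrightarrow> (\<forall>x. x \<notin> ball p s \<longrightarrow> f x = 0 \<and> D x = 0) \<longrightarrow>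
    slice_constant TYPE('a) * (\<integral>x. indicator \<Omega> x * (D x \<bullet> w) \<partial>lborel) = (\<integral>x. f x * (\<nu> x \<bullet> w) \<partial>\<sigma>))" for p s
  have "\<exists>s. P p s" if "p \<in> closure \<Omega>" for p
    using local_divergence[OF that] by (simp only: P_def)
  then obtain s where sP: "\<And>p. p \<in> closure \<Omega> \<Longrightarrow> P p (s p)" by metis
  then have s: "\<And>p. p \<in> closure \<Omega> \<Longrightarrow> 0 < s p" by (simp add: P_def)
  have loc: "slice_constant TYPE('a) * (\<integral>x. indicator \<Omega> x * (D x \<bullet> w) \<partial>lborel) = (\<integral>x. f x * (\<nu> x \<bullet> w) \<partial>\<sigma>)"
    if "p \<in> closure \<Omega>" "C1_gradient f D" "\<And>x. x \<notin> ball p (s p) \<Longrightarrow> f x = 0 \<and> D x = 0" for p f D w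
    using sP[OF that(1), unfolded P_def, THEN conjunct2, rule_format, OF that(2)] that(3) by blast
  have comp: "compact (closure \<Omega>)" using bounded_dom by simp
  obtain I where I: "I \<subseteq> closure \<Omega>" "finite I" "closure \<Omega> \<subseteq> (\<Union>p\<in>I. ball p (s p))"
    by (rule compactE_image[OF comp, of "closure \<Omega>" "\<lambda>p. ball p (s p)"]) (use s in auto)
  define g where "g p x = (s p)\<^sup>2 - (x - p) \<bullet> (x - p)" for p x :: 'a
  define b where "b p x = (max 0 (g p x))\<^sup>2" for p x
  define Db where "Db p x = (2 * max 0 (g p x)) *\<^sub>R (- 2 *\<^sub>R (x - p))" for p x
  have b: "C1_gradient (b p) (Db p)" for p
    unfolding b_def[abs_def] Db_def[abs_def] g_def[abs_def]
    by (rule C1_gradient_max_zero_square[OF C1_gradient_ball_defining])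
  have g: "0 < g p x \<longleftrightarrow> x \<in> ball p (s p)" if "p \<in> I" for p x
  proof -
    have "0 < s p" using s I(1) that by blast
    then have "(norm (x - p))\<^sup>2 < (s p)\<^sup>2 \<longleftrightarrow> norm (x - p) < s p"
      by (meson less_imp_le norm_ge_zero power2_less_imp_less power_strict_mono zero_less_numeral)
    then show ?thesis
      by (simp add: g_def dist_norm norm_minus_commute power2_norm_eq_inner[symmetric])
  qed
  define S where "S x = (\<Sum>p\<in>I. b p x)" for x
  define DS where "DS x = (\<Sum>p\<in>I. Db p x)" for x
  have S: "C1_gradient S DS"
    unfolding S_def[abs_def] DS_def[abs_def] by (intro C1_gradient_sum b)
  have S_pos: "0 < S x" if x: "x \<in> closure \<Omega>" for x
  proof -
    obtain p where p: "p \<in> I" "x \<in> ball p (s p)" using I(3) x by blast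
    then have "0 < g p x" using g by blast
    then have "0 < b p x" by (simp add: b_def)
    moreover have "b p x \<le> S x" unfolding S_def using I(2) p(1) by (intro member_le_sum) (auto simp: b_def)
    ultimately show ?thesis by linarith
  qed
  obtain m where m: "0 < m" "\<And>x. x \<in> closure \<Omega> \<Longrightarrow> m \<le> S x"
  proof -
    obtain x0 where "x0 \<in> closure \<Omega>" "\<And>y. y \<in> closure \<Omega> \<Longrightarrow> S x0 \<le> S y"
      using continuous_attains_inf[OF comp _ C1_gradient_continuous(1)[OF S]] False by auto
    then show ?thesis using that[of "S x0"] S_pos by blast
  qed
  \<comment> \<open>On the closure \<open>S\<close> is at least \<open>m\<close>, so the correction
    vanishes there; where \<open>S\<close> is 0 it equals \<open>m\<^sup>2\<close>. Hence
    \<open>t\<close> is positive everywhere, and \<open>1 / t\<close> is defined on the whole space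
    as \<open>C1_gradient\<close> demands.\<close>
  define t where "t x = S x + (max 0 (m + (-1) * S x))\<^sup>2" for x
  have "C1_gradient (\<lambda>x. m + (-1) * S x) (\<lambda>x. (-1) *\<^sub>R DS x)"
    by (rule C1_gradient_compose[where \<phi> = "\<lambda>t. m + (-1) * t" and \<psi> = "\<lambda>t. -1", OF S])
      (auto intro!: derivative_eq_intros)
  from C1_gradient_add[OF S C1_gradient_max_zero_square[OF this]]
  obtain Dt where Dt: "C1_gradient t Dt" unfolding t_def[abs_def] by blast
  have S0: "0 \<le> S x" for x by (auto simp: S_def b_def intro: sum_nonneg)
  have t_pos: "0 < t x" for x
  proof (cases "S x = 0")
    case True then show ?thesis using m(1) by (simp add: t_def)
  next
    case False then show ?thesis using S0[of x] by (auto simp: t_def intro: add_pos_nonneg)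
  qed
  have t_eq: "t x = S x" if "x \<in> closure \<Omega>" for x
    using m(2)[OF that] by (simp add: t_def max_def)
  have "C1_gradient (\<lambda>x. inverse (t x)) (\<lambda>x. (- (inverse (t x) ^ 2)) *\<^sub>R Dt x)"
  proof (rule C1_gradient_compose[where \<psi> = "\<lambda>t. - (inverse t ^ 2)", OF Dt])
    show "(inverse has_real_derivative - (inverse (t x) ^ 2)) (at (t x))" for x
      using DERIV_inverse[of "t x" UNIV] t_pos[of x] by (simp add: numeral_2_eq_2)
    show "continuous_on (range t) (\<lambda>t. - (inverse t ^ 2))"
      using t_pos by (intro continuous_intros) (auto simp: less_imp_neq[symmetric])
  qed
  from C1_gradient_mult[OF f this]
  obtain DF where F: "C1_gradient (\<lambda>x. f x * inverse (t x)) DF" by blast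
  define F where "F x = f x * inverse (t x)" for x
  define h where "h p x = b p x * F x" for p x
  define Dh where "Dh p x = b p x *\<^sub>R DF x + F x *\<^sub>R Db p x" for p x
  have h: "C1_gradient (h p) (Dh p)" for p
    unfolding h_def[abs_def] Dh_def[abs_def] using C1_gradient_mult[OF b F, of p] by (simp add: F_def)
  have supp: "h p x = 0 \<and> Dh p x = 0" if "p \<in> I" "x \<notin> ball p (s p)" for p x
    using g[OF that(1), of x] that(2) by (auto simp: h_def Dh_def b_def Db_def max_def)
  have sum_h: "(\<Sum>p\<in>I. h p x) = f x" if "x \<in> closure \<Omega>" for x
  proof -
    have "(\<Sum>p\<in>I. h p x) = S x * F x" by (simp add: h_def S_def sum_distrib_right)
    then show ?thesis using t_eq[OF that] t_pos[of x] by (simp add: F_def)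
  qed
  \<comment> \<open>The functions \<open>h p\<close> sum to \<open>f\<close> on the open set, so
    their gradients sum to \<open>D\<close> by uniqueness of derivatives; the gradient of the
    partition is never computed.\<close>
  have sum_Dh: "(\<Sum>p\<in>I. Dh p x) = D x" if "x \<in> \<Omega>" for x
  proof -
    have "((\<lambda>x. \<Sum>p\<in>I. h p x) has_derivative (\<lambda>k. (\<Sum>p\<in>I. Dh p x) \<bullet> k)) (at x)"
      using C1_gradient_sum[of I h Dh] h by (auto simp: C1_gradient_def)
    then have "(f has_derivative (\<lambda>k. (\<Sum>p\<in>I. Dh p x) \<bullet> k)) (at x)"
      by (rule has_derivative_transform_within_open[OF _ open_dom that]) (use sum_h closure_subset in auto)
    moreover have "(f has_derivative (\<lambda>k. D x \<bullet> k)) (at x)" using f by (simp add: C1_gradient_def)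
    ultimately have "(\<lambda>k. (\<Sum>p\<in>I. Dh p x) \<bullet> k) = (\<lambda>k. D x \<bullet> k)" by (rule has_derivative_unique)
    then have "(\<Sum>p\<in>I. Dh p x) \<bullet> k = D x \<bullet> k" for k by (rule fun_cong)
    then show ?thesis by (rule vector_eq_rdot[THEN iffD1, OF allI])
  qed
  have intL: "integrable lborel (\<lambda>x. indicator \<Omega> x * (Dh p x \<bullet> w) :: real)" for p
    using bounded_dom open_dom C1_gradient_continuous(2)[OF h] by (intro integrable_indicator_gradient) auto
  have intR: "integrable \<sigma> (\<lambda>x. h p x * (\<nu> x \<bullet> w))" for p
    by (intro integrable_surface_continuous continuous_intros C1_gradient_continuous(1)[OF h] continuous_on_normal)
  have "(\<integral>x. indicator \<Omega> x * (D x \<bullet> w) \<partial>lborel) = (\<integral>x. (\<Sum>p\<in>I. indicator \<Omega> x * (Dh p x \<bullet> w)) \<partial>lborel)"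
    by (intro Bochner_Integration.integral_cong)
      (auto simp: sum_Dh inner_sum_left[symmetric] sum_distrib_left[symmetric] indicator_def)
  also have "\<dots> = (\<Sum>p\<in>I. (\<integral>x. indicator \<Omega> x * (Dh p x \<bullet> w) \<partial>lborel))"
    using intL by (intro Bochner_Integration.integral_sum)
  finally have "slice_constant TYPE('a) * (\<integral>x. indicator \<Omega> x * (D x \<bullet> w) \<partial>lborel)
      = (\<Sum>p\<in>I. slice_constant TYPE('a) * (\<integral>x. indicator \<Omega> x * (Dh p x \<bullet> w) \<partial>lborel))"
    by (simp add: sum_distrib_left)
  also have "\<dots> = (\<Sum>p\<in>I. (\<integral>x. h p x * (\<nu> x \<bullet> w) \<partial>\<sigma>))"
    using I(1) supp by (intro sum.cong refl loc[OF _ h]) auto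
  also have "\<dots> = (\<integral>x. (\<Sum>p\<in>I. h p x * (\<nu> x \<bullet> w)) \<partial>\<sigma>)"
    using intR by (intro Bochner_Integration.integral_sum[symmetric])
  also have "\<dots> = (\<integral>x. f x * (\<nu> x \<bullet> w) \<partial>\<sigma>)"
    by (intro Bochner_Integration.integral_cong refl)
      (simp add: sum_distrib_right[symmetric] sum_h frontier_subset_closure)
  finally show ?thesis .
qed

end

section \<open>The regularised double layer kernel\<close>

definition reg :: "real \<Rightarrow> 'a::real_inner \<Rightarrow> real" where
  "reg \<epsilon> z = inverse (sqrt (\<epsilon>\<^sup>2 + z \<bullet> z))"

lemma reg_pos: "0 < \<epsilon> \<Longrightarrow> 0 < reg \<epsilon> z"
  by (simp add: reg_def add_pos_nonneg)

lemma reg_square: "0 < \<epsilon> \<Longrightarrow> (reg \<epsilon> z)\<^sup>2 * (\<epsilon>\<^sup>2 + z \<bullet> z) = 1"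
proof -
  assume "0 < \<epsilon>"
  then have "0 < \<epsilon>\<^sup>2 + z \<bullet> z" by (simp add: add_pos_nonneg)
  then show ?thesis by (simp add: reg_def power_inverse)
qed

lemma continuous_on_reg [continuous_intros]:
  assumes "0 < \<epsilon>" "continuous_on S f"
  shows "continuous_on S (\<lambda>x. reg \<epsilon> (f x))"
proof -
  have "\<epsilon>\<^sup>2 + z \<bullet> z \<noteq> 0" for z :: 'b
    using assms(1) by (intro less_imp_neq[symmetric]) (simp add: add_pos_nonneg)
  then show ?thesis unfolding reg_def using assms(2) by (intro continuous_intros) auto
qed

lemma borel_measurable_reg [measurable]: "reg \<epsilon> \<in> borel_measurable (borel :: 'a::euclidean_space measure)"
  unfolding reg_def[abs_def] by measurable

lemma reg_scale:
  assumes "0 < \<epsilon>"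
  shows "reg \<epsilon> (\<epsilon> *\<^sub>R u) = reg 1 u / \<epsilon>"
proof -
  have "\<epsilon>\<^sup>2 + (\<epsilon> *\<^sub>R u) \<bullet> (\<epsilon> *\<^sub>R u) = \<epsilon>\<^sup>2 * (1 + u \<bullet> u)" by (simp add: power2_eq_square algebra_simps)
  then show ?thesis using assms by (simp add: reg_def real_sqrt_mult divide_inverse)
qed

lemma norm_mult_reg_le: "0 < \<epsilon> \<Longrightarrow> norm z * reg \<epsilon> z \<le> 1"
proof -
  assume e: "0 < \<epsilon>"
  have "norm z \<le> sqrt (\<epsilon>\<^sup>2 + z \<bullet> z)" by (intro real_le_rsqrt) (simp add: power2_norm_eq_inner)
  moreover have "0 < sqrt (\<epsilon>\<^sup>2 + z \<bullet> z)" using e by (simp add: add_pos_nonneg)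
  ultimately show ?thesis by (simp add: reg_def field_simps)
qed

lemma reg_le_inverse: "0 < \<epsilon> \<Longrightarrow> reg \<epsilon> z \<le> inverse \<epsilon>"
proof -
  assume e: "0 < \<epsilon>"
  have "\<epsilon> \<le> sqrt (\<epsilon>\<^sup>2 + z \<bullet> z)" by (intro real_le_rsqrt) simp
  then show ?thesis unfolding reg_def using e by (intro le_imp_inverse_le)
qed

lemma C1_gradient_reg_power:
  fixes y :: "'a::euclidean_space"
  assumes e: "0 < \<epsilon>"
  shows "C1_gradient (\<lambda>x. reg \<epsilon> (x - y) ^ d) (\<lambda>x. (- real d * reg \<epsilon> (x - y) ^ (d + 2)) *\<^sub>R (x - y))"
proof -
  define N where "N x = \<epsilon>\<^sup>2 + (-1) * (0 - (x - y) \<bullet> (x - y))" for x :: 'a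
  have N: "C1_gradient N (\<lambda>x. (-1) *\<^sub>R (- 2 *\<^sub>R (x - y)))"
    unfolding N_def[abs_def]
    by (rule C1_gradient_compose[where \<phi> = "\<lambda>t. \<epsilon>\<^sup>2 + (-1) * t" and \<psi> = "\<lambda>_. -1", OF C1_gradient_ball_defining])
      (auto intro!: derivative_eq_intros)
  have Npos: "0 < N x" for x using e by (simp add: N_def add_pos_nonneg)
  have reg: "reg \<epsilon> (x - y) = inverse (sqrt (N x))" for x by (simp add: reg_def N_def)
  define \<psi> where "\<psi> t = - real d / 2 * inverse (sqrt t) ^ (d + 2)" for t
  have der: "((\<lambda>t. inverse (sqrt t) ^ d) has_real_derivative \<psi> t) (at t)" if t: "0 < t" for t
  proof -
    have s: "sqrt t \<noteq> 0" using t by simp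
    have "((\<lambda>t. inverse (sqrt t)) has_real_derivative - (inverse (sqrt t) * (inverse (sqrt t) / 2) * inverse (sqrt t))) (at t)"
      using DERIV_inverse'[OF DERIV_real_sqrt[OF t] s] by simp
    from DERIV_power[OF this, of d]
    have "((\<lambda>t. inverse (sqrt t) ^ d) has_real_derivative
      real d * (- (inverse (sqrt t) * (inverse (sqrt t) / 2) * inverse (sqrt t)) * inverse (sqrt t) ^ (d - Suc 0))) (at t)" .
    also have "real d * (- (inverse (sqrt t) * (inverse (sqrt t) / 2) * inverse (sqrt t)) * inverse (sqrt t) ^ (d - Suc 0)) = \<psi> t"
      by (cases d) (auto simp: \<psi>_def algebra_simps)
    finally show ?thesis .
  qed
  have cont: "continuous_on (range N) \<psi>"
    unfolding \<psi>_def using Npos by (intro continuous_intros) (auto simp: less_imp_neq[symmetric])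
  have "C1_gradient (\<lambda>x. inverse (sqrt (N x)) ^ d) (\<lambda>x. \<psi> (N x) *\<^sub>R ((-1) *\<^sub>R (- 2 *\<^sub>R (x - y))))"
    using der[OF Npos] by (intro C1_gradient_compose[OF N _ cont])
  then show ?thesis by (simp add: reg \<psi>_def)
qed

text \<open>The divergence of the field \<open>x\<close> times \<open>reg 1 x ^ DIM('a)\<close>, a
  smoothing of the field \<open>x\<close> divided by \<open>norm x ^ DIM('a)\<close>, whose
  divergence is concentrated at the origin.\<close>

definition bump :: "'a::euclidean_space \<Rightarrow> real" where
  "bump u = real DIM('a) * reg 1 u ^ (DIM('a) + 2)"

lemma bump_nonneg: "0 \<le> bump u"
  using reg_pos[of 1 u] by (simp add: bump_def)

lemma borel_measurable_bump [measurable]: "bump \<in> borel_measurable (borel :: 'a::euclidean_space measure)"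
  unfolding bump_def[abs_def] by measurable

lemma bump_uminus: "bump (- u) = bump u"
  by (simp add: bump_def reg_def)

lemma integral_lborel_affine:
  fixes y :: "'a::euclidean_space" and g :: "'a \<Rightarrow> real"
  assumes [measurable]: "g \<in> borel_measurable borel" and "c \<noteq> 0"
  shows "(\<integral>x. g x \<partial>lborel) = \<bar>c\<bar> ^ DIM('a) * (\<integral>u. g (y + c *\<^sub>R u) \<partial>lborel)"
  by (subst lborel_affine[OF assms(2), of y], subst integral_density)
    (auto simp: integral_distr ennreal_power[symmetric])

context C1_domain
begin

text \<open>The field \<open>x - y\<close> times \<open>reg \<epsilon> (x - y) ^ d\<close> has
  divergence \<open>d * \<epsilon>\<^sup>2 * reg \<epsilon> (x - y) ^ (d + 2)\<close>, of which the
  bump is the rescaled form. It is treated coordinate by coordinate, as \<open>divergence\<close>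
  concerns a scalar function and one direction.\<close>

lemma divergence_reg:
  assumes e: "0 < \<epsilon>"
  shows "(\<integral>x. (\<nu> x \<bullet> (x - y)) * reg \<epsilon> (x - y) ^ DIM('a) \<partial>\<sigma>)
    = slice_constant TYPE('a) * (\<integral>u. indicator \<Omega> (y + \<epsilon> *\<^sub>R u) * bump u \<partial>lborel)"
proof -
  let ?d = "DIM('a)"
  define f where "f b x = ((x - y) \<bullet> b) * reg \<epsilon> (x - y) ^ ?d" for b x
  define D where "D b x = ((x - y) \<bullet> b) *\<^sub>R ((- real ?d * reg \<epsilon> (x - y) ^ (?d + 2)) *\<^sub>R (x - y))
    + reg \<epsilon> (x - y) ^ ?d *\<^sub>R b" for b x
  have lin: "C1_gradient (\<lambda>x. (x - y) \<bullet> b) (\<lambda>_. b)" for b :: 'a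
    unfolding C1_gradient_def by (auto intro!: derivative_eq_intros simp: inner_commute)
  have f: "C1_gradient (f b) (D b)" for b
    unfolding f_def[abs_def] D_def[abs_def] by (rule C1_gradient_mult[OF lin C1_gradient_reg_power[OF e]])
  have intL: "integrable lborel (\<lambda>x. indicator \<Omega> x * (D b x \<bullet> b) :: real)" for b
    using bounded_dom open_dom C1_gradient_continuous(2)[OF f] by (intro integrable_indicator_gradient) auto
  have intR: "integrable \<sigma> (\<lambda>x. f b x * (\<nu> x \<bullet> b))" for b
    by (intro integrable_surface_continuous continuous_intros C1_gradient_continuous(1)[OF f] continuous_on_normal)
  have div: "(\<Sum>b\<in>Basis. D b x \<bullet> b) = real ?d * \<epsilon>\<^sup>2 * reg \<epsilon> (x - y) ^ (?d + 2)" for x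
  proof -
    have "(\<Sum>b\<in>Basis. D b x \<bullet> b) = (\<Sum>b\<in>Basis. - real ?d * reg \<epsilon> (x - y) ^ (?d + 2) * (((x - y) \<bullet> b) * ((x - y) \<bullet> b))
        + reg \<epsilon> (x - y) ^ ?d)"
      by (intro sum.cong refl) (simp add: D_def inner_add_left algebra_simps)
    also have "\<dots> = - real ?d * reg \<epsilon> (x - y) ^ (?d + 2) * ((x - y) \<bullet> (x - y)) + real ?d * reg \<epsilon> (x - y) ^ ?d"
      by (simp only: sum.distrib sum_distrib_left[symmetric] sum_constant euclidean_inner[of "x - y" "x - y"])
    \<comment> \<open>Raising the power to \<open>d + 2\<close> with \<open>reg_square\<close> makes
      the two terms comparable; the parts with \<open>(x - y) \<bullet> (x - y)\<close> cancel and
      only \<open>\<epsilon>\<^sup>2\<close> survives.\<close>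
    also have "reg \<epsilon> (x - y) ^ ?d = reg \<epsilon> (x - y) ^ ?d * ((reg \<epsilon> (x - y))\<^sup>2 * (\<epsilon>\<^sup>2 + (x - y) \<bullet> (x - y)))"
      by (simp only: reg_square[OF e] mult_1_right)
    also have "\<dots> = reg \<epsilon> (x - y) ^ (?d + 2) * (\<epsilon>\<^sup>2 + (x - y) \<bullet> (x - y))"
      by (simp only: power_add mult.assoc)
    finally show ?thesis by (simp only: algebra_simps)
  qed
  have "(\<integral>x. (\<nu> x \<bullet> (x - y)) * reg \<epsilon> (x - y) ^ ?d \<partial>\<sigma>) = (\<integral>x. (\<Sum>b\<in>Basis. f b x * (\<nu> x \<bullet> b)) \<partial>\<sigma>)"
  proof (intro Bochner_Integration.integral_cong refl)
    fix x
    have "(\<Sum>b\<in>Basis. f b x * (\<nu> x \<bullet> b)) = (\<Sum>b\<in>Basis. (\<nu> x \<bullet> b) * ((x - y) \<bullet> b)) * reg \<epsilon> (x - y) ^ ?d"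
      unfolding sum_distrib_right by (intro sum.cong refl) (simp add: f_def)
    then show "(\<nu> x \<bullet> (x - y)) * reg \<epsilon> (x - y) ^ ?d = (\<Sum>b\<in>Basis. f b x * (\<nu> x \<bullet> b))"
      by (simp only: euclidean_inner[of "\<nu> x" "x - y"])
  qed
  also have "\<dots> = (\<Sum>b\<in>Basis. (\<integral>x. f b x * (\<nu> x \<bullet> b) \<partial>\<sigma>))"
    using intR by (intro Bochner_Integration.integral_sum)
  also have "\<dots> = slice_constant TYPE('a) * (\<Sum>b\<in>Basis. (\<integral>x. indicator \<Omega> x * (D b x \<bullet> b) \<partial>lborel))"
    by (simp only: divergence[OF f, symmetric] sum_distrib_left)
  also have "(\<Sum>b\<in>Basis. (\<integral>x. indicator \<Omega> x * (D b x \<bullet> b) \<partial>lborel)) = (\<integral>x. (\<Sum>b\<in>Basis. indicator \<Omega> x * (D b x \<bullet> b)) \<partial>lborel)"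
    using intL by (intro Bochner_Integration.integral_sum[symmetric])
  also have "\<dots> = (\<integral>x. indicator \<Omega> x * (real ?d * \<epsilon>\<^sup>2 * reg \<epsilon> (x - y) ^ (?d + 2)) \<partial>lborel)"
    by (simp only: sum_distrib_left[symmetric] div)
  also have "\<dots> = \<bar>\<epsilon>\<bar> ^ ?d * (\<integral>u. indicator \<Omega> (y + \<epsilon> *\<^sub>R u) * (real ?d * \<epsilon>\<^sup>2 * reg \<epsilon> (y + \<epsilon> *\<^sub>R u - y) ^ (?d + 2)) \<partial>lborel)"
    using e open_dom by (intro integral_lborel_affine) auto
  also have "\<dots> = (\<integral>u. \<epsilon> ^ ?d * (indicator \<Omega> (y + \<epsilon> *\<^sub>R u) * (real ?d * \<epsilon>\<^sup>2 * reg \<epsilon> (\<epsilon> *\<^sub>R u) ^ (?d + 2))) \<partial>lborel)"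
    using e by simp
  also have "\<dots> = (\<integral>u. indicator \<Omega> (y + \<epsilon> *\<^sub>R u) * bump u \<partial>lborel)"
  proof (intro Bochner_Integration.integral_cong refl)
    fix u :: 'a
    \<comment> \<open>The Jacobian, the factor \<open>\<epsilon>\<^sup>2\<close> and the
      \<open>d + 2\<close> factors \<open>1 / \<epsilon>\<close> from \<open>reg_scale\<close>
      balance exactly.\<close>
    have "\<epsilon> ^ ?d * (\<epsilon>\<^sup>2 * (reg 1 u / \<epsilon>) ^ (?d + 2)) = reg 1 u ^ (?d + 2)"
      using e by (simp add: power_divide power_add power2_eq_square)
    then have "\<epsilon> ^ ?d * (indicator \<Omega> (y + \<epsilon> *\<^sub>R u) * (real ?d * \<epsilon>\<^sup>2 * (reg 1 u / \<epsilon>) ^ (?d + 2)))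
      = indicator \<Omega> (y + \<epsilon> *\<^sub>R u) * (real ?d * reg 1 u ^ (?d + 2))"
      by (metis mult.assoc mult.left_commute)
    then show "\<epsilon> ^ ?d * (indicator \<Omega> (y + \<epsilon> *\<^sub>R u) * (real ?d * \<epsilon>\<^sup>2 * reg \<epsilon> (\<epsilon> *\<^sub>R u) ^ (?d + 2)))
      = indicator \<Omega> (y + \<epsilon> *\<^sub>R u) * bump u"
      by (simp only: reg_scale[OF e] bump_def)
  qed
  finally show ?thesis .
qed

text \<open>The sign of the derivative of \<open>\<Phi>\<close> along \<open>w\<close> decides the
  side. This is pointwise convergence of \<open>(\<Omega> - y) / \<epsilon>\<close> to the half
  space \<open>\<nu> y \<bullet> w < 0\<close>, away from the tangent hyperplane.\<close>

lemma normal_sides: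
  assumes y: "y \<in> frontier \<Omega>"
  shows "\<nu> y \<bullet> w < 0 \<Longrightarrow> \<exists>\<tau>>0. \<forall>t\<in>{0<..<\<tau>}. y + t *\<^sub>R w \<in> \<Omega>"
    and "0 < \<nu> y \<bullet> w \<Longrightarrow> \<exists>\<tau>>0. \<forall>t\<in>{0<..<\<tau>}. y + t *\<^sub>R w \<notin> \<Omega>"
proof -
  obtain s e \<Phi> G where s: "0 < s" "norm e = 1"
    "\<And>u. norm (u - e) \<le> 1/2 \<Longrightarrow> transversal_patch \<Omega> y s \<Phi> G (u /\<^sub>R norm u)"
    and \<nu>: "\<And>x. x \<in> frontier \<Omega> \<inter> ball y s \<Longrightarrow> \<nu> x = - (G x /\<^sub>R norm (G x))"
    using cone_patch[OF frontier_subset_closure[OF y]] by metis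
  interpret T: transversal_patch \<Omega> y s \<Phi> G "e /\<^sub>R norm e" by (rule s(3)) simp
  have yB: "y \<in> ball y s" using s by simp
  have \<Phi>y: "\<Phi> y = 0" using T.frontier_iff[OF yB] y by simp
  have Gy: "0 < norm (G y)" using T.grad_nonzero[OF yB] by simp
  have \<nu>y: "\<nu> y \<bullet> w = - (G y \<bullet> w) / norm (G y)" using \<nu>[of y] y yB by (simp add: divide_inverse_commute)
  have "((\<lambda>t. y + t *\<^sub>R w) has_derivative (\<lambda>r. r *\<^sub>R w)) (at 0)"
    by (auto intro!: derivative_eq_intros)
  moreover have "(\<Phi> has_derivative (\<lambda>h. G y \<bullet> h)) (at (y + 0 *\<^sub>R w))" using T.deriv[OF yB] by simp
  ultimately have "((\<lambda>t. \<Phi> (y + t *\<^sub>R w)) has_derivative (\<lambda>r. G y \<bullet> (r *\<^sub>R w))) (at 0)"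
    by (rule has_derivative_compose)
  then have der: "((\<lambda>t. \<Phi> (y + t *\<^sub>R w)) has_real_derivative G y \<bullet> w) (at 0)"
    by (simp add: has_field_derivative_def mult_commute_abs mult.commute)
  define \<rho> where "\<rho> = s / (norm w + 1)"
  have \<rho>: "0 < \<rho>" using s by (auto simp: \<rho>_def intro!: divide_pos_pos add_nonneg_pos)
  have inB: "y + t *\<^sub>R w \<in> ball y s" if "0 < t" "t < \<rho>" for t
  proof -
    have "t * norm w \<le> t * (norm w + 1)" using that by simp
    also have "\<dots> < s" using that by (simp add: \<rho>_def pos_less_divide_eq add_nonneg_pos)
    finally show ?thesis using that by (simp add: dist_norm)
  qed
  show "\<exists>\<tau>>0. \<forall>t\<in>{0<..<\<tau>}. y + t *\<^sub>R w \<in> \<Omega>" if "\<nu> y \<bullet> w < 0"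
  proof -
    have "0 < G y \<bullet> w" using that Gy \<nu>y by (simp add: zero_less_divide_iff)
    from DERIV_pos_inc_right[OF der this]
    obtain d where d: "0 < d" "\<And>h. 0 < h \<Longrightarrow> h < d \<Longrightarrow> 0 < \<Phi> (y + h *\<^sub>R w)" using \<Phi>y by auto
    show ?thesis
      using d \<rho> inB T.dom_iff by (intro exI[of _ "min d \<rho>"]) auto
  qed
  show "\<exists>\<tau>>0. \<forall>t\<in>{0<..<\<tau>}. y + t *\<^sub>R w \<notin> \<Omega>" if "0 < \<nu> y \<bullet> w"
  proof -
    have "G y \<bullet> w < 0" using that Gy \<nu>y by (simp add: divide_less_0_iff zero_less_divide_iff)
    from DERIV_neg_dec_right[OF der this]
    obtain d where d: "0 < d" "\<And>h. 0 < h \<Longrightarrow> h < d \<Longrightarrow> \<Phi> (y + h *\<^sub>R w) < 0" using \<Phi>y by auto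
    have "y + t *\<^sub>R w \<notin> \<Omega>" if "0 < t" "t < min d \<rho>" for t
      using d(2)[of t] T.dom_iff[OF inB[of t]] that by auto
    then show ?thesis
      using d \<rho> by (intro exI[of _ "min d \<rho>"]) auto
  qed
qed

text \<open>For two distinct unit normals, \<open>w = \<nu> y - n\<close> points inward for
  \<open>n\<close> and outward for \<open>\<nu> y\<close>. The lemma identifies an abstractly given
  normal of a ball with the radial one.\<close>

lemma normal_unique:
  assumes y: "y \<in> frontier \<Omega>" and n: "norm n = 1"
    and side: "\<And>w. n \<bullet> w < 0 \<Longrightarrow> \<exists>\<tau>>0. \<forall>t\<in>{0<..<\<tau>}. y + t *\<^sub>R w \<in> \<Omega>"
  shows "\<nu> y = n"
proof (rule ccontr)
  assume ne: "\<nu> y \<noteq> n"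
  have n1: "n \<bullet> n = 1" and \<nu>1: "\<nu> y \<bullet> \<nu> y = 1" using n norm_normal[OF y] by (auto simp: norm_eq_1)
  have "0 < (\<nu> y - n) \<bullet> (\<nu> y - n)" using ne by simp
  then have lt: "\<nu> y \<bullet> n < 1" using n1 \<nu>1 by (simp add: inner_diff_left inner_diff_right inner_commute)
  define w where "w = \<nu> y - n"
  have "n \<bullet> w < 0" "0 < \<nu> y \<bullet> w" using lt n1 \<nu>1 by (auto simp: w_def inner_diff_right inner_commute)
  then obtain t1 t2 where t: "0 < t1" "\<forall>t\<in>{0<..<t1}. y + t *\<^sub>R w \<in> \<Omega>" "0 < t2" "\<forall>t\<in>{0<..<t2}. y + t *\<^sub>R w \<notin> \<Omega>"
    using side[of w] normal_sides(2)[OF y, of w] by blast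
  then have "min t1 t2 / 2 \<in> {0<..<t1}" "min t1 t2 / 2 \<in> {0<..<t2}" by auto
  with t show False by blast
qed

end

lemma C1_domain_ball:
  fixes c :: "'a::euclidean_space"
  assumes R: "0 < R"
  shows "C1_domain (ball c R) (\<lambda>x. (x - c) /\<^sub>R R)"
proof
  fix p assume "p \<in> frontier (ball c R)"
  then have p: "norm (p - c) = R" using R by (simp add: frontier_ball dist_norm norm_minus_commute)
  let ?\<Phi> = "\<lambda>x. R\<^sup>2 - (x - c) \<bullet> (x - c)" and ?G = "\<lambda>x. - 2 *\<^sub>R (x - c)"
  have grad: "C1_gradient ?\<Phi> ?G" by (rule C1_gradient_ball_defining)
  \<comment> \<open>The gradient vanishes only at the centre, which the open ball of radius
    \<open>R\<close> about a boundary point misses.\<close>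
  have nz: "?G x \<noteq> 0" if "x \<in> ball p R" for x
  proof
    assume "?G x = 0"
    then have "x = c" by simp
    with that p show False by (simp add: dist_norm)
  qed
  have dom: "x \<in> ball c R \<longleftrightarrow> 0 < ?\<Phi> x" for x
  proof -
    have "(norm (x - c))\<^sup>2 < R\<^sup>2 \<longleftrightarrow> norm (x - c) < R"
      using R by (meson less_imp_le norm_ge_zero power2_less_imp_less power_strict_mono zero_less_numeral)
    then show ?thesis
      by (simp add: dist_norm norm_minus_commute[of c x] power2_norm_eq_inner)
  qed
  have nrm: "(x - c) /\<^sub>R R = - (?G x /\<^sub>R norm (?G x))" if "x \<in> frontier (ball c R)" for x
  proof -
    have "norm (x - c) = R" using R that by (simp add: frontier_ball dist_norm norm_minus_commute)
    then have "norm (?G x) = 2 * R" by simp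
    then show ?thesis by simp
  qed
  have "ball c R \<inter> ball p R = {x \<in> ball p R. 0 < ?\<Phi> x}" using dom by blast
  then have "C1_patch (ball c R) (\<lambda>x. (x - c) /\<^sub>R R) p R ?\<Phi> ?G"
    unfolding C1_patch_def
    using R nz nrm grad[unfolded C1_gradient_def] C1_gradient_continuous(2)[OF grad, of "ball p R"] by blast
  then show "\<exists>r \<Phi> G. C1_patch (ball c R) (\<lambda>x. (x - c) /\<^sub>R R) p r \<Phi> G" by blast
qed auto

definition sphere_area :: "'a::euclidean_space itself \<Rightarrow> real" where
  "sphere_area _ = measure (surface_measure (sphere (0::'a) 1)) (sphere 0 1)"

text \<open>
  The divergence theorem on the unit ball, with the kernel centred at the origin, evaluates the
  total mass of the bump without any computation.
\<close>

lemma
  shows integrable_bump: "integrable lborel (bump :: 'a::euclidean_space \<Rightarrow> real)"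
    and integral_bump: "slice_constant TYPE('a) * (\<integral>u. bump (u::'a) \<partial>lborel) = sphere_area TYPE('a)"
    and emeasure_sphere: "emeasure (surface_measure (sphere (0::'a) 1)) (sphere 0 1) = ennreal (sphere_area TYPE('a))"
proof -
  let ?d = "DIM('a)"
  interpret C1_domain "ball (0::'a) 1" "\<lambda>x. (x - 0) /\<^sub>R 1" by (rule C1_domain_ball) simp
  have fr: "frontier (ball (0::'a) 1) = sphere 0 1" by (simp add: frontier_ball)
  interpret fin: finite_measure "surface_measure (sphere (0::'a) 1)"
    using finite_measure_surface unfolding fr .
  show "emeasure (surface_measure (sphere (0::'a) 1)) (sphere 0 1) = ennreal (sphere_area TYPE('a))"
    unfolding sphere_area_def by (rule fin.emeasure_eq_measure)
  have sp: "space (surface_measure (sphere (0::'a) 1)) = sphere 0 1" using space_surface unfolding fr .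
  let ?K = "slice_constant TYPE('a)"
  have Kpos: "0 < ?K" by (rule slice_constant_pos)
  define \<epsilon> where "\<epsilon> n = inverse (real (Suc n))" for n
  have \<epsilon>: "0 < \<epsilon> n" for n by (simp add: \<epsilon>_def)
  have \<epsilon>lim: "\<epsilon> \<longlonglongrightarrow> 0" unfolding \<epsilon>_def by (rule LIMSEQ_inverse_real_of_nat)
  define F where "F n u = indicator (ball 0 1) (\<epsilon> n *\<^sub>R u) * bump u" for n and u :: 'a
  \<comment> \<open>On the unit sphere the integrand is the constant
    \<open>inverse (sqrt (\<epsilon>\<^sup>2 + 1)) ^ d\<close>, which tends to 1, so no integral
    over the sphere has to be computed.\<close>
  have F_int: "?K * (\<integral>u. F n u \<partial>lborel) = inverse (sqrt ((\<epsilon> n)\<^sup>2 + 1)) ^ ?d * sphere_area TYPE('a)" for n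
  proof -
    have "?K * (\<integral>u. F n u \<partial>lborel) = (\<integral>x. (x \<bullet> x) * reg (\<epsilon> n) x ^ ?d \<partial>surface_measure (sphere (0::'a) 1))"
      using divergence_reg[OF \<epsilon>[of n], of 0] unfolding fr F_def by simp
    also have "\<dots> = (\<integral>x. inverse (sqrt ((\<epsilon> n)\<^sup>2 + 1)) ^ ?d \<partial>surface_measure (sphere (0::'a) 1))"
    proof (intro Bochner_Integration.integral_cong refl)
      fix x :: 'a assume "x \<in> space (surface_measure (sphere 0 1))"
      then have "x \<bullet> x = 1" using sp by (simp add: norm_eq_1)
      then show "(x \<bullet> x) * reg (\<epsilon> n) x ^ ?d = inverse (sqrt ((\<epsilon> n)\<^sup>2 + 1)) ^ ?d" by (simp add: reg_def)
    qed
    finally show ?thesis by (simp add: sphere_area_def sp)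
  qed
  have F_integrable: "integrable lborel (F n)" for n
  proof -
    have "integrable lborel (\<lambda>u. indicator (cball 0 (real (Suc n))) u *\<^sub>R bump u)"
      by (intro borel_integrable_compact) (auto simp: bump_def[abs_def] intro!: continuous_intros)
    then have "integrable lborel (\<lambda>u. indicator (ball 0 (real (Suc n))) u *\<^sub>R (indicator (cball 0 (real (Suc n))) u *\<^sub>R bump u))"
      by (rule integrable_mult_indicator[rotated]) simp
    also have "(\<lambda>u. indicator (ball 0 (real (Suc n))) u *\<^sub>R (indicator (cball 0 (real (Suc n))) u *\<^sub>R bump u)) = F n"
      by (auto simp: F_def \<epsilon>_def indicator_def fun_eq_iff field_simps)
    finally show ?thesis .
  qed
  have mono: "mono (\<lambda>n. F n u)" for u
  proof (rule monoI)
    fix m n :: nat assume "m \<le> n"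
    then have "\<epsilon> n * norm u \<le> \<epsilon> m * norm u" by (intro mult_right_mono) (auto simp: \<epsilon>_def)
    then show "F m u \<le> F n u" using bump_nonneg[of u] \<epsilon>[of m] \<epsilon>[of n] by (auto simp: F_def indicator_def)
  qed
  have lim: "(\<lambda>n. F n u) \<longlonglongrightarrow> bump u" for u
  proof -
    have "(\<lambda>n. \<epsilon> n * norm u) \<longlonglongrightarrow> 0 * norm u" by (intro tendsto_intros \<epsilon>lim)
    then have "\<forall>\<^sub>F n in sequentially. \<epsilon> n * norm u < 1" by (rule order_tendstoD) simp
    then have "\<forall>\<^sub>F n in sequentially. F n u = bump u"
      by eventually_elim (use \<epsilon> in \<open>simp add: F_def abs_of_pos\<close>)
    then show ?thesis by (rule tendsto_eventually)
  qed
  have "(\<integral>u. F n u \<partial>lborel) = inverse (sqrt ((\<epsilon> n)\<^sup>2 + 1)) ^ ?d * sphere_area TYPE('a) / ?K" for n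
    using F_int[of n] Kpos by (metis less_irrefl nonzero_mult_div_cancel_left)
  moreover have "(\<lambda>n. inverse (sqrt ((\<epsilon> n)\<^sup>2 + 1)) ^ ?d * sphere_area TYPE('a) / ?K)
      \<longlonglongrightarrow> inverse (sqrt (0\<^sup>2 + 1)) ^ ?d * sphere_area TYPE('a) / ?K"
    using Kpos by (intro tendsto_intros \<epsilon>lim) auto
  ultimately have ilim: "(\<lambda>n. \<integral>u. F n u \<partial>lborel) \<longlonglongrightarrow> sphere_area TYPE('a) / ?K" by simp
  have nonneg: "0 \<le> F n u" for n u using bump_nonneg[of u] by (simp add: F_def)
  \<comment> \<open>The domains of integration exhaust the space monotonically; the known limit of
    the integrals yields integrability of the bump together with its integral.\<close>
  note conv = integral_monotone_convergence_nonneg[where f = F and u = bump, OF F_integrable _ _ _ ilim]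
  show "integrable lborel (bump :: 'a \<Rightarrow> real)" by (rule conv) (use mono nonneg lim in auto)
  have "(\<integral>u. bump (u::'a) \<partial>lborel) = sphere_area TYPE('a) / ?K" by (rule conv) (use mono nonneg lim in auto)
  then show "?K * (\<integral>u. bump (u::'a) \<partial>lborel) = sphere_area TYPE('a)" using Kpos by simp
qed

lemma AE_lborel_inner_nonzero:
  fixes a :: "'a::euclidean_space"
  assumes "a \<noteq> 0"
  shows "AE u in lborel. a \<bullet> u \<noteq> 0"
proof -
  have "negligible {u. a \<bullet> u = 0}" using assms by (intro negligible_hyperplane) simp
  then have "{u. a \<bullet> u = 0} \<in> null_sets lebesgue" by (simp add: negligible_iff_null_sets)
  then have "AE u in lebesgue. u \<notin> {u. a \<bullet> u = 0}" by (rule AE_not_in)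
  then show ?thesis by (simp add: AE_completion_iff)
qed

text \<open>The bump is even and the bounding hyperplane is null; this is the source of the factor
  one half in the solid angle formula.\<close>

lemma integral_bump_halfspace:
  fixes a :: "'a::euclidean_space"
  assumes a: "a \<noteq> 0"
  shows "(\<integral>u. indicator {u. a \<bullet> u < 0} u * bump u \<partial>lborel) = (\<integral>u. bump (u::'a) \<partial>lborel) / 2"
proof -
  have [measurable]: "{u. a \<bullet> u < 0} \<in> sets borel" "{u. 0 < a \<bullet> u} \<in> sets borel"
    by (auto intro!: borel_open open_halfspace_lt open_halfspace_gt)
  have int: "integrable lborel (\<lambda>u. indicator A u * bump u)" if "A \<in> sets borel" for A :: "'a set"
    using integrable_mult_indicator[OF _ integrable_bump, of A] that by simp
  have "(\<integral>u. indicator {u. a \<bullet> u < 0} u * bump u \<partial>lborel)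
      = \<bar>-1\<bar> ^ DIM('a) * (\<integral>u. indicator {u. a \<bullet> u < 0} (0 + (-1) *\<^sub>R u) * bump (0 + (-1) *\<^sub>R u) \<partial>lborel)"
    by (rule integral_lborel_affine) auto
  also have "\<dots> = (\<integral>u. indicator {u. 0 < a \<bullet> u} u * bump u \<partial>lborel)"
    by (simp add: bump_uminus indicator_def)
  finally have sym: "(\<integral>u. indicator {u. a \<bullet> u < 0} u * bump u \<partial>lborel) = (\<integral>u. indicator {u. 0 < a \<bullet> u} u * bump u \<partial>lborel)" .
  have "(\<integral>u. bump (u::'a) \<partial>lborel) = (\<integral>u. indicator {u. a \<bullet> u < 0} u * bump u + indicator {u. 0 < a \<bullet> u} u * bump u \<partial>lborel)"
    using AE_lborel_inner_nonzero[OF a] by (intro integral_cong_AE) (auto elim!: eventually_mono simp: indicator_def)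
  also have "\<dots> = (\<integral>u. indicator {u. a \<bullet> u < 0} u * bump u \<partial>lborel) + (\<integral>u. indicator {u. 0 < a \<bullet> u} u * bump u \<partial>lborel)"
    by (intro Bochner_Integration.integral_add int) auto
  finally show ?thesis using sym by simp
qed

section \<open>The energy inequality\<close>

text \<open>Fatou's lemma, in the form used both for the energy of a ball and for the deficit in the
  equality case.\<close>

lemma nn_integral_le_of_tendsto:
  fixes u :: "nat \<Rightarrow> 'a \<Rightarrow> ennreal"
  assumes u: "\<And>n. u n \<in> borel_measurable M" and lim: "\<And>x. x \<in> space M \<Longrightarrow> (\<lambda>n. u n x) \<longlonglongrightarrow> v x"
    and L: "(\<lambda>n. \<integral>\<^sup>+ x. u n x \<partial>M) \<longlonglongrightarrow> L"
  shows "(\<integral>\<^sup>+ x. v x \<partial>M) \<le> L"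
proof -
  have "(\<integral>\<^sup>+ x. v x \<partial>M) = (\<integral>\<^sup>+ x. liminf (\<lambda>n. u n x) \<partial>M)"
    using lim by (intro nn_integral_cong) (metis lim_imp_Liminf sequentially_bot)
  also have "\<dots> \<le> liminf (\<lambda>n. \<integral>\<^sup>+ x. u n x \<partial>M)"
    using u by (rule nn_integral_liminf)
  also have "\<dots> = L" using L by (simp add: lim_imp_Liminf)
  finally show ?thesis .
qed

context C1_domain
begin

definition energy_kernel :: "'a \<Rightarrow> 'a \<Rightarrow> real" where
  "energy_kernel x y = norm (\<nu> x - \<nu> y) / norm (x - y) ^ (DIM('a) - 1)"

definition directed_kernel :: "'a \<Rightarrow> 'a \<Rightarrow> real" where
  "directed_kernel x y = ((\<nu> x - \<nu> y) \<bullet> (x - y)) * inverse (norm (x - y)) ^ DIM('a)"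

definition reg_kernel :: "real \<Rightarrow> 'a \<Rightarrow> 'a \<Rightarrow> real" where
  "reg_kernel \<epsilon> x y = ((\<nu> x - \<nu> y) \<bullet> (x - y)) * reg \<epsilon> (x - y) ^ DIM('a)"

text \<open>With the same power as in the other two kernels, comparisons reduce to Cauchy-Schwarz
  for the first factor; on the diagonal the numerator is 0.\<close>

lemma energy_kernel_eq: "energy_kernel x y = norm (\<nu> x - \<nu> y) * norm (x - y) * inverse (norm (x - y)) ^ DIM('a)"
proof (cases "x = y")
  case False
  obtain k where "DIM('a) = Suc k" using DIM_positive[where 'a='a] by (cases "DIM('a)") auto
  with False show ?thesis by (simp add: energy_kernel_def power_inverse field_simps)
qed (simp add: energy_kernel_def)

lemma abs_reg_kernel_le:
  assumes e: "0 < \<epsilon>"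
  shows "\<bar>reg_kernel \<epsilon> x y\<bar> \<le> energy_kernel x y"
proof (cases "x = y")
  case False
  have "norm (x - y) * reg \<epsilon> (x - y) \<le> 1" using e by (rule norm_mult_reg_le)
  then have "reg \<epsilon> (x - y) \<le> inverse (norm (x - y))" using False by (simp add: field_simps)
  then have "reg \<epsilon> (x - y) ^ DIM('a) \<le> inverse (norm (x - y)) ^ DIM('a)"
    using reg_pos[OF e, of "x - y"] by (intro power_mono) auto
  then show ?thesis
    unfolding reg_kernel_def energy_kernel_eq abs_mult using reg_pos[OF e, of "x - y"]
    by (intro mult_mono Cauchy_Schwarz_ineq2) auto
qed (simp add: reg_kernel_def energy_kernel_def)

lemma reg_kernel_tendsto:
  assumes \<epsilon>: "\<epsilon> \<longlonglongrightarrow> 0"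
  shows "(\<lambda>n. reg_kernel (\<epsilon> n) x y) \<longlonglongrightarrow> directed_kernel x y"
proof (cases "x = y")
  case False
  then have "(\<lambda>n. reg (\<epsilon> n) (x - y)) \<longlonglongrightarrow> inverse (sqrt (0\<^sup>2 + (x - y) \<bullet> (x - y)))"
    unfolding reg_def by (intro tendsto_intros \<epsilon>) auto
  then have "(\<lambda>n. reg (\<epsilon> n) (x - y)) \<longlonglongrightarrow> inverse (norm (x - y))"
    by (simp add: norm_eq_sqrt_inner)
  then show ?thesis unfolding reg_kernel_def directed_kernel_def by (intro tendsto_intros)
qed (simp add: reg_kernel_def directed_kernel_def)

lemma measurable_surface_normal: "\<nu> \<in> borel_measurable \<sigma>"
  by (rule measurable_surface_continuous[OF continuous_on_normal])

lemma measurable_pair_surface: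
  "(\<lambda>p. fst p) \<in> borel_measurable (\<sigma> \<Otimes>\<^sub>M \<sigma>)" "(\<lambda>p. snd p) \<in> borel_measurable (\<sigma> \<Otimes>\<^sub>M \<sigma>)"
  "(\<lambda>p. \<nu> (fst p)) \<in> borel_measurable (\<sigma> \<Otimes>\<^sub>M \<sigma>)" "(\<lambda>p. \<nu> (snd p)) \<in> borel_measurable (\<sigma> \<Otimes>\<^sub>M \<sigma>)"
  using measurable_compose[OF measurable_fst measurable_surface_ident, of \<sigma>]
    measurable_compose[OF measurable_snd measurable_surface_ident, of \<sigma>]
    measurable_compose[OF measurable_fst measurable_surface_normal, of \<sigma>]
    measurable_compose[OF measurable_snd measurable_surface_normal, of \<sigma>]
  by simp_all

lemma measurable_kernels:
  shows "(\<lambda>p. energy_kernel (fst p) (snd p)) \<in> borel_measurable (\<sigma> \<Otimes>\<^sub>M \<sigma>)"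
    and "(\<lambda>p. reg_kernel \<epsilon> (fst p) (snd p)) \<in> borel_measurable (\<sigma> \<Otimes>\<^sub>M \<sigma>)"
    and "(\<lambda>p. directed_kernel (fst p) (snd p)) \<in> borel_measurable (\<sigma> \<Otimes>\<^sub>M \<sigma>)"
  unfolding energy_kernel_def reg_kernel_def directed_kernel_def
  using measurable_pair_surface by measurable

lemma space_pair_surface: "p \<in> space (\<sigma> \<Otimes>\<^sub>M \<sigma>) \<longleftrightarrow> fst p \<in> frontier \<Omega> \<and> snd p \<in> frontier \<Omega>"
  by (simp add: space_pair_measure mem_Times_iff)

text \<open>The regularised double layer potential of the constant density, in the form given by
  \<open>divergence_reg\<close>. As a volume integral of a nonnegative function it exhibits sign,
  uniform bound and limit.\<close>

definition potential :: "real \<Rightarrow> 'a \<Rightarrow> real" where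
  "potential \<epsilon> y = slice_constant TYPE('a) * (\<integral>u. indicator \<Omega> (y + \<epsilon> *\<^sub>R u) * bump u \<partial>lborel)"

text \<open>Since \<open>reg\<close> is even, the kernel splits as \<open>g x y + g y x\<close> with
  \<open>g\<close> the double layer kernel. For fixed \<open>\<epsilon>\<close> this is bounded on a
  finite measure space, so Fubini applies and each half integrates to the potential.\<close>

lemma integral_reg_kernel:
  assumes e: "0 < \<epsilon>"
  shows "integrable (\<sigma> \<Otimes>\<^sub>M \<sigma>) (\<lambda>p. reg_kernel \<epsilon> (fst p) (snd p))"
    and "integrable \<sigma> (potential \<epsilon>)"
    and "(\<integral>p. reg_kernel \<epsilon> (fst p) (snd p) \<partial>(\<sigma> \<Otimes>\<^sub>M \<sigma>)) = 2 * (\<integral>y. potential \<epsilon> y \<partial>\<sigma>)"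
proof -
  let ?d = "DIM('a)" and ?P = "\<sigma> \<Otimes>\<^sub>M \<sigma>"
  interpret finite_measure \<sigma> by (rule finite_measure_surface)
  interpret P: pair_sigma_finite \<sigma> \<sigma> ..
  interpret PF: finite_measure ?P by (rule finite_measure_pair_measure) unfold_locales
  define g where "g x y = (\<nu> x \<bullet> (x - y)) * reg \<epsilon> (x - y) ^ ?d" for x y
  \<comment> \<open>One factor \<open>reg\<close> absorbs the inner product through
    \<open>norm_mult_reg_le\<close>; the remaining \<open>d - 1\<close> factors are at most
    \<open>1 / \<epsilon>\<close>.\<close>
  have bound: "\<bar>(n \<bullet> z) * reg \<epsilon> z ^ ?d\<bar> \<le> inverse \<epsilon> ^ (?d - 1)" if "norm n = 1" for n z :: 'a
  proof -
    have r: "0 < reg \<epsilon> z" by (rule reg_pos[OF e])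
    have "\<bar>(n \<bullet> z) * reg \<epsilon> z ^ ?d\<bar> = \<bar>n \<bullet> z\<bar> * reg \<epsilon> z * reg \<epsilon> z ^ (?d - 1)"
    proof -
      obtain k where "?d = Suc k" using DIM_positive[where 'a='a] by (cases ?d) auto
      then show ?thesis using r by (simp add: abs_mult)
    qed
    also have "\<dots> \<le> 1 * inverse \<epsilon> ^ (?d - 1)"
    proof (intro mult_mono power_mono)
      have "\<bar>n \<bullet> z\<bar> \<le> norm z" using Cauchy_Schwarz_ineq2[of n z] that by simp
      then have "\<bar>n \<bullet> z\<bar> * reg \<epsilon> z \<le> norm z * reg \<epsilon> z" using r by (intro mult_right_mono) auto
      then show "\<bar>n \<bullet> z\<bar> * reg \<epsilon> z \<le> 1" using norm_mult_reg_le[OF e, of z] by linarith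
    qed (use r reg_le_inverse[OF e, of z] e in auto)
    finally show ?thesis by simp
  qed
  have m: "(\<lambda>p. g (fst p) (snd p)) \<in> borel_measurable ?P" "(\<lambda>p. g (snd p) (fst p)) \<in> borel_measurable ?P"
    unfolding g_def using measurable_pair_surface by measurable
  have i1: "integrable ?P (\<lambda>p. g (fst p) (snd p))"
  proof (rule PF.integrable_const_bound[where B = "inverse \<epsilon> ^ (?d - 1)"])
    show "AE p in ?P. norm (g (fst p) (snd p)) \<le> inverse \<epsilon> ^ (?d - 1)"
      using bound norm_normal by (intro AE_I2) (auto simp: space_pair_measure g_def)
  qed (rule m)
  have i2: "integrable ?P (\<lambda>p. g (snd p) (fst p))"
  proof (rule PF.integrable_const_bound[where B = "inverse \<epsilon> ^ (?d - 1)"])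
    show "AE p in ?P. norm (g (snd p) (fst p)) \<le> inverse \<epsilon> ^ (?d - 1)"
      using bound norm_normal by (intro AE_I2) (auto simp: space_pair_measure g_def)
  qed (rule m)
  have k: "reg_kernel \<epsilon> x y = g x y + g y x" for x y
  proof -
    have "reg \<epsilon> (y - x) = reg \<epsilon> (x - y)"
      by (simp add: reg_def inner_diff_left inner_diff_right inner_commute)
    then show ?thesis by (simp add: reg_kernel_def g_def inner_diff_left inner_diff_right algebra_simps)
  qed
  have pot: "(\<integral>x. g x y \<partial>\<sigma>) = potential \<epsilon> y" for y
    unfolding g_def potential_def by (rule divergence_reg[OF e])
  show "integrable ?P (\<lambda>p. reg_kernel \<epsilon> (fst p) (snd p))"
    unfolding k using i1 i2 by (rule Bochner_Integration.integrable_add)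
  have i1': "integrable ?P (case_prod g)" and i2': "integrable ?P (case_prod (\<lambda>x y. g y x))"
    using i1 i2 by (simp_all add: case_prod_beta')
  have 1: "(\<integral>p. g (fst p) (snd p) \<partial>?P) = (\<integral>y. potential \<epsilon> y \<partial>\<sigma>)"
    using P.integral_snd[OF i1'] by (simp add: pot case_prod_beta')
  show "integrable \<sigma> (potential \<epsilon>)"
    using P.integrable_snd[OF i1'] by (simp add: pot)
  have 2: "(\<integral>p. g (snd p) (fst p) \<partial>?P) = (\<integral>y. potential \<epsilon> y \<partial>\<sigma>)"
    using P.integral_fst'[OF i2'] by (simp add: pot case_prod_beta')
  show "(\<integral>p. reg_kernel \<epsilon> (fst p) (snd p) \<partial>?P) = 2 * (\<integral>y. potential \<epsilon> y \<partial>\<sigma>)"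
    unfolding k using i1 i2 1 2 by simp
qed

lemma potential_nonneg: "0 \<le> potential \<epsilon> y"
  unfolding potential_def using slice_constant_pos[where 'a='a]
  by (intro mult_nonneg_nonneg Bochner_Integration.integral_nonneg) (auto simp: bump_nonneg)

lemma integrable_indicator_bump:
  "integrable lborel (\<lambda>u. indicator \<Omega> (y + \<epsilon> *\<^sub>R u) * bump u)"
proof -
  have "(\<lambda>u. y + \<epsilon> *\<^sub>R u) -` \<Omega> \<in> sets borel"
    using open_dom by (intro borel_open open_vimage continuous_intros) auto
  then have "integrable lborel (\<lambda>u. indicator ((\<lambda>u. y + \<epsilon> *\<^sub>R u) -` \<Omega>) u *\<^sub>R bump u)"
    by (intro integrable_mult_indicator integrable_bump) simp
  then show ?thesis by (simp add: indicator_def)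
qed

lemma potential_le: "potential \<epsilon> y \<le> sphere_area TYPE('a)"
proof -
  have "(\<integral>u. indicator \<Omega> (y + \<epsilon> *\<^sub>R u) * bump u \<partial>lborel) \<le> (\<integral>u. bump (u::'a) \<partial>lborel)"
    by (intro Bochner_Integration.integral_mono integrable_bump integrable_indicator_bump)
      (auto simp: indicator_def bump_nonneg)
  then show ?thesis
    unfolding potential_def integral_bump[symmetric] using slice_constant_pos[where 'a='a]
    by (intro mult_left_mono) auto
qed

text \<open>Gauss' solid angle formula at a boundary point: the rescaled domains tend to a half
  space off a null hyperplane, and the bump dominates.\<close>

lemma potential_tendsto:
  assumes \<epsilon>: "\<epsilon> \<longlonglongrightarrow> 0" "\<And>n. 0 < \<epsilon> n" and y: "y \<in> frontier \<Omega>"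
  shows "(\<lambda>n. potential (\<epsilon> n) y) \<longlonglongrightarrow> sphere_area TYPE('a) / 2"
proof -
  have \<nu>0: "\<nu> y \<noteq> 0" using norm_normal[OF y] by auto
  have [measurable]: "{u. \<nu> y \<bullet> u < 0} \<in> sets borel"
    by (intro borel_open open_halfspace_lt)
  have "(\<lambda>n. \<integral>u. indicator \<Omega> (y + \<epsilon> n *\<^sub>R u) * bump u \<partial>lborel)
      \<longlonglongrightarrow> (\<integral>u. indicator {u. \<nu> y \<bullet> u < 0} u * bump u \<partial>lborel)"
  proof (rule integral_dominated_convergence[where w = bump])
    show "AE u in lborel. (\<lambda>n. indicator \<Omega> (y + \<epsilon> n *\<^sub>R u) * bump u) \<longlonglongrightarrow> indicator {u. \<nu> y \<bullet> u < 0} u * bump u"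
      using AE_lborel_inner_nonzero[OF \<nu>0]
    proof eventually_elim
      fix u assume u: "\<nu> y \<bullet> u \<noteq> 0"
      obtain \<tau> where \<tau>: "0 < \<tau>" "\<And>t. 0 < t \<Longrightarrow> t < \<tau> \<Longrightarrow> y + t *\<^sub>R u \<in> \<Omega> \<longleftrightarrow> \<nu> y \<bullet> u < 0"
      proof (cases "\<nu> y \<bullet> u < 0")
        case True
        then show ?thesis using normal_sides(1)[OF y True] that by auto
      next
        case False
        then have pos: "0 < \<nu> y \<bullet> u" using u by simp
        show ?thesis using normal_sides(2)[OF y pos] that False by auto
      qed
      have "\<forall>\<^sub>F n in sequentially. \<epsilon> n < \<tau>" using \<epsilon>(1) \<tau>(1) by (rule order_tendstoD)
      then have "\<forall>\<^sub>F n in sequentially. indicator \<Omega> (y + \<epsilon> n *\<^sub>R u) * bump u = indicator {u. \<nu> y \<bullet> u < 0} u * bump u"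
        by eventually_elim (use \<tau>(2)[OF \<epsilon>(2)] in \<open>auto simp: indicator_def\<close>)
      then show "(\<lambda>n. indicator \<Omega> (y + \<epsilon> n *\<^sub>R u) * bump u) \<longlonglongrightarrow> indicator {u. \<nu> y \<bullet> u < 0} u * bump u"
        by (rule tendsto_eventually)
    qed
    show "(\<lambda>u. indicator \<Omega> (y + \<epsilon> n *\<^sub>R u) * bump u) \<in> borel_measurable lborel" for n
      using integrable_indicator_bump by (rule borel_measurable_integrable)
    show "AE u in lborel. norm (indicator \<Omega> (y + \<epsilon> n *\<^sub>R u) * bump u) \<le> bump u" for n
      using bump_nonneg by (intro AE_I2) (auto simp: indicator_def)
  qed (auto intro: integrable_bump)
  then have "(\<lambda>n. potential (\<epsilon> n) y) \<longlonglongrightarrow> slice_constant TYPE('a) * ((\<integral>u. bump (u::'a) \<partial>lborel) / 2)"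
    unfolding potential_def integral_bump_halfspace[OF \<nu>0] by (intro tendsto_intros)
  then show ?thesis by (simp add: integral_bump)
qed

definition sharp_value :: real where
  "sharp_value = measure \<sigma> (frontier \<Omega>) * sphere_area TYPE('a)"

lemma integral_reg_kernel_tendsto:
  assumes \<epsilon>: "\<epsilon> \<longlonglongrightarrow> 0" "\<And>n. 0 < \<epsilon> n"
  shows "(\<lambda>n. \<integral>p. reg_kernel (\<epsilon> n) (fst p) (snd p) \<partial>(\<sigma> \<Otimes>\<^sub>M \<sigma>)) \<longlonglongrightarrow> sharp_value"
proof -
  interpret finite_measure \<sigma> by (rule finite_measure_surface)
  have "(\<lambda>n. \<integral>y. potential (\<epsilon> n) y \<partial>\<sigma>) \<longlonglongrightarrow> (\<integral>y. sphere_area TYPE('a) / 2 \<partial>\<sigma>)"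
  proof (rule integral_dominated_convergence[where w = "\<lambda>_. sphere_area TYPE('a)"])
    show "potential (\<epsilon> n) \<in> borel_measurable \<sigma>" for n
      using integral_reg_kernel(2)[OF \<epsilon>(2)] by (rule borel_measurable_integrable)
    show "AE y in \<sigma>. norm (potential (\<epsilon> n) y) \<le> sphere_area TYPE('a)" for n
      using potential_nonneg potential_le by (intro AE_I2) (simp add: abs_of_nonneg)
    show "AE y in \<sigma>. (\<lambda>n. potential (\<epsilon> n) y) \<longlonglongrightarrow> sphere_area TYPE('a) / 2"
      using potential_tendsto[OF \<epsilon>] by (intro AE_I2) simp
  qed auto
  then have "(\<lambda>n. 2 * (\<integral>y. potential (\<epsilon> n) y \<partial>\<sigma>)) \<longlonglongrightarrow> 2 * (\<integral>y. sphere_area TYPE('a) / 2 \<partial>\<sigma>)"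
    by (intro tendsto_intros)
  then show ?thesis
    by (simp add: integral_reg_kernel(3)[OF \<epsilon>(2)] sharp_value_def)
qed

definition energy :: ennreal where
  "energy = (\<integral>\<^sup>+ y. (\<integral>\<^sup>+ x. ennreal (energy_kernel x y) \<partial>\<sigma>) \<partial>\<sigma>)"

lemma energy_eq: "energy = (\<integral>\<^sup>+ p. ennreal (energy_kernel (fst p) (snd p)) \<partial>(\<sigma> \<Otimes>\<^sub>M \<sigma>))"
proof -
  interpret finite_measure \<sigma> by (rule finite_measure_surface)
  interpret P: pair_sigma_finite \<sigma> \<sigma> ..
  have "(\<lambda>p. ennreal (energy_kernel (fst p) (snd p))) \<in> borel_measurable (\<sigma> \<Otimes>\<^sub>M \<sigma>)"
    using measurable_kernels(1) by measurable
  from P.nn_integral_snd[OF this] show ?thesis by (simp add: energy_def)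
qed

definition eps :: "nat \<Rightarrow> real" where "eps n = inverse (real (Suc n))"

lemma eps: "eps \<longlonglongrightarrow> 0" "0 < eps n"
  unfolding eps_def by (rule LIMSEQ_inverse_real_of_nat) simp

text \<open>For every fixed \<open>\<epsilon>\<close> the integral of the regularised kernel is at
  most that of its absolute value, hence at most the energy, be it finite or infinite. Only a
  sequence of real numbers passes to the limit.\<close>

lemma sharp_value_le_energy: "ennreal sharp_value \<le> energy"
proof (rule LIMSEQ_le_const2)
  show "(\<lambda>n. ennreal (\<integral>p. reg_kernel (eps n) (fst p) (snd p) \<partial>(\<sigma> \<Otimes>\<^sub>M \<sigma>))) \<longlonglongrightarrow> ennreal sharp_value"
    by (intro tendsto_ennrealI integral_reg_kernel_tendsto eps)
  have "ennreal (\<integral>p. reg_kernel (eps n) (fst p) (snd p) \<partial>(\<sigma> \<Otimes>\<^sub>M \<sigma>)) \<le> energy" for n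
  proof -
    have "ennreal (\<integral>p. reg_kernel (eps n) (fst p) (snd p) \<partial>(\<sigma> \<Otimes>\<^sub>M \<sigma>))
        \<le> ennreal (norm (\<integral>p. reg_kernel (eps n) (fst p) (snd p) \<partial>(\<sigma> \<Otimes>\<^sub>M \<sigma>)))"
      by (intro ennreal_leI) simp
    also have "\<dots> \<le> (\<integral>\<^sup>+ p. norm (reg_kernel (eps n) (fst p) (snd p)) \<partial>(\<sigma> \<Otimes>\<^sub>M \<sigma>))"
      by (rule integral_norm_bound_ennreal[OF integral_reg_kernel(1)[OF eps(2)]])
    also have "\<dots> \<le> energy"
      unfolding energy_eq using abs_reg_kernel_le[OF eps(2)] by (intro nn_integral_mono ennreal_leI) simp
    finally show ?thesis .
  qed
  then show "\<exists>N. \<forall>n\<ge>N. ennreal (\<integral>p. reg_kernel (eps n) (fst p) (snd p) \<partial>(\<sigma> \<Otimes>\<^sub>M \<sigma>)) \<le> energy" by blast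
qed

text \<open>Equality in Cauchy-Schwarz makes the regularised kernels nonnegative with the energy
  kernel as their limit, so Fatou bounds the energy by the limit of their integrals.\<close>

lemma energy_le_sharp_value:
  assumes par: "\<And>x y. x \<in> frontier \<Omega> \<Longrightarrow> y \<in> frontier \<Omega> \<Longrightarrow>
    (\<nu> x - \<nu> y) \<bullet> (x - y) = norm (\<nu> x - \<nu> y) * norm (x - y)"
  shows "energy \<le> ennreal sharp_value"
  unfolding energy_eq
proof (rule nn_integral_le_of_tendsto[where u = "\<lambda>n p. ennreal (reg_kernel (eps n) (fst p) (snd p))"])
  show "(\<lambda>p. ennreal (reg_kernel (eps n) (fst p) (snd p))) \<in> borel_measurable (\<sigma> \<Otimes>\<^sub>M \<sigma>)" for n
    using measurable_kernels(2) by measurable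
  fix p assume "p \<in> space (\<sigma> \<Otimes>\<^sub>M \<sigma>)"
  then have p: "fst p \<in> frontier \<Omega>" "snd p \<in> frontier \<Omega>" by (simp_all add: space_pair_surface)
  have "directed_kernel (fst p) (snd p) = energy_kernel (fst p) (snd p)"
    unfolding directed_kernel_def energy_kernel_eq par[OF p] ..
  then show "(\<lambda>n. ennreal (reg_kernel (eps n) (fst p) (snd p))) \<longlonglongrightarrow> ennreal (energy_kernel (fst p) (snd p))"
    using reg_kernel_tendsto[OF eps(1), of "fst p" "snd p"] by (intro tendsto_ennrealI) simp
next
  have "(\<integral>\<^sup>+ p. ennreal (reg_kernel (eps n) (fst p) (snd p)) \<partial>(\<sigma> \<Otimes>\<^sub>M \<sigma>))
      = ennreal (\<integral>p. reg_kernel (eps n) (fst p) (snd p) \<partial>(\<sigma> \<Otimes>\<^sub>M \<sigma>))" for n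
  proof (rule nn_integral_eq_integral[OF integral_reg_kernel(1)[OF eps(2)]])
    show "AE p in \<sigma> \<Otimes>\<^sub>M \<sigma>. 0 \<le> reg_kernel (eps n) (fst p) (snd p)"
      using par by (intro AE_I2)
        (auto simp: reg_kernel_def space_pair_surface intro!: mult_nonneg_nonneg zero_le_power less_imp_le[OF reg_pos] eps(2))
  qed
  then show "(\<lambda>n. \<integral>\<^sup>+ p. ennreal (reg_kernel (eps n) (fst p) (snd p)) \<partial>(\<sigma> \<Otimes>\<^sub>M \<sigma>)) \<longlonglongrightarrow> ennreal sharp_value"
    using tendsto_ennrealI[OF integral_reg_kernel_tendsto[OF eps]] by simp
qed

lemma sharp_value_nonneg: "0 \<le> sharp_value"
  by (simp add: sharp_value_def sphere_area_def)

lemma emeasure_surface_ball_pos: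
  assumes q: "q \<in> frontier \<Omega>" and s: "0 < s"
  shows "0 < emeasure \<sigma> (ball q s \<inter> frontier \<Omega>)"
proof -
  obtain r e \<Phi> G where r: "0 < r" "norm e = 1"
    "\<And>u. norm (u - e) \<le> 1/2 \<Longrightarrow> transversal_patch \<Omega> q r \<Phi> G (u /\<^sub>R norm u)"
    using cone_patch[OF frontier_subset_closure[OF q]] by metis
  interpret T: transversal_patch \<Omega> q r \<Phi> G "e /\<^sub>R norm e" by (rule r(3)) simp
  have "q \<in> T.sheet" using q r(1) by (simp add: T.sheet_def)
  then show ?thesis
    using T.hausdorff_outer_sheet_pos[OF _ s] emeasure_surface[of "ball q s"]
    by (simp add: Int_commute)
qed

text \<open>The gap between the energy kernel and the regularised kernel is nonnegative and its
  integral tends to 0. Fatou gives equality in Cauchy-Schwarz for almost all pairs, and a failure at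
  one pair would spread by continuity to a product of boundary balls of positive measure.\<close>

lemma parallel_of_energy_eq:
  assumes eq: "energy = ennreal sharp_value" and x0: "x0 \<in> frontier \<Omega>" and y0: "y0 \<in> frontier \<Omega>"
  shows "(\<nu> x0 - \<nu> y0) \<bullet> (x0 - y0) = norm (\<nu> x0 - \<nu> y0) * norm (x0 - y0)"
proof (rule ccontr)
  assume ne: "\<not> ?thesis"
  let ?P = "\<sigma> \<Otimes>\<^sub>M \<sigma>"
  interpret finite_measure \<sigma> by (rule finite_measure_surface)
  let ?k = "\<lambda>p. energy_kernel (fst p) (snd p)" and ?r = "\<lambda>n p. reg_kernel (eps n) (fst p) (snd p)"
    and ?d = "\<lambda>p. directed_kernel (fst p) (snd p)"
  have k_nonneg: "0 \<le> energy_kernel x y" for x y by (simp add: energy_kernel_def)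
  have nnk: "(\<integral>\<^sup>+ p. ennreal (?k p) \<partial>?P) = ennreal sharp_value" using eq by (simp add: energy_eq)
  \<comment> \<open>The assumed equality supplies finite energy, which is what permits subtracting
    integrals.\<close>
  have intk: "integrable ?P ?k"
    using measurable_kernels(1) nnk k_nonneg by (intro integrableI_nonneg) auto
  then have "ennreal (\<integral>p. ?k p \<partial>?P) = ennreal sharp_value"
    using nn_integral_eq_integral[OF intk] nnk k_nonneg by simp
  then have Ik: "(\<integral>p. ?k p \<partial>?P) = sharp_value"
    using sharp_value_nonneg k_nonneg by (subst (asm) ennreal_inj) (auto intro!: Bochner_Integration.integral_nonneg)
  have "(\<integral>\<^sup>+ p. ennreal (?k p - ?d p) \<partial>?P) \<le> ennreal 0"
  proof (rule nn_integral_le_of_tendsto[where u = "\<lambda>n p. ennreal (?k p - ?r n p)"])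
    show "(\<lambda>p. ennreal (?k p - ?r n p)) \<in> borel_measurable ?P" for n
      using measurable_kernels by measurable
    show "(\<lambda>n. ennreal (?k p - ?r n p)) \<longlonglongrightarrow> ennreal (?k p - ?d p)" for p
      by (intro tendsto_ennrealI tendsto_diff tendsto_const reg_kernel_tendsto eps)
    have "(\<integral>\<^sup>+ p. ennreal (?k p - ?r n p) \<partial>?P) = ennreal (sharp_value - (\<integral>p. ?r n p \<partial>?P))" for n
    proof -
      have ir: "integrable ?P (?r n)" by (rule integral_reg_kernel(1)[OF eps(2)])
      have "0 \<le> ?k p - ?r n p" for p
        using abs_reg_kernel_le[OF eps(2)[of n], of "fst p" "snd p"] by (simp add: abs_le_iff)
      then have "(\<integral>\<^sup>+ p. ennreal (?k p - ?r n p) \<partial>?P) = ennreal (\<integral>p. ?k p - ?r n p \<partial>?P)"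
        using intk ir by (intro nn_integral_eq_integral) auto
      then show ?thesis using intk ir Ik by simp
    qed
    moreover have "(\<lambda>n. ennreal (sharp_value - (\<integral>p. ?r n p \<partial>?P))) \<longlonglongrightarrow> ennreal (sharp_value - sharp_value)"
      by (intro tendsto_ennrealI tendsto_diff tendsto_const integral_reg_kernel_tendsto eps)
    ultimately show "(\<lambda>n. \<integral>\<^sup>+ p. ennreal (?k p - ?r n p) \<partial>?P) \<longlonglongrightarrow> ennreal 0" by simp
  qed
  then have "(\<integral>\<^sup>+ p. ennreal (?k p - ?d p) \<partial>?P) = 0" by simp
  moreover have "(\<lambda>p. ennreal (?k p - ?d p)) \<in> borel_measurable ?P"
    using measurable_kernels by measurable
  ultimately have AE: "AE p in ?P. ennreal (?k p - ?d p) = 0"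
    by (simp add: nn_integral_0_iff_AE)
  \<comment> \<open>The Cauchy-Schwarz defect without the singular power, so that it is continuous
    across the diagonal as well.\<close>
  define c where "c p = norm (\<nu> (fst p) - \<nu> (snd p)) * norm (fst p - snd p) - (\<nu> (fst p) - \<nu> (snd p)) \<bullet> (fst p - snd p)" for p
  have c_nonneg: "0 \<le> c p" for p by (simp add: c_def norm_cauchy_schwarz)
  have kd: "?k p - ?d p = c p * inverse (norm (fst p - snd p)) ^ DIM('a)" for p
    by (simp add: energy_kernel_eq directed_kernel_def c_def left_diff_distrib)
  have c0: "c p = 0" if "ennreal (?k p - ?d p) = 0" for p
  proof (cases "fst p = snd p")
    case False
    have "c p * inverse (norm (fst p - snd p)) ^ DIM('a) \<le> 0" using that unfolding kd by (simp add: ennreal_eq_0_iff)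
    moreover have "0 < inverse (norm (fst p - snd p)) ^ DIM('a)" using False by simp
    ultimately show ?thesis using c_nonneg[of p] by (simp add: mult_le_0_iff not_le)
  qed (simp add: c_def)
  have "AE p in ?P. c p = 0" using AE by eventually_elim (rule c0)
  then have AEn: "AE p in ?P. \<not> c p \<noteq> 0" by simp
  have comps: "continuous_on (frontier \<Omega> \<times> frontier \<Omega>) (\<lambda>p. \<nu> (fst p))"
      "continuous_on (frontier \<Omega> \<times> frontier \<Omega>) (\<lambda>p. \<nu> (snd p))"
    by (rule continuous_on_compose2[OF continuous_on_normal]; auto intro!: continuous_intros)+
  have "continuous_on (frontier \<Omega> \<times> frontier \<Omega>) c"
    unfolding c_def by (intro continuous_intros comps)
  moreover have "0 < c (x0, y0)" using ne c_nonneg[of "(x0, y0)"] by (auto simp: c_def)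
  ultimately obtain \<delta> where \<delta>: "0 < \<delta>"
    "\<And>p. p \<in> frontier \<Omega> \<times> frontier \<Omega> \<Longrightarrow> dist p (x0, y0) < \<delta> \<Longrightarrow> dist (c p) (c (x0, y0)) < c (x0, y0)"
    using x0 y0 unfolding continuous_on_iff by (metis mem_Sigma_iff)
  define A where "A = ball x0 (\<delta> / 2) \<inter> frontier \<Omega>"
  define B where "B = ball y0 (\<delta> / 2) \<inter> frontier \<Omega>"
  have AB: "A \<in> sets \<sigma>" "B \<in> sets \<sigma>"
    by (auto simp: A_def B_def sets_surface sets_restrict_space)
  have "c p \<noteq> 0" if "p \<in> A \<times> B" for p
  proof -
    have "dist p (x0, y0) \<le> dist (fst p) x0 + dist (snd p) y0"
      by (cases p) (simp add: dist_Pair_Pair sqrt_sum_squares_le_sum)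
    also have "\<dots> < \<delta>" using that by (auto simp: A_def B_def dist_commute)
    finally have "dist (c p) (c (x0, y0)) < c (x0, y0)"
      using \<delta>(2) that by (auto simp: A_def B_def)
    then show ?thesis by auto
  qed
  then have "AE p in ?P. p \<notin> A \<times> B" using AEn by (auto elim: eventually_mono)
  then have "emeasure ?P (A \<times> B) = 0"
    using AB by (subst (asm) AE_iff_measurable[where N = "A \<times> B"]) (auto simp: space_pair_measure A_def B_def)
  then have "emeasure \<sigma> A = 0 \<or> emeasure \<sigma> B = 0"
    unfolding emeasure_pair_measure_Times[OF AB] by simp
  moreover have "emeasure \<sigma> A \<noteq> 0" "emeasure \<sigma> B \<noteq> 0"
    unfolding A_def B_def
    using emeasure_surface_ball_pos[OF x0, of "\<delta> / 2"] emeasure_surface_ball_pos[OF y0, of "\<delta> / 2"] \<delta>(1)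
    by (auto simp: less_imp_neq[symmetric])
  ultimately show False by simp
qed

end

section \<open>Rigidity\<close>

text \<open>Connected sets disjoint from the frontier lie on one side of it. The exterior of the
  ball is connected in dimension at least 2 and unbounded, so it misses the bounded set; the ball is
  connected and meets the set, so it is filled.\<close>

lemma open_subset_cball_frontier_sphere:
  fixes z :: "'a::euclidean_space"
  assumes dim: "2 \<le> DIM('a)" and "open \<Omega>" "bounded \<Omega>" "\<Omega> \<noteq> {}" and fr: "frontier \<Omega> \<subseteq> sphere z \<rho>"
  shows "\<Omega> = ball z \<rho>"
proof -
  have "\<not> bounded (- cball z \<rho>)" by (intro cobounded_imp_unbounded) simp
  then have "- cball z \<rho> - \<Omega> \<noteq> {}" using \<open>bounded \<Omega>\<close> by (metis Diff_eq_empty_iff bounded_subset)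
  moreover have "connected (- cball z \<rho>)"
    using dim by (intro connected_complement_bounded_convex) auto
  moreover have "- cball z \<rho> \<inter> frontier \<Omega> = {}" using fr by auto
  ultimately have "- cball z \<rho> \<inter> \<Omega> = {}" using connected_Int_frontier by blast
  then have "\<Omega> \<subseteq> interior (cball z \<rho>)" using \<open>open \<Omega>\<close> by (intro interior_maximal) auto
  then have sub: "\<Omega> \<subseteq> ball z \<rho>" by simp
  have "ball z \<rho> \<inter> frontier \<Omega> = {}" using fr by auto
  then have "ball z \<rho> - \<Omega> = {}"
    using connected_Int_frontier[of "ball z \<rho>" \<Omega>] sub \<open>\<Omega> \<noteq> {}\<close> by blast
  with sub show ?thesis by blast
qed

context C1_domain
begin

text \<open>An open set does not fit into a line. From a point of it off the given line, the ray
  parallel to that line reaches the frontier without ever meeting the line.\<close>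

lemma frontier_point_off_line:
  assumes dim: "2 \<le> DIM('a)" and ne: "\<Omega> \<noteq> {}" and w: "w \<noteq> 0"
  shows "\<exists>d\<in>frontier \<Omega>. \<forall>s. d \<noteq> a + s *\<^sub>R w"
proof -
  have "\<exists>p\<in>\<Omega>. \<forall>s. p \<noteq> a + s *\<^sub>R w"
  proof (rule ccontr)
    assume "\<not> ?thesis"
    then have all: "\<exists>s. p = a + s *\<^sub>R w" if "p \<in> \<Omega>" for p using that by blast
    obtain p where p: "p \<in> \<Omega>" using ne by blast
    obtain u where u: "u \<noteq> 0" "orthogonal w u" using orthogonal_to_vector_exists[OF dim] by blast
    obtain r where r: "0 < r" "ball p r \<subseteq> \<Omega>" using p open_dom by (metis open_contains_ball)
    define q where "q = p + (r / (2 * norm u)) *\<^sub>R u"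
    have "dist p q = r / 2" using u r by (simp add: q_def dist_norm)
    then have "q \<in> \<Omega>" using r by auto
    then obtain s s' where s: "q = a + s *\<^sub>R w" "p = a + s' *\<^sub>R w" using all p by meson
    have "u \<bullet> (q - p) = u \<bullet> ((s - s') *\<^sub>R w)" unfolding s by (simp add: algebra_simps)
    also have "\<dots> = 0" using u(2) by (simp add: orthogonal_def inner_commute)
    finally have "u \<bullet> (q - p) = 0" .
    moreover have "q - p = (r / (2 * norm u)) *\<^sub>R u" by (simp add: q_def)
    ultimately show False using u r by simp
  qed
  then obtain p where p: "p \<in> \<Omega>" "\<And>s. p \<noteq> a + s *\<^sub>R w" by blast
  obtain d where d: "p + d *\<^sub>R w \<in> frontier \<Omega>"
    using ray_to_frontier[OF bounded_dom _ w, of p] p(1) open_dom by (auto simp: interior_open)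
  have "p + d *\<^sub>R w \<noteq> a + s *\<^sub>R w" for s
  proof
    assume "p + d *\<^sub>R w = a + s *\<^sub>R w"
    then have "p = a + (s - d) *\<^sub>R w" by (simp add: algebra_simps)
    with p(2) show False by blast
  qed
  with d show ?thesis by blast
qed

text \<open>Moving from an interior point in direction \<open>- n\<close>, the first boundary point
  has the segment just travelled in direction \<open>n\<close> behind it, yet \<open>n\<close> is
  its outward normal.\<close>

lemma normal_not_constant:
  assumes ne: "\<Omega> \<noteq> {}" and const: "\<And>x. x \<in> frontier \<Omega> \<Longrightarrow> \<nu> x = n"
  shows False
proof -
  obtain b :: 'a where b: "b \<in> Basis" using nonempty_Basis by blast
  obtain p where p: "p \<in> \<Omega>" using ne by blast
  then have pi: "p \<in> interior \<Omega>" using open_dom by (simp add: interior_open)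
  obtain d0 where "p + d0 *\<^sub>R b \<in> frontier \<Omega>"
    using ray_to_frontier[OF bounded_dom pi, of b] b nonzero_Basis by metis
  then have n: "norm n = 1" using const norm_normal by metis
  then have "- n \<noteq> 0" by auto
  then obtain d where d: "0 < d" "p + d *\<^sub>R - n \<in> frontier \<Omega>" "\<And>e. 0 \<le> e \<Longrightarrow> e < d \<Longrightarrow> p + e *\<^sub>R - n \<in> interior \<Omega>"
    using ray_to_frontier[OF bounded_dom pi] by metis
  have "0 < \<nu> (p + d *\<^sub>R - n) \<bullet> n" using const[OF d(2)] n by (simp add: norm_eq_1)
  then obtain \<tau> where \<tau>: "0 < \<tau>" "\<And>t. t \<in> {0<..<\<tau>} \<Longrightarrow> p + d *\<^sub>R - n + t *\<^sub>R n \<notin> \<Omega>"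
    using normal_sides(2)[OF d(2)] by blast
  define t where "t = min \<tau> d / 2"
  have t: "t \<in> {0<..<\<tau>}" "0 \<le> d - t" "d - t < d" using \<tau>(1) d(1) by (auto simp: t_def min_def)
  have shift: "p + d *\<^sub>R - n + t *\<^sub>R n = p + (d - t) *\<^sub>R - n" by (simp add: algebra_simps)
  have "p + (d - t) *\<^sub>R - n \<in> \<Omega>" using d(3)[OF t(2,3)] interior_subset by blast
  then show False using \<tau>(2)[OF t(1)] unfolding shift by blast
qed

text \<open>
  On three non-collinear boundary points the proportionality factors of \<open>\<nu> x - \<nu> y\<close> and \<open>x - y\<close>
  agree, so the factor is global and \<open>\<nu>\<close> is an affine map of homothety type.
\<close>

lemma ball_of_parallel:
  assumes dim: "2 \<le> DIM('a)" and ne: "\<Omega> \<noteq> {}"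
    and par: "\<And>x y. x \<in> frontier \<Omega> \<Longrightarrow> y \<in> frontier \<Omega> \<Longrightarrow>
      (\<nu> x - \<nu> y) \<bullet> (x - y) = norm (\<nu> x - \<nu> y) * norm (x - y)"
  shows "\<exists>z \<rho>. 0 < \<rho> \<and> \<Omega> = ball z \<rho>"
proof -
  let ?S = "frontier \<Omega>"
  define l where "l x y = norm (\<nu> x - \<nu> y) / norm (x - y)" for x y
  have l_sym: "l x y = l y x" for x y by (simp add: l_def norm_minus_commute)
  have l: "\<nu> x - \<nu> y = l x y *\<^sub>R (x - y)" if "x \<in> ?S" "y \<in> ?S" for x y
  proof (cases "x = y")
    case False
    have "norm (\<nu> x - \<nu> y) *\<^sub>R (x - y) = norm (x - y) *\<^sub>R (\<nu> x - \<nu> y)"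
      using par[OF that] by (simp add: norm_cauchy_schwarz_eq)
    then have "(1 / norm (x - y)) *\<^sub>R (norm (\<nu> x - \<nu> y) *\<^sub>R (x - y)) = \<nu> x - \<nu> y"
      using False by simp
    then show ?thesis by (simp add: l_def)
  qed simp
  have triple: "l a c = l a b" if S: "a \<in> ?S" "b \<in> ?S" "c \<in> ?S" and ab: "a \<noteq> b"
    and off: "\<And>s. c \<noteq> a + s *\<^sub>R (b - a)" for a b c
  proof (rule ccontr)
    assume neq: "l a c \<noteq> l a b"
    \<comment> \<open>The differences of \<open>\<nu>\<close> around the triangle add up to 0, which
      is a linear relation between \<open>b - a\<close> and \<open>c - a\<close>.\<close>
    have "l a b *\<^sub>R (b - a) + l b c *\<^sub>R (c - b) - l a c *\<^sub>R (c - a) = 0"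
      unfolding l_sym[of a b] l_sym[of b c] l_sym[of a c] l[OF S(2,1), symmetric] l[OF S(3,2), symmetric]
        l[OF S(3,1), symmetric] by simp
    moreover have "l a b *\<^sub>R (b - a) + l b c *\<^sub>R (c - b) - l a c *\<^sub>R (c - a)
        = (l a b - l b c) *\<^sub>R (b - a) + (l b c - l a c) *\<^sub>R (c - a)"
      by (simp add: algebra_simps)
    ultimately have e: "(l a c - l b c) *\<^sub>R (c - a) = (l a b - l b c) *\<^sub>R (b - a)"
      by (simp add: algebra_simps)
    show False
    proof (cases "l a c = l b c")
      case True
      then have "(l a b - l b c) *\<^sub>R (b - a) = 0" using e by simp
      then show False using ab neq True by simp
    next
      case False
      then have "c - a = (1 / (l a c - l b c)) *\<^sub>R ((l a c - l b c) *\<^sub>R (c - a))" by simp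
      also have "\<dots> = ((l a b - l b c) / (l a c - l b c)) *\<^sub>R (b - a)" unfolding e by simp
      finally have "c = a + ((l a b - l b c) / (l a c - l b c)) *\<^sub>R (b - a)"
        by (metis add.commute diff_add_cancel)
      with off show False by blast
    qed
  qed
  obtain p where p: "p \<in> \<Omega>" using ne by blast
  then have pi: "p \<in> interior \<Omega>" using open_dom by (simp add: interior_open)
  obtain e :: 'a where e: "e \<in> Basis" using nonempty_Basis by blast
  then have e0: "e \<noteq> 0" by auto
  obtain d where "p + d *\<^sub>R e \<in> ?S" using ray_to_frontier[OF bounded_dom pi e0] by metis
  then obtain a where a: "a \<in> ?S" by blast
  obtain b where b: "b \<in> ?S" "\<And>s. b \<noteq> a + s *\<^sub>R e" using frontier_point_off_line[OF dim ne e0] by blast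
  have ab: "a \<noteq> b" using b(2)[of 0] by simp
  define m where "m = l a b"
  have global: "\<nu> c - \<nu> a = m *\<^sub>R (c - a)" if c: "c \<in> ?S" for c
  proof (cases "c = a")
    case ca: False
    have "l a c = m"
    proof (cases "\<exists>s. c = a + s *\<^sub>R (b - a)")
      case False
      then show ?thesis unfolding m_def using ab by (intro triple[OF a b(1) c]) auto
    next
      case True
      then obtain s where s: "c = a + s *\<^sub>R (b - a)" by blast
      have s0: "s \<noteq> 0" using s ca by auto
      \<comment> \<open>If \<open>c\<close> lies on the line through \<open>a\<close> and
        \<open>b\<close>, a boundary point \<open>q\<close> off that line links the two factors:
        \<open>a\<close>, \<open>q\<close>, \<open>c\<close> and \<open>a\<close>, \<open>b\<close>,
        \<open>q\<close> are both non-collinear.\<close>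
      obtain q where q: "q \<in> ?S" "\<And>s. q \<noteq> a + s *\<^sub>R (b - a)"
        using frontier_point_off_line[OF dim ne, of "b - a" a] ab by auto
      have aq: "a \<noteq> q" using q(2)[of 0] by simp
      have "c \<noteq> a + t *\<^sub>R (q - a)" for t
      proof
        assume t: "c = a + t *\<^sub>R (q - a)"
        then have "t \<noteq> 0" using ca by auto
        moreover have "t *\<^sub>R (q - a) = s *\<^sub>R (b - a)" using s t by simp
        ultimately have "q - a = (s / t) *\<^sub>R (b - a)"
          by (metis divide_inverse_commute scaleR_left_imp_eq scaleR_scaleR nonzero_mult_div_cancel_left times_divide_eq_right)
        then have "q = a + (s / t) *\<^sub>R (b - a)" by (metis add.commute diff_add_cancel)
        then show False using q(2) by blast
      qed
      then have "l a c = l a q" by (intro triple[OF a q(1) c aq])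
      also have "\<dots> = l a b" using q(2) by (intro triple[OF a b(1) q(1) ab])
      finally show ?thesis by (simp add: m_def)
    qed
    then show ?thesis using l[OF c a] l_sym by simp
  qed simp
  have "m \<noteq> 0"
  proof
    assume "m = 0"
    then have "\<nu> x = \<nu> a" if "x \<in> ?S" for x using global[OF that] by simp
    then show False using normal_not_constant[OF ne] by blast
  qed
  moreover have "0 \<le> m" by (simp add: m_def l_def)
  ultimately have m: "0 < m" by simp
  \<comment> \<open>The centre of the homothety: \<open>x - z\<close> equals
    \<open>(1 / m) *\<^sub>R \<nu> x\<close> on the boundary, so the radius is
    \<open>1 / m\<close>.\<close>
  define z where "z = a - (1 / m) *\<^sub>R \<nu> a"
  have "dist z x = 1 / m" if x: "x \<in> ?S" for x
  proof -
    have "(1 / m) *\<^sub>R \<nu> x = (1 / m) *\<^sub>R (\<nu> a + m *\<^sub>R (x - a))" using global[OF x] by (metis add.commute diff_add_cancel)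
    also have "\<dots> = x - z" using m by (simp add: z_def scaleR_add_right)
    finally have "norm (x - z) = norm ((1 / m) *\<^sub>R \<nu> x)" by simp
    then show ?thesis using norm_normal[OF x] m by (simp add: dist_norm norm_minus_commute)
  qed
  then have "\<Omega> = ball z (1 / m)"
    using open_dom bounded_dom ne by (intro open_subset_cball_frontier_sphere[OF dim]) auto
  then show ?thesis using m by (intro exI[of _ z] exI[of _ "1 / m"]) simp
qed

text \<open>The field \<open>\<nu>\<close> is only assumed to be an admissible normal;
  \<open>normal_unique\<close> identifies it with the radial field, for which
  \<open>\<nu> x - \<nu> y\<close> is \<open>x - y\<close> divided by \<open>R\<close>.\<close>

lemma parallel_of_ball:
  assumes \<Omega>: "\<Omega> = ball c R" and R: "0 < R" and xy: "x \<in> frontier \<Omega>" "y \<in> frontier \<Omega>"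
  shows "(\<nu> x - \<nu> y) \<bullet> (x - y) = norm (\<nu> x - \<nu> y) * norm (x - y)"
proof -
  interpret B: C1_domain "ball c R" "\<lambda>x. (x - c) /\<^sub>R R" using R by (rule C1_domain_ball)
  have \<nu>: "\<nu> x = (x - c) /\<^sub>R R" if "x \<in> frontier \<Omega>" for x
    using that B.norm_normal B.normal_sides(1) unfolding \<Omega>
    by (intro normal_unique[unfolded \<Omega>]) auto
  have "\<nu> x - \<nu> y = (1 / R) *\<^sub>R (x - y)"
    unfolding \<nu>[OF xy(1)] \<nu>[OF xy(2)] by (simp add: scaleR_diff_right divide_inverse)
  then show ?thesis using R by (simp add: power2_norm_eq_inner[symmetric] power2_eq_square)
qed

end

section \<open>Domains of class \<open>C\<^sup>2\<close>\<close>

lemma C2_function_gradient: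
  assumes "C2_function g"
  obtains D where "C1_gradient g D"
proof -
  obtain g' :: "'a \<Rightarrow> 'a \<Rightarrow>\<^sub>L real" and g'' where g': "\<And>x. (g has_derivative blinfun_apply (g' x)) (at x)"
    "\<And>x. (g' has_derivative blinfun_apply (g'' x)) (at x)"
    using assms unfolding C2_function_def by blast
  define D where "D x = (\<Sum>b\<in>Basis. blinfun_apply (g' x) b *\<^sub>R b)" for x
  have D: "D x \<bullet> h = blinfun_apply (g' x) h" for x h
  proof -
    have "blinfun_apply (g' x) h = blinfun_apply (g' x) (\<Sum>b\<in>Basis. (h \<bullet> b) *\<^sub>R b)"
      by (simp add: euclidean_representation)
    also have "\<dots> = (\<Sum>b\<in>Basis. (h \<bullet> b) * blinfun_apply (g' x) b)"
      by (simp add: blinfun.sum_right blinfun.scaleR_right)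
    finally show ?thesis
      unfolding D_def inner_sum_left inner_scaleR_left by (simp add: inner_commute mult.commute)
  qed
  have "continuous_on UNIV g'"
    using g'(2) by (meson continuous_at_imp_continuous_on has_derivative_continuous)
  then have "continuous_on UNIV D" unfolding D_def[abs_def] by (intro continuous_intros)
  moreover have "blinfun_apply (g' x) = (\<lambda>h. D x \<bullet> h)" for x using D by auto
  ultimately have "C1_gradient g D" using g'(1) by (simp add: C1_gradient_def)
  then show ?thesis by (rule that)
qed

text \<open>Orthogonality to the velocities of curves on the boundary fixes the normal up to sign,
  and the side condition fixes the sign; so the prescribed \<open>\<nu>\<close> is the normalised
  negative gradient of \<open>\<Phi>\<close>.\<close>

lemma graph_normal:
  fixes \<Omega> :: "'a::euclidean_space set"
  assumes op: "open \<Omega>" and r: "0 < r" and e: "norm e = 1" and g: "C1_gradient g D"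
    and eq: "\<Omega> \<inter> ball p r = {x \<in> ball p r. g (x - (x \<bullet> e) *\<^sub>R e) < x \<bullet> e}"
    and n: "\<forall>x\<in>frontier \<Omega>. outward_unit_normal \<Omega> x (\<nu> x)"
  shows "\<exists>\<Phi> G. C1_patch \<Omega> \<nu> p r \<Phi> G"
proof -
  have ee: "e \<bullet> e = 1" using e by (simp add: norm_eq_1)
  define \<pi> where "\<pi> x = x - (x \<bullet> e) *\<^sub>R e" for x
  define \<Phi> where "\<Phi> x = x \<bullet> e - g (\<pi> x)" for x
  define G where "G x = e - (D (\<pi> x) - (D (\<pi> x) \<bullet> e) *\<^sub>R e)" for x
  have Ge: "G x \<bullet> e = 1" for x by (simp add: G_def inner_diff_left ee)
  have der: "(\<Phi> has_derivative (\<lambda>h. G x \<bullet> h)) (at x)" for x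
  proof -
    have "(\<pi> has_derivative (\<lambda>h. h - (h \<bullet> e) *\<^sub>R e)) (at x)"
      unfolding \<pi>_def[abs_def] by (auto intro!: derivative_eq_intros)
    moreover have "(g has_derivative (\<lambda>h. D (\<pi> x) \<bullet> h)) (at (\<pi> x))" using g by (simp add: C1_gradient_def)
    ultimately have "((\<lambda>x. g (\<pi> x)) has_derivative (\<lambda>h. D (\<pi> x) \<bullet> (h - (h \<bullet> e) *\<^sub>R e))) (at x)"
      by (rule has_derivative_compose)
    then have "(\<Phi> has_derivative (\<lambda>h. h \<bullet> e - D (\<pi> x) \<bullet> (h - (h \<bullet> e) *\<^sub>R e))) (at x)"
      unfolding \<Phi>_def[abs_def] by (auto intro!: derivative_eq_intros)
    moreover have "h \<bullet> e - D (\<pi> x) \<bullet> (h - (h \<bullet> e) *\<^sub>R e) = G x \<bullet> h" for h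
      by (simp add: G_def inner_diff_left inner_diff_right inner_commute)
    ultimately show ?thesis by simp
  qed
  have cont: "continuous_on S G" for S
    unfolding G_def \<pi>_def
    by (intro continuous_intros continuous_on_compose2[OF C1_gradient_continuous(2)[OF g, of UNIV]]) auto
  have dom: "\<Omega> \<inter> ball p r = {x \<in> ball p r. 0 < \<Phi> x}" unfolding eq by (auto simp: \<Phi>_def \<pi>_def)
  interpret T: transversal_patch \<Omega> p r \<Phi> G e
    by unfold_locales (use op der cont e Ge dom in auto)
  have "\<nu> x = - (G x /\<^sub>R norm (G x))" if x: "x \<in> frontier \<Omega> \<inter> ball p r" for x
  proof -
    define m where "m = \<nu> x"
    have out: "outward_unit_normal \<Omega> x m" using n x by (simp add: m_def)
    then have m1: "norm m = 1" by (simp add: outward_unit_normal_def)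
    have \<Phi>x: "\<Phi> x = 0" using T.frontier_iff x by blast
    define q where "q = D (\<pi> x)"
    have tangent: "m \<bullet> (h + (q \<bullet> h) *\<^sub>R e) = 0" if h: "h \<bullet> e = 0" for h
    proof -
      \<comment> \<open>The straight line with velocity \<open>h\<close> lifted to the graph of
        \<open>g\<close>. As \<open>h\<close> is orthogonal to \<open>e\<close>,
        \<open>\<Phi>\<close> is constant along it, and its velocity is
        \<open>h + (q \<bullet> h) *\<^sub>R e\<close>.\<close>
      define c where "c t = x + t *\<^sub>R h + (g (\<pi> x + t *\<^sub>R h) - g (\<pi> x)) *\<^sub>R e" for t
      have c0: "c 0 = x" by (simp add: c_def)
      have "((\<lambda>t. \<pi> x + t *\<^sub>R h) has_derivative (\<lambda>s. s *\<^sub>R h)) (at 0)"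
        by (auto intro!: derivative_eq_intros)
      moreover have "(g has_derivative (\<lambda>k. q \<bullet> k)) (at (\<pi> x + 0 *\<^sub>R h))" using g by (simp add: C1_gradient_def q_def)
      ultimately have "((\<lambda>t. g (\<pi> x + t *\<^sub>R h)) has_derivative (\<lambda>s. q \<bullet> (s *\<^sub>R h))) (at 0)"
        by (rule has_derivative_compose)
      then have "(c has_derivative (\<lambda>s. s *\<^sub>R h + (q \<bullet> (s *\<^sub>R h)) *\<^sub>R e)) (at 0)"
        unfolding c_def[abs_def] by (auto intro!: derivative_eq_intros)
      then have vd: "(c has_vector_derivative h + (q \<bullet> h) *\<^sub>R e) (at 0)"
        unfolding has_vector_derivative_def by (simp add: scaleR_add_right)
      then have "isCont c 0" by (rule has_vector_derivative_continuous)
      moreover have "open (ball p r)" "c 0 \<in> ball p r" using x c0 by auto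
      ultimately have "\<forall>\<^sub>F t in at 0. c t \<in> ball p r"
        unfolding isCont_def by (rule topological_tendstoD)
      then obtain \<epsilon> where \<epsilon>: "0 < \<epsilon>" "\<And>t. t \<noteq> 0 \<Longrightarrow> \<bar>t\<bar> < \<epsilon> \<Longrightarrow> c t \<in> ball p r"
        by (auto simp: eventually_at dist_real_def)
      have "c t \<in> frontier \<Omega>" if "t \<in> {-\<epsilon><..<\<epsilon>}" for t
      proof -
        have B: "c t \<in> ball p r" using \<epsilon>(2)[of t] that c0 x by (cases "t = 0") auto
        have ce: "c t \<bullet> e = x \<bullet> e + (g (\<pi> x + t *\<^sub>R h) - g (\<pi> x))" by (simp add: c_def inner_add_left h ee)
        have "\<pi> (c t) = \<pi> x + t *\<^sub>R h"
          unfolding \<pi>_def[of "c t"] ce by (simp add: c_def \<pi>_def algebra_simps)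
        then have "\<Phi> (c t) = \<Phi> x" by (simp add: \<Phi>_def ce)
        then show ?thesis using T.frontier_iff[OF B] \<Phi>x by simp
      qed
      then have "h + (q \<bullet> h) *\<^sub>R e \<in> tangent_vectors (frontier \<Omega>) x"
        unfolding tangent_vectors_def using \<epsilon>(1) c0 vd by blast
      then show ?thesis using out by (simp add: outward_unit_normal_def)
    qed
    define \<alpha> where "\<alpha> = m \<bullet> e"
    \<comment> \<open>The component of \<open>m + \<alpha> *\<^sub>R q\<close> orthogonal to
      \<open>e\<close>. Tested with this \<open>h\<close>, tangency reads
      \<open>h \<bullet> h = 0\<close>, and \<open>h = 0\<close> says that \<open>m\<close> is
      \<open>\<alpha>\<close> times the gradient.\<close>
    define h where "h = (m - \<alpha> *\<^sub>R e) + \<alpha> *\<^sub>R (q - (q \<bullet> e) *\<^sub>R e)"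
    have he: "h \<bullet> e = 0" by (simp add: h_def \<alpha>_def inner_add_left inner_diff_left ee)
    have "m \<bullet> h + \<alpha> * (q \<bullet> h) = 0"
      using tangent[OF he] by (simp add: inner_add_right \<alpha>_def mult.commute)
    moreover have "h \<bullet> h = m \<bullet> h + \<alpha> * (q \<bullet> h)"
    proof -
      have "h \<bullet> h = m \<bullet> h - \<alpha> * (e \<bullet> h) + \<alpha> * (q \<bullet> h - (q \<bullet> e) * (e \<bullet> h))"
        by (subst (1) h_def) (simp add: inner_add_left inner_diff_left)
      then show ?thesis using he by (simp add: inner_commute)
    qed
    ultimately have "h = 0" by simp
    then have m: "m = \<alpha> *\<^sub>R G x"
      by (simp add: h_def G_def q_def algebra_simps add_eq_0_iff)
    have G0: "0 < norm (G x)" using Ge[of x] by auto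
    have \<alpha>n: "\<bar>\<alpha>\<bar> * norm (G x) = 1" using m1 m by simp
    have "\<not> 0 < \<alpha>"
    proof
      \<comment> \<open>Then \<open>\<Phi>\<close> would decrease from 0 in direction
        \<open>- m\<close>, whereas the side condition puts these points inside the domain.\<close>
      assume \<alpha>: "0 < \<alpha>"
      have "((\<lambda>t. x + t *\<^sub>R (- m)) has_derivative (\<lambda>s. s *\<^sub>R (- m))) (at 0)"
        by (auto intro!: derivative_eq_intros)
      moreover have "(\<Phi> has_derivative (\<lambda>h. G x \<bullet> h)) (at (x + 0 *\<^sub>R (- m)))" using der by simp
      ultimately have "((\<lambda>t. \<Phi> (x + t *\<^sub>R (- m))) has_derivative (\<lambda>s. G x \<bullet> (s *\<^sub>R (- m)))) (at 0)"
        by (rule has_derivative_compose)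
      moreover have "(\<lambda>s. G x \<bullet> (s *\<^sub>R (- m))) = (*) (G x \<bullet> (- m))" by auto
      ultimately have "((\<lambda>t. \<Phi> (x + t *\<^sub>R (- m))) has_real_derivative G x \<bullet> (- m)) (at 0)"
        by (simp only: has_field_derivative_def)
      moreover have "G x \<bullet> (- m) < 0"
        using \<alpha> G0 by (simp add: m)
      ultimately obtain d where d: "0 < d" "\<And>t. 0 < t \<Longrightarrow> t < d \<Longrightarrow> \<Phi> (x + t *\<^sub>R (- m)) < 0"
        using DERIV_neg_dec_right[of "\<lambda>t. \<Phi> (x + t *\<^sub>R (- m))" "G x \<bullet> (- m)" 0] \<Phi>x by auto
      obtain \<epsilon> where \<epsilon>: "0 < \<epsilon>" "\<And>t. 0 < t \<Longrightarrow> t < \<epsilon> \<Longrightarrow> x - t *\<^sub>R m \<in> \<Omega>"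
        using out by (auto simp: outward_unit_normal_def)
      obtain s where s: "0 < s" "ball x s \<subseteq> ball p r" using x by (metis IntD2 open_ball open_contains_ball)
      define t where "t = min (min d \<epsilon>) s / 2"
      have t: "0 < t" "t < d" "t < \<epsilon>" "t < s" using d(1) \<epsilon>(1) s(1) by (auto simp: t_def min_def)
      have "x - t *\<^sub>R m \<in> ball x s" using t m1 by (simp add: dist_norm)
      then have "x - t *\<^sub>R m \<in> ball p r" using s by blast
      then have "0 < \<Phi> (x - t *\<^sub>R m)" using \<epsilon>(2)[OF t(1,3)] T.dom_iff by blast
      then show False using d(2)[OF t(1,2)] by simp
    qed
    then have "\<alpha> = - (1 / norm (G x))" using \<alpha>n G0 by (simp add: field_simps abs_if split: if_splits)
    then show ?thesis using m by (simp add: m_def divide_inverse)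
  qed
  then have "C1_patch \<Omega> \<nu> p r \<Phi> G"
    unfolding C1_patch_def using r der cont dom T.grad_nonzero by blast
  then show ?thesis by blast
qed

lemma C1_domain_of_C2:
  assumes \<Omega>: "bounded_C2_domain \<Omega>" and n: "\<forall>x\<in>frontier \<Omega>. outward_unit_normal \<Omega> x (\<nu> x)"
  shows "C1_domain \<Omega> \<nu>"
proof
  show "open \<Omega>" "bounded \<Omega>" using \<Omega> by (auto simp: bounded_C2_domain_def)
  fix p assume "p \<in> frontier \<Omega>"
  then obtain r e g where g: "0 < r" "norm e = 1" "C2_function g"
    "\<Omega> \<inter> ball p r = {x \<in> ball p r. g (x - (x \<bullet> e) *\<^sub>R e) < x \<bullet> e}"
    using \<Omega> unfolding bounded_C2_domain_def C2_boundary_def by meson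
  obtain D where "C1_gradient g D" using C2_function_gradient[OF g(3)] .
  then show "\<exists>r \<Phi> G. C1_patch \<Omega> \<nu> p r \<Phi> G"
    using graph_normal[OF \<open>open \<Omega>\<close> g(1,2) _ g(4) n] by blast
qed

theorem mainTheorem3:
  fixes \<Omega> :: "'a::euclidean_space set" and \<nu> :: "'a \<Rightarrow> 'a"
  assumes "DIM('a) \<ge> 3"
    and "bounded_C2_domain \<Omega>"
    and "\<forall>x \<in> frontier \<Omega>. outward_unit_normal \<Omega> x (\<nu> x)"
  shows "let \<sigma> = surface_measure (frontier \<Omega>);
             lhs = (\<integral>\<^sup>+ y. (\<integral>\<^sup>+ x. ennreal (norm (\<nu> x - \<nu> y) / norm (x - y) ^ (DIM('a) - 1)) \<partial>\<sigma>) \<partial>\<sigma>);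
             rhs = emeasure \<sigma> (frontier \<Omega>) *
                   emeasure (surface_measure (sphere (0::'a) 1)) (sphere 0 1)
         in lhs \<ge> rhs \<and> (lhs = rhs \<longleftrightarrow> (\<exists>c r. 0 < r \<and> \<Omega> = ball c r))"
proof -
  interpret C1_domain \<Omega> \<nu> using assms(2,3) by (rule C1_domain_of_C2)
  interpret finite_measure \<sigma> by (rule finite_measure_surface)
  have rhs: "emeasure \<sigma> (frontier \<Omega>) * emeasure (surface_measure (sphere (0::'a) 1)) (sphere 0 1) = ennreal sharp_value"
    unfolding emeasure_eq_measure emeasure_sphere sharp_value_def
    by (simp add: ennreal_mult sphere_area_def)
  have lhs: "(\<integral>\<^sup>+ y. (\<integral>\<^sup>+ x. ennreal (norm (\<nu> x - \<nu> y) / norm (x - y) ^ (DIM('a) - 1)) \<partial>\<sigma>) \<partial>\<sigma>) = energy"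
    by (simp only: energy_def energy_kernel_def)
  have "energy = ennreal sharp_value \<longleftrightarrow> (\<exists>c r. 0 < r \<and> \<Omega> = ball c r)"
  proof
    assume eq: "energy = ennreal sharp_value"
    show "\<exists>c r. 0 < r \<and> \<Omega> = ball c r"
      using assms(1,2) parallel_of_energy_eq[OF eq]
      by (intro ball_of_parallel) (auto simp: bounded_C2_domain_def)
  next
    assume "\<exists>c r. 0 < r \<and> \<Omega> = ball c r"
    then obtain c r where "0 < r" "\<Omega> = ball c r" by blast
    then have "energy \<le> ennreal sharp_value"
      using parallel_of_ball by (intro energy_le_sharp_value) blast
    then show "energy = ennreal sharp_value" using sharp_value_le_energy by (rule antisym)
  qed
  then show ?thesis
    unfolding Let_def lhs rhs using sharp_value_le_energy by blast
qed

end
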